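(* Let $\mathfrak{H}$ be a complex Hilbert space and let $A$ and $H$ be self-adjoint operators in $\mathfrak{H}$ such that $\inf\operatorname{spec}(A)>0$ and $H$ is bounded and has a bounded inverse. Let $\mathfrak{b}$ be the symmetric sesquilinear form $$\mathfrak{b}[x,y]=\langle A^{1/2}x,HA^{1/2}y\rangle,\qquad x,y\in\operatorname{Dom}[\mathfrak{b}]=\operatorname{Dom}(A^{1/2}),$$ and let $B:=A^{1/2}HA^{1/2}$ be the self-adjoint operator with domain $\operatorname{Dom}(B)=\{x\in\operatorname{Dom}(A^{1/2})\mid HA^{1/2}x\in\operatorname{Dom}(A^{1/2})\}$. If $\operatorname{Dom}(A^{1/2})=\operatorname{Dom}(|B|^{1/2})$, then $$\mathfrak{b}[x,y]=\langle |B|^{1/2}x,\operatorname{sign}(B)|B|^{1/2}y\rangle\quad\text{for all } x,y\in\operatorname{Dom}[\mathfrak{b}]=\operatorname{Dom}(|B|^{1/2}).$$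
   Context: Inner products and sesquilinear forms are linear in the second argument and conjugate-linear in the first. The operator $B$ is self-adjoint with a bounded inverse, and it is the unique self-adjoint operator with $\operatorname{Dom}(B)\subset\operatorname{Dom}[\mathfrak{b}]$ and $\mathfrak{b}[x,y]=\langle x,By\rangle$ for all $x\in\operatorname{Dom}[\mathfrak{b}]$, $y\in\operatorname{Dom}(B)$. The operators $|B|$, $|B|^{1/2}$ and $\operatorname{sign}(B)$ are defined by the functional calculus; $\operatorname{sign}(B)$ is a self-adjoint unitary involution. *)

theory Defs
  imports "HOL-Analysis.Analysis"
begin

section \<open>Complex Hilbert spaces\<close>

text \<open>The superclass \<open>real_inner\<close> only provides the underlying real structure: the last axiom and
  polarization force \<open>inner x y = Re (cinner x y)\<close>.\<close>

class complex_hilbert_space = real_inner + complete_space +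
  fixes scaleC :: "complex \<Rightarrow> 'a \<Rightarrow> 'a" (infixr "*\<^sub>C" 75)
    and cinner :: "'a \<Rightarrow> 'a \<Rightarrow> complex" ("\<langle>_, _\<rangle>")
  assumes scaleC_add_right: "c *\<^sub>C (x + y) = c *\<^sub>C x + c *\<^sub>C y"
    and scaleC_add_left: "(c + d) *\<^sub>C x = c *\<^sub>C x + d *\<^sub>C x"
    and scaleC_scaleC: "c *\<^sub>C (d *\<^sub>C x) = (c * d) *\<^sub>C x"
    and scaleC_one: "1 *\<^sub>C x = x"
    and scaleR_eq_scaleC: "r *\<^sub>R x = complex_of_real r *\<^sub>C x"
    and cinner_commute: "\<langle>x, y\<rangle> = cnj \<langle>y, x\<rangle>"
    and cinner_add_right: "\<langle>x, y + z\<rangle> = \<langle>x, y\<rangle> + \<langle>x, z\<rangle>"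
    and cinner_scaleC_right: "\<langle>x, c *\<^sub>C y\<rangle> = c * \<langle>x, y\<rangle>"
    and cinner_self: "\<langle>x, x\<rangle> = complex_of_real ((norm x)\<^sup>2)"

instantiation complex :: complex_hilbert_space
begin

definition scaleC_complex :: "complex \<Rightarrow> complex \<Rightarrow> complex"
  where "scaleC_complex c x = c * x"

definition cinner_complex :: "complex \<Rightarrow> complex \<Rightarrow> complex"
  where "cinner_complex x y = cnj x * y"

instance
proof
  fix c d x y z :: complex and r :: real
  show "c *\<^sub>C (x + y) = c *\<^sub>C x + c *\<^sub>C y"
    by (simp add: scaleC_complex_def distrib_left)
  show "(c + d) *\<^sub>C x = c *\<^sub>C x + d *\<^sub>C x"
    by (simp add: scaleC_complex_def distrib_right)
  show "c *\<^sub>C (d *\<^sub>C x) = (c * d) *\<^sub>C x"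
    by (simp add: scaleC_complex_def)
  show "1 *\<^sub>C x = x"
    by (simp add: scaleC_complex_def)
  show "r *\<^sub>R x = complex_of_real r *\<^sub>C x"
    by (simp add: scaleC_complex_def scaleR_conv_of_real)
  show "\<langle>x, y\<rangle> = cnj \<langle>y, x\<rangle>"
    by (simp add: cinner_complex_def)
  show "\<langle>x, y + z\<rangle> = \<langle>x, y\<rangle> + \<langle>x, z\<rangle>"
    by (simp add: cinner_complex_def distrib_left)
  show "\<langle>x, c *\<^sub>C y\<rangle> = c * \<langle>x, y\<rangle>"
    by (simp add: cinner_complex_def scaleC_complex_def)
  show "\<langle>x, x\<rangle> = complex_of_real ((norm x)\<^sup>2)"
    by (subst complex_norm_square) (simp add: cinner_complex_def)
qed

end

section \<open>Unbounded operators\<close>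

text \<open>A (partially defined) operator is identified with its graph. Its domain is \<open>Domain T\<close>, its
  inverse \<open>T\<inverse>\<close>, and the product \<open>S T\<close> (first \<open>T\<close>, then \<open>S\<close>) is \<open>T O S\<close>.\<close>

type_synonym 'a operator = "('a \<times> 'a) set"

definition op_app :: "'a operator \<Rightarrow> 'a \<Rightarrow> 'a" (infixr "\<cdot>" 80)
  where "T \<cdot> x = (THE y. (x, y) \<in> T)"

definition linear_operator :: "'a::complex_hilbert_space operator \<Rightarrow> bool" where
  "linear_operator T \<longleftrightarrow> single_valued T \<and> (0, 0) \<in> T \<and>
     (\<forall>x y x' y'. (x, y) \<in> T \<longrightarrow> (x', y') \<in> T \<longrightarrow> (x + x', y + y') \<in> T) \<and>
     (\<forall>c x y. (x, y) \<in> T \<longrightarrow> (c *\<^sub>C x, c *\<^sub>C y) \<in> T)"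

definition adjoint_operator :: "'a::complex_hilbert_space operator \<Rightarrow> 'a operator" where
  "adjoint_operator T = {(y, z). \<forall>(x, w) \<in> T. \<langle>w, y\<rangle> = \<langle>x, z\<rangle>}"

definition self_adjoint :: "'a::complex_hilbert_space operator \<Rightarrow> bool" where
  "self_adjoint T \<longleftrightarrow>
     linear_operator T \<and> closure (Domain T) = UNIV \<and> adjoint_operator T = T"

definition bounded_operator :: "'a::complex_hilbert_space operator \<Rightarrow> bool" where
  "bounded_operator T \<longleftrightarrow> (\<exists>c. \<forall>(x, y) \<in> T. norm y \<le> c * norm x)"

definition has_bounded_inverse :: "'a::complex_hilbert_space operator \<Rightarrow> bool" where
  "has_bounded_inverse T \<longleftrightarrow>
     single_valued (T\<inverse>) \<and> Domain (T\<inverse>) = UNIV \<and> bounded_operator (T\<inverse>)"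

definition spectrum :: "'a::complex_hilbert_space operator \<Rightarrow> complex set" where
  "spectrum T = {l. \<not> has_bounded_inverse {(x, y - l *\<^sub>C x) | x y. (x, y) \<in> T}}"

section \<open>Spectral measures and the functional calculus\<close>

definition orthogonal_projection :: "('a::complex_hilbert_space \<Rightarrow> 'a) \<Rightarrow> bool" where
  "orthogonal_projection P \<longleftrightarrow>
     (\<forall>x y. P (x + y) = P x + P y) \<and> (\<forall>c x. P (c *\<^sub>C x) = c *\<^sub>C P x) \<and>
     P \<circ> P = P \<and> (\<forall>x y. \<langle>P x, y\<rangle> = \<langle>x, P y\<rangle>)"

text \<open>Only the values of \<open>E\<close> on Borel sets are constrained.\<close>

definition projection_valued_measure ::
    "(real set \<Rightarrow> 'a::complex_hilbert_space \<Rightarrow> 'a) \<Rightarrow> bool" where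
  "projection_valued_measure E \<longleftrightarrow>
     (\<forall>S \<in> sets borel. orthogonal_projection (E S)) \<and>
     E UNIV = id \<and>
     (\<forall>S \<in> sets borel. \<forall>S' \<in> sets borel. E (S \<inter> S') = E S \<circ> E S') \<and>
     (\<forall>F x. range F \<subseteq> sets borel \<longrightarrow> disjoint_family F \<longrightarrow>
        (\<lambda>n::nat. E (F n) x) sums E (\<Union>n. F n) x)"

text \<open>The finite Borel measure mapping \<open>S\<close> to \<open>\<langle>x, E S x\<rangle> = \<parallel>E S x\<parallel>\<^sup>2\<close>.\<close>

definition scalar_measure ::
    "(real set \<Rightarrow> 'a::complex_hilbert_space \<Rightarrow> 'a) \<Rightarrow> 'a \<Rightarrow> real measure" where
  "scalar_measure E x = measure_of UNIV (sets borel) (\<lambda>S. ennreal ((norm (E S x))\<^sup>2))"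

definition spectral_integral_domain ::
    "(real set \<Rightarrow> 'a::complex_hilbert_space \<Rightarrow> 'a) \<Rightarrow> (real \<Rightarrow> complex) \<Rightarrow> 'a set" where
  "spectral_integral_domain E f =
     {x. integrable (scalar_measure E x) (\<lambda>t. (norm (f t))\<^sup>2)}"

text \<open>The integral of \<open>f\<close> against the complex measure mapping \<open>S\<close> to \<open>\<langle>x, E S y\<rangle>\<close>; that measure is
  the combination of finite positive measures given by the polarization identity
  \<open>4 \<langle>x, P y\<rangle> = (\<Sum>k<4. \<i>^k * \<parallel>P (y + \<i>^k x)\<parallel>\<^sup>2)\<close> for orthogonal projections \<open>P\<close>.\<close>

definition sesquilinear_integral ::
    "(real set \<Rightarrow> 'a::complex_hilbert_space \<Rightarrow> 'a) \<Rightarrow> (real \<Rightarrow> complex) \<Rightarrow> 'a \<Rightarrow> 'a \<Rightarrow> complex" where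
  "sesquilinear_integral E f x y =
     (\<Sum>k<4::nat. \<i> ^ k * (LINT t | scalar_measure E (y + (\<i> ^ k) *\<^sub>C x). f t)) / 4"

text \<open>The operator \<open>\<integral> f dE\<close> for a Borel function \<open>f\<close>. Its domain is dense, so testing with \<open>x\<close> in
  the domain determines the value \<open>z\<close> at \<open>y\<close>, and for such \<open>x\<close> all four integrals above converge.\<close>

definition spectral_integral ::
    "(real set \<Rightarrow> 'a::complex_hilbert_space \<Rightarrow> 'a) \<Rightarrow> (real \<Rightarrow> complex) \<Rightarrow> 'a operator" where
  "spectral_integral E f =
     {(y, z). y \<in> spectral_integral_domain E f \<and>
        (\<forall>x \<in> spectral_integral_domain E f. \<langle>x, z\<rangle> = sesquilinear_integral E f x y)}"

text \<open>By the spectral theorem a self-adjoint \<open>T\<close> has a spectral measure, unique on Borel sets; the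
  choice operator therefore only selects irrelevant values outside the Borel sets.\<close>

definition spectral_measure ::
    "'a::complex_hilbert_space operator \<Rightarrow> real set \<Rightarrow> 'a \<Rightarrow> 'a" where
  "spectral_measure T =
     (SOME E. projection_valued_measure E \<and> spectral_integral E complex_of_real = T)"

definition functional_calculus ::
    "(real \<Rightarrow> complex) \<Rightarrow> 'a::complex_hilbert_space operator \<Rightarrow> 'a operator" where
  "functional_calculus f T = spectral_integral (spectral_measure T) f"

text \<open>The square root is meant for nonnegative \<open>T\<close>.\<close>

definition op_sqrt :: "'a::complex_hilbert_space operator \<Rightarrow> 'a operator" where
  "op_sqrt = functional_calculus (\<lambda>t. complex_of_real (sqrt t))"

definition op_sqrt_abs :: "'a::complex_hilbert_space operator \<Rightarrow> 'a operator" where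
  "op_sqrt_abs = functional_calculus (\<lambda>t. complex_of_real (sqrt \<bar>t\<bar>))"

definition op_sign :: "'a::complex_hilbert_space operator \<Rightarrow> 'a operator" where
  "op_sign = functional_calculus (\<lambda>t. complex_of_real (sgn t))"

end

theory Submission imports Defs "HOL-Probability.Helly_Selection" begin

text \<open>\<open>A\<close> and \<open>B\<close> are inverses of bounded injective symmetric operators, so each has a spectral measure:
  after an affine change of variable, the Bernstein weights of \<open>0 \<le> R \<le> 1\<close> give discrete measures whose
  weak limit (Helly) has the moments \<open>\<langle>x, R\<^sup>n x\<rangle>\<close>, polynomials in \<open>R\<close> extend isometrically to
  \<open>L\<^sup>2\<close> of these measures, and indicator functions yield the projections. The two forms agree when the
  second argument lies in \<open>Dom(B)\<close>, where both equal \<open>\<langle>x, B y\<rangle>\<close>. Since \<open>Dom(A\<^sup>1\<^sup>/\<^sup>2) = Dom(|B|\<^sup>1\<^sup>/\<^sup>2)\<close>, the operator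
  \<open>A\<^sup>1\<^sup>/\<^sup>2 |B|\<^sup>-\<^sup>1\<^sup>/\<^sup>2\<close> is everywhere defined, hence bounded by the closed graph theorem, so
  spectral cutoffs \<open>y\<^sub>n \<in> Dom(B)\<close> of \<open>y\<close> converge to \<open>y\<close> in both form norms.\<close>

section \<open>Inner products\<close>

text \<open>The operators in the statement come from a spectral measure picked by
  \<open>SOME\<close>, about which nothing can be said before one is shown to exist; hence the
  weight of the existence part. \<open>A\<close> has a bounded inverse because 0 lies outside its
  spectrum, and the inverse of \<open>B\<close> can be written down as A^(-1/2) H^(-1) A^(-1/2).
  Bounded symmetric \<open>T\<close> is therefore treated through (T + M)/(2M), where
  \<open>M\<close> bounds \<open>T\<close>, and the measure is transported by t -> 1/(2Mt - M).
  Bernstein weights serve because their positivity follows by pulling out squares, at a stage where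
  no square root of \<open>R\<close> is at hand. All integrands are real; complex values return
  through polarization. One completion scheme is used twice: polynomials give the projections,
  simple functions give the integrals of unbounded functions. Convergence of the cutoffs in the form
  norm of |B|^(1/2) by itself says nothing about A^(1/2); the bound on A^(1/2) |B|^(-1/2) carries it
  over. The closed graph argument runs through the formal adjoint |B|^(-1/2) A^(1/2), given on the
  dense set Dom(A^(1/2)).\<close>

lemma cinner_add_left: "\<langle>x + y, z\<rangle> = \<langle>x, z\<rangle> + \<langle>y, z\<rangle>"
  by (metis cinner_add_right cinner_commute complex_cnj_add)

lemma cinner_scaleC_left: "\<langle>c *\<^sub>C x, y\<rangle> = cnj c * \<langle>x, y\<rangle>"
  by (metis cinner_commute cinner_scaleC_right complex_cnj_mult)

lemma cinner_scaleR_right: "\<langle>x, r *\<^sub>R y\<rangle> = of_real r * \<langle>x, y\<rangle>"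
  by (simp add: scaleR_eq_scaleC cinner_scaleC_right)

lemma cinner_scaleR_left: "\<langle>r *\<^sub>R x, y\<rangle> = of_real r * \<langle>x, y\<rangle>"
  by (simp add: scaleR_eq_scaleC cinner_scaleC_left)

lemma cinner_zero_right [simp]: "\<langle>x, 0\<rangle> = 0"
  using cinner_scaleR_right[of x 0 "0"] by simp

lemma cinner_zero_left [simp]: "\<langle>0, x\<rangle> = 0"
  using cinner_scaleR_left[of 0 0 x] by simp

lemma cinner_minus_right: "\<langle>x, - y\<rangle> = - \<langle>x, y\<rangle>"
  using cinner_scaleR_right[of x "-1" y] by simp

lemma cinner_minus_left: "\<langle>- x, y\<rangle> = - \<langle>x, y\<rangle>"
  using cinner_scaleR_left[of "-1" x y] by simp

lemma cinner_diff_right: "\<langle>x, y - z\<rangle> = \<langle>x, y\<rangle> - \<langle>x, z\<rangle>"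
  using cinner_add_right[of x y "- z"] by (simp add: cinner_minus_right)

lemma cinner_diff_left: "\<langle>x - y, z\<rangle> = \<langle>x, z\<rangle> - \<langle>y, z\<rangle>"
  using cinner_add_left[of x "- y" z] by (simp add: cinner_minus_left)

lemma cinner_sum_right: "\<langle>x, \<Sum>i\<in>I. f i\<rangle> = (\<Sum>i\<in>I. \<langle>x, f i\<rangle>)"
  by (induction I rule: infinite_finite_induct) (auto simp: cinner_add_right)

lemma scaleC_zero_left [simp]: "0 *\<^sub>C x = 0"
  using scaleR_eq_scaleC[of 0 x] by simp

lemma scaleC_zero_right [simp]: "c *\<^sub>C 0 = 0"
  using scaleC_add_right[of c 0 0] by simp

lemma scaleC_minus_right: "c *\<^sub>C (- x) = - (c *\<^sub>C x)"
  using scaleC_add_right[of c x "- x"] by (simp add: eq_neg_iff_add_eq_0 add.commute)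

lemma scaleC_diff_right: "c *\<^sub>C (x - y) = c *\<^sub>C x - c *\<^sub>C y"
  using scaleC_add_right[of c x "- y"] by (simp add: scaleC_minus_right)

lemma scaleC_scaleR_commute: "c *\<^sub>C (r *\<^sub>R x) = r *\<^sub>R (c *\<^sub>C x)"
  by (simp add: scaleR_eq_scaleC scaleC_scaleC mult.commute)

lemma norm_scaleC: "norm (c *\<^sub>C x) = cmod c * norm x"
proof -
  have "complex_of_real ((norm (c *\<^sub>C x))\<^sup>2) = (cnj c * c) * complex_of_real ((norm x)\<^sup>2)"
    by (simp only: cinner_self[symmetric] cinner_scaleC_left cinner_scaleC_right mult_ac)
  also have "\<dots> = complex_of_real ((cmod c * norm x)\<^sup>2)"
    by (simp add: power_mult_distrib mult.commute complex_norm_square[symmetric])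
  finally show ?thesis
    by (metis norm_ge_zero of_real_eq_iff mult_nonneg_nonneg power2_eq_iff_nonneg)
qed

lemma cinner_eqI: "(\<And>x. \<langle>x, y\<rangle> = \<langle>x, z\<rangle>) \<Longrightarrow> y = z"
  by (metis cinner_diff_right cinner_self diff_self eq_iff_diff_eq_0 norm_eq_zero of_real_eq_0_iff
      power_eq_0_iff)

text \<open>Comparing the two expansions of the squared norm of \<open>x + y\<close> identifies the
  real structure; the real Cauchy-Schwarz inequality then becomes available for
  \<open>cinner\<close>.\<close>

lemma Re_cinner: "Re \<langle>x, y\<rangle> = inner x y"
proof -
  have "complex_of_real ((norm (x + y))\<^sup>2) = \<langle>x, x\<rangle> + \<langle>y, y\<rangle> + (\<langle>x, y\<rangle> + cnj \<langle>x, y\<rangle>)"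
    unfolding cinner_self[symmetric] cinner_commute[of y x, symmetric]
    by (simp add: cinner_add_left cinner_add_right add_ac)
  also have "\<dots> = complex_of_real ((norm x)\<^sup>2 + (norm y)\<^sup>2 + 2 * Re \<langle>x, y\<rangle>)"
    by (simp add: cinner_self complex_add_cnj)
  finally have "(norm (x + y))\<^sup>2 = (norm x)\<^sup>2 + (norm y)\<^sup>2 + 2 * Re \<langle>x, y\<rangle>"
    using of_real_eq_iff by blast
  then show ?thesis
    by (simp add: power2_norm_eq_inner inner_add_left inner_add_right inner_commute)
qed

lemma norm_cinner_le: "cmod \<langle>x, y\<rangle> \<le> norm x * norm y"
proof (cases "\<langle>x, y\<rangle> = 0")
  case False
  \<comment> \<open>Multiplying \<open>y\<close> by this unimodular factor makes the inner product
    real and nonnegative, so it equals a real inner product.\<close>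
  define c where "c = cnj \<langle>x, y\<rangle> / cmod \<langle>x, y\<rangle>"
  have c: "cmod c = 1" using False by (simp add: c_def norm_divide)
  have "\<langle>x, c *\<^sub>C y\<rangle> = cmod \<langle>x, y\<rangle>"
    using False
    by (simp add: cinner_scaleC_right c_def divide_simps complex_norm_square[symmetric] mult.commute power2_eq_square)
  then have "cmod \<langle>x, y\<rangle> = inner x (c *\<^sub>C y)"
    by (metis Re_cinner Re_complex_of_real)
  also have "\<dots> \<le> norm x * norm (c *\<^sub>C y)" by (rule norm_cauchy_schwarz)
  finally show ?thesis by (simp add: norm_scaleC c)
qed simp

lemma tendsto_cinner:
  assumes "(f \<longlongrightarrow> x) F" "(g \<longlongrightarrow> y) F"
  shows "((\<lambda>n. \<langle>f n, g n\<rangle>) \<longlongrightarrow> \<langle>x, y\<rangle>) F"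
proof -
  have *: "((\<lambda>n. norm (f n - x) * norm (g n) + norm x * norm (g n - y)) \<longlongrightarrow> 0 * norm y + norm x * 0) F"
    by (intro tendsto_add tendsto_mult tendsto_norm assms tendsto_const tendsto_norm_zero LIM_zero)
  have "((\<lambda>n. \<langle>f n, g n\<rangle> - \<langle>x, y\<rangle>) \<longlongrightarrow> 0) F"
  proof (rule Lim_null_comparison)
    show "\<forall>\<^sub>F n in F. cmod (\<langle>f n, g n\<rangle> - \<langle>x, y\<rangle>) \<le> norm (f n - x) * norm (g n) + norm x * norm (g n - y)"
    proof (intro always_eventually allI)
      fix n
      have "\<langle>f n, g n\<rangle> - \<langle>x, y\<rangle> = \<langle>f n - x, g n\<rangle> + \<langle>x, g n - y\<rangle>"
        by (simp add: cinner_diff_left cinner_diff_right)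
      then show "cmod (\<langle>f n, g n\<rangle> - \<langle>x, y\<rangle>) \<le> norm (f n - x) * norm (g n) + norm x * norm (g n - y)"
        by (metis add_mono norm_cinner_le norm_triangle_mono)
    qed
  qed (use * in simp)
  then show ?thesis by (rule LIM_zero_cancel)
qed

lemma tendsto_scaleC:
  assumes "(f \<longlongrightarrow> x) F"
  shows "((\<lambda>n. c *\<^sub>C f n) \<longlongrightarrow> (c *\<^sub>C x :: 'a::complex_hilbert_space)) F"
proof -
  have *: "((\<lambda>n. cmod c * norm (f n - x)) \<longlongrightarrow> 0) F"
    by (intro tendsto_mult_right_zero tendsto_norm_zero LIM_zero assms)
  have "((\<lambda>n. c *\<^sub>C f n - c *\<^sub>C x) \<longlongrightarrow> 0) F"
    by (rule Lim_null_comparison[OF always_eventually *])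
       (auto simp: norm_scaleC simp flip: scaleC_diff_right)
  then show ?thesis by (rule LIM_zero_cancel)
qed

lemma cinner_eqI_dense:
  assumes "closure D = UNIV" and eq: "\<And>x. x \<in> D \<Longrightarrow> \<langle>x, y\<rangle> = \<langle>x, z\<rangle>"
  shows "y = z"
proof (rule cinner_eqI)
  fix x
  obtain f where f: "\<And>n. f n \<in> D" "f \<longlonglongrightarrow> x"
    using assms(1) closure_sequential[of x D] by auto
  have "(\<lambda>n. \<langle>f n, y\<rangle>) \<longlonglongrightarrow> \<langle>x, z\<rangle>"
    unfolding eq[OF f(1)] by (intro tendsto_cinner f tendsto_const)
  moreover have "(\<lambda>n. \<langle>f n, y\<rangle>) \<longlonglongrightarrow> \<langle>x, y\<rangle>"
    by (intro tendsto_cinner f tendsto_const)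
  ultimately show "\<langle>x, y\<rangle> = \<langle>x, z\<rangle>" using LIMSEQ_unique by blast
qed

definition clinear_map :: "('a::complex_hilbert_space \<Rightarrow> 'a) \<Rightarrow> bool" where
  "clinear_map K \<longleftrightarrow> (\<forall>x y. K (x + y) = K x + K y) \<and> (\<forall>c x. K (c *\<^sub>C x) = c *\<^sub>C K x)"

lemma clinear_mapD:
  assumes "clinear_map K"
  shows "K (x + y) = K x + K y" "K (c *\<^sub>C x) = c *\<^sub>C K x" "K (r *\<^sub>R x) = r *\<^sub>R K x"
    "K 0 = 0" "K (- x) = - K x" "K (x - y) = K x - K y"
proof -
  show 1: "K (x + y) = K x + K y" "K (c *\<^sub>C x) = c *\<^sub>C K x" "K (r *\<^sub>R x) = r *\<^sub>R K x" for x y c r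
    using assms by (auto simp: clinear_map_def scaleR_eq_scaleC)
  show "K 0 = 0" using 1(3)[of 0 0] by simp
  show 2: "K (- x) = - K x" for x using 1(3)[of "-1" x] by simp
  show "K (x - y) = K x - K y" using 1(1)[of x "- y"] 2[of y] by simp
qed

lemma clinear_map_sum:
  assumes "clinear_map K"
  shows "K (\<Sum>i\<in>I. f i) = (\<Sum>i\<in>I. K (f i))"
  by (induction I rule: infinite_finite_induct) (auto simp: clinear_mapD[OF assms])

lemma sum_i_powers: "(\<Sum>k<4::nat. g k) = g 0 + g 1 + g 2 + (g 3 :: 'b::comm_monoid_add)"
  by (simp add: eval_nat_numeral)

text \<open>Summing over the powers of i cancels every term except the one with <x, K y>. Additivity
  is asked only at the four vectors concerned, since \<open>K\<close> will be an unbounded integral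
  that is linear only on its domain.\<close>

lemma polarization:
  fixes K :: "'a::complex_hilbert_space \<Rightarrow> 'a"
  assumes "\<And>k. k < 4 \<Longrightarrow> K (y + (\<i> ^ k) *\<^sub>C x) = K y + (\<i> ^ k) *\<^sub>C K x"
  shows "(\<Sum>k<4::nat. \<i> ^ k * \<langle>y + (\<i> ^ k) *\<^sub>C x, K (y + (\<i> ^ k) *\<^sub>C x)\<rangle>) / 4 = \<langle>x, K y\<rangle>"
proof -
  have "(\<Sum>k<4::nat. \<i> ^ k * \<langle>y + (\<i> ^ k) *\<^sub>C x, K (y + (\<i> ^ k) *\<^sub>C x)\<rangle>)
     = (\<Sum>k<4::nat. \<i> ^ k * (\<langle>y, K y\<rangle> + \<i> ^ k * \<langle>y, K x\<rangle> + cnj (\<i> ^ k) * \<langle>x, K y\<rangle>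
          + cnj (\<i> ^ k) * \<i> ^ k * \<langle>x, K x\<rangle>))"
    by (intro sum.cong refl)
       (simp add: assms cinner_add_left cinner_add_right cinner_scaleC_left cinner_scaleC_right algebra_simps)
  also have "\<dots> = 4 * \<langle>x, K y\<rangle>"
    unfolding sum_i_powers by (simp add: power2_eq_square power3_eq_cube algebra_simps)
  finally show ?thesis by simp
qed

text \<open>Polarization recovers an operator from its quadratic form. Operator identities thus
  reduce to identities between scalar measures.\<close>

lemma clinear_map_eqI:
  assumes "clinear_map K" "clinear_map L" "\<And>x. \<langle>x, K x\<rangle> = \<langle>x, L x\<rangle>"
  shows "K = L"
proof
  fix y
  show "K y = L y"
  proof (rule cinner_eqI)
    fix x
    show "\<langle>x, K y\<rangle> = \<langle>x, L y\<rangle>"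
      using polarization[of K y x] polarization[of L y x]
      by (simp add: clinear_mapD[OF assms(1)] clinear_mapD[OF assms(2)] assms(3)[symmetric]
          flip: clinear_mapD(1,2)[OF assms(1)] clinear_mapD(1,2)[OF assms(2)])
  qed
qed

section \<open>Square integrable functions\<close>

text \<open>Measurability of \<open>f\<close> is listed separately because integrability of its
  square does not imply it.\<close>

definition sq_int :: "real measure \<Rightarrow> (real \<Rightarrow> real) \<Rightarrow> bool" where
  "sq_int M f \<longleftrightarrow> f \<in> borel_measurable M \<and> integrable M (\<lambda>t. (f t)\<^sup>2)"

lemma sq_int_integrable: "sq_int M f \<Longrightarrow> integrable M (\<lambda>t. (f t)\<^sup>2)"
  by (simp add: sq_int_def)

lemma sq_int_mult:
  assumes "sq_int M f" "sq_int M g"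
  shows "integrable M (\<lambda>t. f t * g t)"
proof (rule Bochner_Integration.integrable_bound[where f = "\<lambda>t. (f t)\<^sup>2 + (g t)\<^sup>2"])
  show "AE t in M. norm (f t * g t) \<le> norm ((f t)\<^sup>2 + (g t)\<^sup>2)"
  proof (rule AE_I2)
    fix t
    have "2 * (\<bar>f t\<bar> * \<bar>g t\<bar>) \<le> (f t)\<^sup>2 + (g t)\<^sup>2"
      using sum_squares_bound[of "\<bar>f t\<bar>" "\<bar>g t\<bar>"] by simp
    then have "\<bar>f t\<bar> * \<bar>g t\<bar> \<le> (f t)\<^sup>2 + (g t)\<^sup>2"
      using mult_nonneg_nonneg[of "\<bar>f t\<bar>" "\<bar>g t\<bar>"] by linarith
    then show "norm (f t * g t) \<le> norm ((f t)\<^sup>2 + (g t)\<^sup>2)"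
      by (simp add: abs_mult)
  qed
qed (use assms in \<open>auto simp: sq_int_def\<close>)

lemma sq_int_bound:
  assumes "sq_int M g" "f \<in> borel_measurable M" "AE t in M. \<bar>f t\<bar> \<le> c * \<bar>g t\<bar>"
  shows "sq_int M f"
  unfolding sq_int_def
proof (intro conjI assms(2))
  show "integrable M (\<lambda>t. (f t)\<^sup>2)"
  proof (rule Bochner_Integration.integrable_bound[where f = "\<lambda>t. c\<^sup>2 * (g t)\<^sup>2"])
    show "AE t in M. norm ((f t)\<^sup>2) \<le> norm (c\<^sup>2 * (g t)\<^sup>2)"
      using assms(3)
    proof eventually_elim
      case (elim t)
      then have "\<bar>f t\<bar>\<^sup>2 \<le> (c * \<bar>g t\<bar>)\<^sup>2" by (intro power_mono) auto
      then show ?case by (simp add: power_mult_distrib)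
    qed
  qed (use assms in \<open>auto simp: sq_int_def\<close>)
qed

lemma sq_int_cmult: "sq_int M f \<Longrightarrow> sq_int M (\<lambda>t. c * f t)"
  by (auto simp: sq_int_def power_mult_distrib)

lemma sq_int_add:
  assumes "sq_int M f" "sq_int M g"
  shows "sq_int M (\<lambda>t. f t + g t)"
  using assms sq_int_mult[OF assms] by (auto simp: sq_int_def power2_sum mult.assoc)

lemma sq_int_diff:
  assumes "sq_int M f" "sq_int M g"
  shows "sq_int M (\<lambda>t. f t - g t)"
  using sq_int_add[OF assms(1) sq_int_cmult[OF assms(2), of "-1"]] by simp

lemma sq_int_bounded:
  assumes "finite_measure M" "f \<in> borel_measurable M" "AE t in M. \<bar>f t\<bar> \<le> c"
  shows "sq_int M f"
  unfolding sq_int_def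
proof (intro conjI assms(2) finite_measure.integrable_const_bound[OF assms(1), where B = "c\<^sup>2"])
  show "AE t in M. norm ((f t)\<^sup>2) \<le> c\<^sup>2"
    using assms(3)
  proof eventually_elim
    case (elim t)
    then have "\<bar>f t\<bar>\<^sup>2 \<le> c\<^sup>2" by (intro power_mono) auto
    then show ?case by simp
  qed
qed (use assms in auto)

lemma integral_Cauchy_Schwarz:
  assumes "sq_int M f" "sq_int M g"
  shows "\<bar>\<integral>t. f t * g t \<partial>M\<bar> \<le> sqrt (\<integral>t. (f t)\<^sup>2 \<partial>M) * sqrt (\<integral>t. (g t)\<^sup>2 \<partial>M)"
proof -
  define a where "a = (\<integral>t. (f t)\<^sup>2 \<partial>M)"
  define b where "b = (\<integral>t. f t * g t \<partial>M)"
  define c where "c = (\<integral>t. (g t)\<^sup>2 \<partial>M)"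
  \<comment> \<open>A binary quadratic form that is nowhere negative; the inequality is the sign of
    its discriminant.\<close>
  have q: "0 \<le> x\<^sup>2 * a + 2 * x * y * b + y\<^sup>2 * c" for x y
  proof -
    have "0 \<le> (\<integral>t. (x * f t + y * g t)\<^sup>2 \<partial>M)" by simp
    also have "\<dots> = (\<integral>t. x\<^sup>2 * (f t)\<^sup>2 + 2 * x * y * (f t * g t) + y\<^sup>2 * (g t)\<^sup>2 \<partial>M)"
      by (intro Bochner_Integration.integral_cong) (auto simp: power2_sum power_mult_distrib)
    also have "\<dots> = x\<^sup>2 * a + 2 * x * y * b + y\<^sup>2 * c"
      using assms sq_int_mult[OF assms] by (simp add: a_def b_def c_def sq_int_def)
    finally show ?thesis .
  qed
  have nn: "0 \<le> a" "0 \<le> c" by (simp_all add: a_def c_def)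
  have "b\<^sup>2 \<le> a * c"
  proof (cases "c = 0")
    case True
    have "b = 0"
    proof (rule ccontr)
      assume "b \<noteq> 0"
      then show False
        \<comment> \<open>If \<open>c = 0\<close> the form is affine in \<open>y\<close>; this value
          of \<open>y\<close> would make it equal to -1.\<close>
        using q[of 1 "- (a + 1) / (2 * b)"] True nn by (simp add: field_simps)
    qed
    then show ?thesis using True by simp
  next
    case False
    then have "0 < c" using nn by simp
    \<comment> \<open>At the point (c, -b) the form factors as \<open>c\<close> times the
      discriminant expression.\<close>
    have "0 \<le> c * (a * c - b\<^sup>2)"
      using q[of c "- b"] by (simp add: power2_eq_square algebra_simps)
    then show ?thesis using \<open>0 < c\<close> by (simp add: zero_le_mult_iff)
  qed
  then have "sqrt (b\<^sup>2) \<le> sqrt (a * c)" by (rule real_sqrt_le_mono)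
  then show ?thesis by (simp add: real_sqrt_mult a_def b_def c_def)
qed

definition sq_conv :: "real measure \<Rightarrow> (nat \<Rightarrow> real \<Rightarrow> real) \<Rightarrow> (real \<Rightarrow> real) \<Rightarrow> bool" where
  "sq_conv M s f \<longleftrightarrow> sq_int M f \<and> (\<forall>n. sq_int M (s n)) \<and>
     (\<lambda>n. \<integral>t. (s n t - f t)\<^sup>2 \<partial>M) \<longlonglongrightarrow> 0"

lemma sq_conv_const: "sq_int M f \<Longrightarrow> sq_conv M (\<lambda>n. f) f"
  by (simp add: sq_conv_def)

text \<open>With errors \<open>u\<close> and \<open>v\<close>, the product differs from its limit by
  u v + u g + f v, and Cauchy-Schwarz makes each integral vanish in the limit.\<close>

lemma sq_conv_integral_mult:
  assumes "sq_conv M s f" "sq_conv M r g"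
  shows "(\<lambda>n. \<integral>t. s n t * r n t \<partial>M) \<longlonglongrightarrow> (\<integral>t. f t * g t \<partial>M)"
proof -
  note sf = assms[unfolded sq_conv_def]
  define u where "u n = (\<lambda>t. s n t - f t)" for n
  define v where "v n = (\<lambda>t. r n t - g t)" for n
  have uv: "sq_int M (u n)" "sq_int M (v n)" for n
    using sf by (auto simp: u_def v_def intro: sq_int_diff)
  have f: "sq_int M f" and g: "sq_int M g" using sf by auto
  have U: "(\<lambda>n. sqrt (\<integral>t. (u n t)\<^sup>2 \<partial>M)) \<longlonglongrightarrow> sqrt 0"
    and V: "(\<lambda>n. sqrt (\<integral>t. (v n t)\<^sup>2 \<partial>M)) \<longlonglongrightarrow> sqrt 0"
    by (rule tendsto_real_sqrt; use sf in \<open>simp add: u_def v_def\<close>)+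
  have z1: "(\<lambda>n. \<integral>t. u n t * v n t \<partial>M) \<longlonglongrightarrow> 0"
    by (rule Lim_null_comparison[OF always_eventually])
       (use integral_Cauchy_Schwarz[OF uv] tendsto_mult[OF U V] in auto)
  have z2: "(\<lambda>n. \<integral>t. u n t * g t \<partial>M) \<longlonglongrightarrow> 0"
    by (rule Lim_null_comparison[OF always_eventually, where g = "\<lambda>n. sqrt (\<integral>t. (u n t)\<^sup>2 \<partial>M) * sqrt (\<integral>t. (g t)\<^sup>2 \<partial>M)"])
       (use integral_Cauchy_Schwarz[OF uv(1) g] tendsto_mult_left_zero[OF U[simplified]] in auto)
  have z3: "(\<lambda>n. \<integral>t. f t * v n t \<partial>M) \<longlonglongrightarrow> 0"
    by (rule Lim_null_comparison[OF always_eventually, where g = "\<lambda>n. sqrt (\<integral>t. (f t)\<^sup>2 \<partial>M) * sqrt (\<integral>t. (v n t)\<^sup>2 \<partial>M)"])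
       (use integral_Cauchy_Schwarz[OF f uv(2)] tendsto_mult_right_zero[OF V[simplified]] in auto)
  have "(\<integral>t. s n t * r n t \<partial>M) = (\<integral>t. u n t * v n t \<partial>M) + (\<integral>t. u n t * g t \<partial>M)
      + (\<integral>t. f t * v n t \<partial>M) + (\<integral>t. f t * g t \<partial>M)" for n
  proof -
    have "(\<integral>t. s n t * r n t \<partial>M) = (\<integral>t. (u n t * v n t + u n t * g t + f t * v n t) + f t * g t \<partial>M)"
      by (intro Bochner_Integration.integral_cong) (auto simp: u_def v_def algebra_simps)
    then show ?thesis
      using sq_int_mult[OF uv] sq_int_mult[OF uv(1) g] sq_int_mult[OF f uv(2)] sq_int_mult[OF f g]
      by simp
  qed
  then show ?thesis
    using tendsto_add[OF tendsto_add[OF tendsto_add[OF z1 z2] z3] tendsto_const] by simp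
qed

lemma sq_conv_diff:
  assumes "sq_conv M s f" "sq_conv M r g"
  shows "sq_conv M (\<lambda>n t. s n t - r n t) (\<lambda>t. f t - g t)"
proof -
  define u where "u n = (\<lambda>t. s n t - f t)" for n
  define v where "v n = (\<lambda>t. r n t - g t)" for n
  have uv: "sq_conv M u (\<lambda>t. 0)" "sq_conv M v (\<lambda>t. 0)"
    using assms by (auto simp: u_def v_def sq_conv_def sq_int_diff) (auto simp: sq_int_def)
  have int: "integrable M (\<lambda>t. u n t * u n t)" "integrable M (\<lambda>t. u n t * v n t)" 
    "integrable M (\<lambda>t. v n t * v n t)" for n
    using uv by (auto simp: sq_conv_def intro: sq_int_mult)
  have "(\<lambda>n. (\<integral>t. u n t * u n t \<partial>M) - 2 * (\<integral>t. u n t * v n t \<partial>M) + (\<integral>t. v n t * v n t \<partial>M)) \<longlonglongrightarrow> 0 - 2 * 0 + 0"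
    by (intro tendsto_intros)
       (use sq_conv_integral_mult[OF uv(1) uv(1)] sq_conv_integral_mult[OF uv(1) uv(2)]
          sq_conv_integral_mult[OF uv(2) uv(2)] in auto)
  moreover have "(\<integral>t. (s n t - r n t - (f t - g t))\<^sup>2 \<partial>M) =
      (\<integral>t. u n t * u n t \<partial>M) - 2 * (\<integral>t. u n t * v n t \<partial>M) + (\<integral>t. v n t * v n t \<partial>M)" for n
  proof -
    have "(\<integral>t. (s n t - r n t - (f t - g t))\<^sup>2 \<partial>M)
        = (\<integral>t. u n t * u n t - 2 * (u n t * v n t) + v n t * v n t \<partial>M)"
      by (intro Bochner_Integration.integral_cong) (auto simp: u_def v_def algebra_simps power2_eq_square)
    then show ?thesis using int[of n] by simp
  qed
  ultimately show ?thesis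
    using assms by (auto simp: sq_conv_def intro: sq_int_diff)
qed

section \<open>Polynomials in an operator\<close>

definition symmetric_map :: "('a::complex_hilbert_space \<Rightarrow> 'a) \<Rightarrow> bool" where
  "symmetric_map K \<longleftrightarrow> clinear_map K \<and> (\<forall>x y. \<langle>K x, y\<rangle> = \<langle>x, K y\<rangle>)"

lemma symmetric_mapD:
  assumes "symmetric_map K"
  shows "clinear_map K" "\<langle>K x, y\<rangle> = \<langle>x, K y\<rangle>" "\<langle>x, K x\<rangle> = complex_of_real (Re \<langle>x, K x\<rangle>)"
proof -
  show 1: "clinear_map K" "\<langle>K x, y\<rangle> = \<langle>x, K y\<rangle>" for x y
    using assms by (auto simp: symmetric_map_def)
  have "\<langle>x, K x\<rangle> = cnj \<langle>x, K x\<rangle>"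
    using 1(2)[of x x] cinner_commute[of "K x" x] by simp
  then show "\<langle>x, K x\<rangle> = complex_of_real (Re \<langle>x, K x\<rangle>)"
    by (metis Reals_cnj_iff complex_is_Real_iff complex_eq_iff Re_complex_of_real Im_complex_of_real)
qed

definition op_poly :: "('a::real_vector \<Rightarrow> 'a) \<Rightarrow> real poly \<Rightarrow> 'a \<Rightarrow> 'a" where
  "op_poly R p x = (\<Sum>i\<le>degree p. coeff p i *\<^sub>R (R ^^ i) x)"

lemma op_poly_altdef:
  assumes "degree p \<le> n"
  shows "op_poly R p x = (\<Sum>i\<le>n. coeff p i *\<^sub>R (R ^^ i) x)"
  unfolding op_poly_def
  by (rule sum.mono_neutral_left) (use assms in \<open>auto simp: coeff_eq_0\<close>)

lemma op_poly_0 [simp]: "op_poly R 0 x = 0"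
  by (simp add: op_poly_def)

lemma op_poly_add: "op_poly R (p + q) x = op_poly R p x + op_poly R q x"
proof -
  define n where "n = max (degree p) (degree q)"
  have "degree (p + q) \<le> n" "degree p \<le> n" "degree q \<le> n"
    by (auto simp: n_def degree_add_le_max)
  then show ?thesis
    by (simp add: op_poly_altdef[of _ n] scaleR_left_distrib sum.distrib)
qed

lemma op_poly_smult: "op_poly R (smult c p) x = c *\<^sub>R op_poly R p x"
  by (simp add: op_poly_altdef[of "smult c p" "degree p"] degree_smult_le op_poly_def scaleR_right.sum)

lemma op_poly_sum: "op_poly R (\<Sum>i\<in>I. f i) x = (\<Sum>i\<in>I. op_poly R (f i) x)"
  by (induction I rule: infinite_finite_induct) (auto simp: op_poly_add)

lemma op_poly_pCons:
  assumes R: "clinear_map R"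
  shows "op_poly R (pCons a p) x = a *\<^sub>R x + R (op_poly R p x)"
proof -
  have "op_poly R (pCons a p) x = (\<Sum>i\<le>Suc (degree p). coeff (pCons a p) i *\<^sub>R (R ^^ i) x)"
    by (rule op_poly_altdef) (simp add: degree_pCons_le)
  also have "\<dots> = a *\<^sub>R x + R (op_poly R p x)"
    by (simp only: sum.atMost_Suc_shift op_poly_def clinear_map_sum[OF R] clinear_mapD(3)[OF R])
       (simp del: sum.atMost_Suc)
  finally show ?thesis .
qed

lemma op_poly_1 [simp]: "op_poly R 1 x = x"
  by (simp add: op_poly_def)

lemma op_poly_mult:
  assumes R: "clinear_map R"
  shows "op_poly R (p * q) x = op_poly R p (op_poly R q x)"
  by (induction p) (auto simp: op_poly_pCons[OF R] op_poly_add op_poly_smult)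

lemma clinear_map_op_poly:
  assumes R: "clinear_map R"
  shows "clinear_map (op_poly R p)"
  unfolding clinear_map_def
  by (induction p)
     (auto simp: op_poly_pCons[OF R] clinear_mapD[OF R] scaleR_right_distrib scaleC_add_right scaleC_scaleR_commute)

lemma symmetric_op_poly:
  assumes R: "symmetric_map R"
  shows "symmetric_map (op_poly R p)"
proof -
  note l = symmetric_mapD(1)[OF R]
  \<comment> \<open>\<open>op_poly_pCons\<close> puts \<open>R\<close> outermost, whereas moving it
    across the inner product leaves it innermost; the two orders must be exchanged.\<close>
  have com: "op_poly R p (R y) = R (op_poly R p y)" for p y
    using op_poly_mult[OF l, of p "[:0, 1:]" y] op_poly_mult[OF l, of "[:0, 1:]" p y]
    by (simp add: op_poly_pCons[OF l] mult.commute clinear_mapD[OF l])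
  have "\<langle>op_poly R p x, y\<rangle> = \<langle>x, op_poly R p y\<rangle>" for x y
    by (induction p arbitrary: y)
       (auto simp: op_poly_pCons[OF l] cinner_add_left cinner_add_right cinner_scaleR_left
          cinner_scaleR_right symmetric_mapD(2)[OF R] com)
  then show ?thesis using clinear_map_op_poly[OF l] by (simp add: symmetric_map_def)
qed

section \<open>Moment measures of a positive contraction\<close>

definition bernstein :: "nat \<Rightarrow> nat \<Rightarrow> real poly" where
  "bernstein n k = smult (of_nat (n choose k)) ([:0, 1:] ^ k * [:1, -1:] ^ (n - k))"

lemma sum_bernstein: "(\<Sum>k\<le>n. bernstein n k) = 1"
proof -
  have "([:0, 1:] + [:1, -1:]) ^ n = (\<Sum>k\<le>n. bernstein n k)"
    by (subst binomial_ring) (simp add: bernstein_def of_nat_poly)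
  moreover have "[:0, 1:] + [:1, -1:] = (1 :: real poly)" by (simp add: one_pCons)
  ultimately show ?thesis by (metis power_one)
qed

text \<open>The absorption identity (k+1) C(n+1,k+1) = (n+1) C(n,k), with \<open>[:0, 1:]\<close>
  standing for X and \<open>[:1, -1:]\<close> for 1 - X. It drives the induction on the degree of a
  moment.\<close>

lemma bernstein_shift:
  assumes "k \<le> n"
  shows "smult ((real k + 1) / (real n + 1)) (bernstein (Suc n) (Suc k)) = [:0, 1:] * bernstein n k"
proof -
  have "real (Suc k) * real (Suc n choose Suc k) = real (Suc n) * real (n choose k)"
    by (metis of_nat_mult Suc_times_binomial_eq mult.commute)
  then have "(real k + 1) / (real n + 1) * real (Suc n choose Suc k) = real (n choose k)"
    by (simp add: field_simps del: binomial_Suc_Suc)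
  then show ?thesis
    by (simp add: bernstein_def del: binomial_Suc_Suc)
qed

text \<open>The quotient of falling factorials k(k-1)...(k-j+1) / (n(n-1)...(n-j+1)), that is
  C(k,j)/C(n,j) when j <= n: the coefficients of X^j in the Bernstein basis of degree
  \<open>n\<close>.\<close>

definition falling_ratio :: "nat \<Rightarrow> nat \<Rightarrow> nat \<Rightarrow> real" where
  "falling_ratio n j k = (\<Prod>i<j. (real k - real i) / (real n - real i))"

text \<open>Factorial moments of the Bernstein weights are exact, while power moments are only
  asymptotically right; hence the expansion by falling factorials. The summand \<open>k = 0\<close>
  drops out and the others are shifted down by one.\<close>

lemma sum_falling_ratio_bernstein:
  "j \<le> n \<Longrightarrow> (\<Sum>k\<le>n. smult (falling_ratio n j k) (bernstein n k)) = [:0, 1:] ^ j"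
proof (induction j arbitrary: n)
  case 0
  then show ?case by (simp add: falling_ratio_def sum_bernstein)
next
  case (Suc j)
  then obtain m where n: "n = Suc m" and m: "j \<le> m" by (cases n) auto
  have z: "falling_ratio (Suc m) (Suc j) 0 = 0"
    by (simp only: falling_ratio_def prod.lessThan_Suc_shift) simp
  have s: "falling_ratio (Suc m) (Suc j) (Suc k) = falling_ratio m j k * ((real k + 1) / (real m + 1))" for k
    by (simp only: falling_ratio_def prod.lessThan_Suc_shift) (simp add: add.commute)
  have "(\<Sum>k\<le>n. smult (falling_ratio n (Suc j) k) (bernstein n k))
      = (\<Sum>k\<le>m. smult (falling_ratio m j k) (smult ((real k + 1) / (real m + 1)) (bernstein (Suc m) (Suc k))))"
    by (simp only: n sum.atMost_Suc_shift z s) simp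
  also have "\<dots> = [:0, 1:] * (\<Sum>k\<le>m. smult (falling_ratio m j k) (bernstein m k))"
    by (simp only: sum_distrib_left) (intro sum.cong refl, simp add: bernstein_shift)
  finally show ?case using Suc.IH[OF m] by simp
qed

text \<open>All factors of both products have modulus at most 1, so the products differ by at most
  the sum of the differences of factors. The \<open>i\<close>-th difference is (i/(n-i)) *
  ((n-k)/n).\<close>

lemma falling_ratio_approx:
  assumes k: "k \<le> n" and n: "2 * j < n"
  shows "\<bar>(real k / real n) ^ j - falling_ratio n j k\<bar> \<le> real j * (real j / (real n - real j))"
proof -
  have "norm ((\<Prod>i<j. real k / real n) - falling_ratio n j k)
      \<le> (\<Sum>i<j. norm (real k / real n - (real k - real i) / (real n - real i)))"
    unfolding falling_ratio_def
  proof (rule norm_prod_diff)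
    fix i assume "i \<in> {..<j}"
    \<comment> \<open>Since \<open>k\<close> may be smaller than \<open>i\<close>, this also needs i
      - k <= n - i, which \<open>2 * j < n\<close> provides.\<close>
    then have "\<bar>real k - real i\<bar> \<le> real n - real i" "0 < real n - real i" using k n by auto
    then show "norm ((real k - real i) / (real n - real i)) \<le> 1"
      by (simp add: divide_le_eq)
  qed (use k in \<open>auto simp: divide_le_eq\<close>)
  also have "\<dots> \<le> (\<Sum>i<j. real j / (real n - real j))"
  proof (rule sum_mono)
    fix i assume "i \<in> {..<j}"
    then have i: "i < j" by simp
    have "real k / real n - (real k - real i) / (real n - real i)
        = (real i / (real n - real i)) * ((real n - real k) / real n)"
      using i n by (simp add: field_simps)
    also have "norm \<dots> \<le> (real i / (real n - real i)) * 1"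
      unfolding norm_mult using i n k by (intro mult_mono) (auto simp: divide_le_eq)
    also have "\<dots> \<le> real j / (real n - real j)"
      using i n by (simp add: frac_le)
    finally show "norm (real k / real n - (real k - real i) / (real n - real i)) \<le> real j / (real n - real j)" .
  qed
  finally show ?thesis by simp
qed

definition positive_contraction :: "('a::complex_hilbert_space \<Rightarrow> 'a) \<Rightarrow> bool" where
  "positive_contraction R \<longleftrightarrow> symmetric_map R \<and>
     (\<forall>x. 0 \<le> Re \<langle>x, R x\<rangle> \<and> Re \<langle>x, R x\<rangle> \<le> (norm x)\<^sup>2)"

text \<open>A factor s^2 can be removed because s(R) is symmetric: <x, s(R) q(R) s(R) x> is the form
  of q(R) at s(R) x. Lowering both exponents by two leaves 1, X, 1 - X and X(1 - X).\<close>

lemma bernstein_nonneg: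
  assumes R: "positive_contraction R"
  shows "0 \<le> Re \<langle>x, op_poly R (bernstein n k) x\<rangle>"
proof -
  have sR: "symmetric_map R" and lR: "clinear_map R"
    using R by (auto simp: positive_contraction_def symmetric_map_def)
  define P where "P q \<longleftrightarrow> (\<forall>x. 0 \<le> Re \<langle>x, op_poly R q x\<rangle>)" for q
  let ?X = "[:0, 1:] :: real poly" and ?Y = "[:1, -1:] :: real poly"
  have P1: "P 1" by (simp add: P_def cinner_self)
  have PX: "P ?X" using R by (simp add: P_def op_poly_pCons[OF lR] positive_contraction_def clinear_mapD[OF lR])
  have PY: "P ?Y"
    using R by (simp add: P_def op_poly_pCons[OF lR] positive_contraction_def clinear_mapD[OF lR]
        cinner_diff_right cinner_add_right cinner_minus_right cinner_self)
  have Ps: "P (s * s * q)" if "P q" for s q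
    unfolding P_def
  proof
    fix x
    have "\<langle>x, op_poly R (s * s * q) x\<rangle> = \<langle>x, op_poly R (s * (q * s)) x\<rangle>"
      by (simp add: mult_ac)
    also have "\<dots> = \<langle>op_poly R s x, op_poly R q (op_poly R s x)\<rangle>"
      by (simp only: op_poly_mult[OF lR] symmetric_mapD(2)[OF symmetric_op_poly[OF sR]])
    finally show "0 \<le> Re \<langle>x, op_poly R (s * s * q) x\<rangle>" using that by (simp add: P_def)
  qed
  have Padd: "P (p + q)" if "P p" "P q" for p q
    using that by (simp add: P_def op_poly_add cinner_add_right)
  have PXY: "P (?X * ?Y)"
  proof -
    \<comment> \<open>X(1-X) is multiplied by X + (1-X) = 1, so that each summand is a square times
      a factor already known to be positive.\<close>
    have "?X * ?Y = ?X * ?X * ?Y + ?Y * ?Y * ?X" by simp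
    then show ?thesis using Padd[OF Ps[OF PY] Ps[OF PX]] by metis
  qed
  have PYm: "P (q * ?Y ^ m)" if "P q" "P (q * ?Y)" for q m
  proof (induction m rule: less_induct)
    case (less m)
    consider "m = 0" | "m = 1" | i where "m = Suc (Suc i)" by (metis One_nat_def not0_implies_Suc)
    then show ?case
    proof cases
      case 3
      then show ?thesis using Ps[OF less[of i], of ?Y] by (simp only: power_Suc) (simp only: mult_ac)
    qed (use that in auto)
  qed
  have "P (?X ^ l * ?Y ^ m)" for l m
  proof (induction l rule: less_induct)
    case (less l)
    consider "l = 0" | "l = 1" | i where "l = Suc (Suc i)" by (metis One_nat_def not0_implies_Suc)
    then show ?case
    proof cases
      case 3
      then show ?thesis using Ps[OF less[of i], of ?X] by (simp only: power_Suc) (simp only: mult_ac)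
    qed (use PYm[of 1 m] PYm[of ?X m] P1 PX PY PXY in auto)
  qed
  then show ?thesis
    by (simp add: P_def bernstein_def op_poly_smult cinner_scaleR_right)
qed

text \<open>Finite weighted point sets in the form required by Helly's selection theorem, with
  integrals that are plain finite sums.\<close>

lemma real_distribution_points:
  fixes w :: "nat \<Rightarrow> real" and q :: "nat \<Rightarrow> real"
  assumes w: "\<And>k. 0 \<le> w k" "(\<Sum>k\<le>n. w k) = 1"
  defines "M \<equiv> distr (point_measure {..n} (\<lambda>k. ennreal (w k))) borel q"
  shows "real_distribution M"
    "\<And>g :: real \<Rightarrow> real. g \<in> borel_measurable borel \<Longrightarrow> (\<integral>t. g t \<partial>M) = (\<Sum>k\<le>n. w k * g (q k))"
    "\<And>S. S \<in> sets borel \<Longrightarrow> q ` {..n} \<subseteq> S \<Longrightarrow> measure M S = 1"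
proof -
  let ?P = "point_measure {..n} (\<lambda>k. ennreal (w k))"
  have e: "emeasure ?P {..n} = 1"
    using w by (simp add: emeasure_point_measure_finite sum_ennreal)
  have "prob_space ?P"
    by (rule prob_spaceI) (use e in \<open>simp add: space_point_measure\<close>)
  then interpret P: prob_space ?P .
  have m: "q \<in> measurable ?P borel" by simp
  have "prob_space M" unfolding M_def using m by (rule P.prob_space_distr)
  then show "real_distribution M"
    by (simp add: real_distribution_def real_distribution_axioms_def M_def)
  show "(\<integral>t. g t \<partial>M) = (\<Sum>k\<le>n. w k * g (q k))" if "g \<in> borel_measurable borel" for g :: "real \<Rightarrow> real"
    unfolding M_def using that m w
    by (subst integral_distr) (auto simp: lebesgue_integral_point_measure_finite)
  show "measure M S = 1" if "S \<in> sets borel" "q ` {..n} \<subseteq> S" for S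
  proof -
    have "q -` S \<inter> space ?P = {..n}" using that by (auto simp: space_point_measure)
    then show ?thesis
      unfolding M_def using that m e
      by (subst measure_distr) (auto simp: measure_def)
  qed
qed

text \<open>This solves the Hausdorff moment problem for <u, R^n u>. The vector is normalized
  because the selection theorem speaks of probability distributions.\<close>

lemma moment_measure_unit:
  fixes u :: "'a::complex_hilbert_space"
  assumes R: "positive_contraction R" and u: "norm u = 1"
  obtains M where "real_distribution M" "AE t in M. 0 \<le> t \<and> t \<le> 1"
    "\<And>p. (\<integral>t. poly p t \<partial>M) = Re \<langle>u, op_poly R p u\<rangle>"
proof -
  define L where "L p = Re \<langle>u, op_poly R p u\<rangle>" for p
  have L: "L (p + q) = L p + L q" "L (smult c p) = c * L p" "L (\<Sum>i\<in>I. f i) = (\<Sum>i\<in>I. L (f i))"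
    for p q c f and I :: "nat set"
    by (simp_all add: L_def op_poly_add cinner_add_right op_poly_smult cinner_scaleR_right op_poly_sum cinner_sum_right)
  have L1: "L 1 = 1" by (simp add: L_def cinner_self u)
  define w where "w n k = L (bernstein n k)" for n k
  have w: "0 \<le> w n k" "(\<Sum>k\<le>n. w n k) = 1" for n k
    using bernstein_nonneg[OF R] by (simp add: w_def L_def) (simp add: w_def L(3)[symmetric] sum_bernstein L1)
  define N where "N n = distr (point_measure {..n} (\<lambda>k. ennreal (w n k))) borel (\<lambda>k. real k / real n)" for n
  note N = real_distribution_points[where w = "w n" and n = n and q = "\<lambda>k. real k / real n" for n,
      OF w(1) w(2), folded N_def]
  interpret N: real_distribution "N n" for n by (rule N(1))
  have "tight N"
    unfolding tight_def
  proof (intro conjI allI impI)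
    fix e :: real assume "0 < e"
    \<comment> \<open>The interval is open on the left, so it has to begin below the node 0. For
      \<open>n = 0\<close> the only node is 0/0, which evaluates to 0.\<close>
    have "measure (N n) {-1<..1} = 1" for n
      by (rule N(3)) (auto intro: divide_le_eq_1 simp: divide_le_eq_1 less_le_trans[of "-1" 0])
    then show "\<exists>a b. a < b \<and> (\<forall>n. 1 - e < measure (N n) {a<..b})"
      using \<open>0 < e\<close> by (intro exI[of _ "-1"] exI[of _ 1]) auto
  qed (rule N(1))
  then obtain r M where r: "strict_mono (r :: nat \<Rightarrow> nat)" and M: "real_distribution M"
    and conv: "weak_conv_m (N \<circ> id \<circ> r) M"
    using tight_imp_convergent_subsubsequence[of N id] strict_mono_id by blast
  interpret M: real_distribution M by (rule M)
  have lim: "(\<lambda>i. \<Sum>k\<le>r i. w (r i) k * g (real k / real (r i))) \<longlonglongrightarrow> (\<integral>t. g t \<partial>M)"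
    if c: "continuous_on UNIV g" and b: "\<And>t. \<bar>g t\<bar> \<le> B" for g B
  proof -
    have gm: "g \<in> borel_measurable borel" using c by (rule borel_measurable_continuous_onI)
    have "(\<lambda>i. \<integral>t. g t \<partial>((N \<circ> id \<circ> r) i)) \<longlonglongrightarrow> (\<integral>t. g t \<partial>M)"
    proof (rule weak_conv_imp_integral_bdd_continuous_conv[OF _ M conv])
      show "isCont g x" for x using c by (simp add: continuous_on_eq_continuous_at)
      show "norm (g x) \<le> B" for x using b by simp
    qed (simp add: N(1))
    then show ?thesis by (simp add: N(2)[OF gm])
  qed
  have frac: "0 \<le> real k / real n" "real k / real n \<le> 1" if "k \<le> n" for k n :: nat
    using that by (auto simp: divide_le_eq_1)
  have clamp: "continuous_on UNIV (\<lambda>t::real. max 0 (min 1 t))" by (intro continuous_intros)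
  have ae: "AE t in M. 0 \<le> t \<and> t \<le> 1"
  proof -
    \<comment> \<open>The distance to [0,1], capped at 1: a bounded continuous function that
      vanishes at all nodes, so its integral against the weak limit is 0.\<close>
    define g where "g t = min 1 \<bar>t - max 0 (min 1 t)\<bar>" for t :: real
    have gc: "continuous_on UNIV g" unfolding g_def by (intro continuous_intros)
    have gb: "\<bar>g t\<bar> \<le> 1" for t by (auto simp: g_def)
    have "(\<lambda>i. \<Sum>k\<le>r i. w (r i) k * g (real k / real (r i))) = (\<lambda>i. 0)"
      using frac by (intro ext sum.neutral) (auto simp: g_def)
    then have "(\<integral>t. g t \<partial>M) = 0"
      using lim[OF gc gb] LIMSEQ_unique[OF _ tendsto_const] by metis
    moreover have "integrable M g"
      using gb borel_measurable_continuous_onI[OF gc] by (intro M.integrable_const_bound[of _ 1]) auto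
    moreover have "AE t in M. 0 \<le> g t" by (auto simp: g_def)
    ultimately have "AE t in M. g t = 0"
      using integral_nonneg_eq_0_iff_AE by blast
    then show ?thesis by eventually_elim (auto simp: g_def split: if_splits simp: min_def max_def)
  qed
  have mom: "(\<integral>t. t ^ j \<partial>M) = L ([:0, 1:] ^ j)" for j
  proof -
    \<comment> \<open>Weak convergence needs a bounded continuous test function on the whole line.
      Clamping changes t^j neither at the nodes nor almost everywhere for \<open>M\<close>.\<close>
    define g where "g t = (max 0 (min 1 t)) ^ j" for t :: real
    have gc: "continuous_on UNIV g" unfolding g_def by (intro continuous_intros)
    have gb: "\<bar>g t\<bar> \<le> 1" for t by (auto simp: g_def power_le_one abs_le_iff intro: order_trans[of _ 0])
    have e: "(\<integral>t. t ^ j \<partial>M) = (\<integral>t. g t \<partial>M)"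
    proof (rule integral_cong_AE)
      show "AE t in M. t ^ j = g t" using ae by eventually_elim (auto simp: g_def)
    qed (use borel_measurable_continuous_onI[OF gc] in auto)
    have ev: "\<forall>\<^sub>F n in sequentially. \<bar>(\<Sum>k\<le>n. w n k * g (real k / real n)) - L ([:0, 1:] ^ j)\<bar>
        \<le> real j * (real j / (real n - real j))"
      using eventually_gt_at_top[of "2 * j"]
    proof eventually_elim
      case (elim n)
      have "L ([:0, 1:] ^ j) = (\<Sum>k\<le>n. w n k * falling_ratio n j k)"
        using elim by (simp add: sum_falling_ratio_bernstein[of j n, symmetric] L w_def mult.commute)
      then have "\<bar>(\<Sum>k\<le>n. w n k * g (real k / real n)) - L ([:0, 1:] ^ j)\<bar>
          = \<bar>\<Sum>k\<le>n. w n k * ((real k / real n) ^ j - falling_ratio n j k)\<bar>"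
        using frac by (simp add: g_def right_diff_distrib sum_subtractf)
      also have "\<dots> \<le> (\<Sum>k\<le>n. w n k * (real j * (real j / (real n - real j))))"
      proof (intro order_trans[OF sum_abs] sum_mono)
        fix k assume "k \<in> {..n}"
        then have "\<bar>(real k / real n) ^ j - falling_ratio n j k\<bar> \<le> real j * (real j / (real n - real j))"
          using elim by (intro falling_ratio_approx) auto
        then show "\<bar>w n k * ((real k / real n) ^ j - falling_ratio n j k)\<bar>
            \<le> w n k * (real j * (real j / (real n - real j)))"
          unfolding abs_mult abs_of_nonneg[OF w(1)] by (rule mult_left_mono) (rule w(1))
      qed
      also have "\<dots> = real j * (real j / (real n - real j))"
        using w(2)[of n] by (simp only: sum_distrib_right[symmetric])
      finally show ?case .
    qed
    have z: "(\<lambda>n. real j * (real j / (real n - real j))) \<longlonglongrightarrow> 0"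
    proof (rule tendsto_mult_right_zero, rule tendsto_divide_0[OF tendsto_const])
      show "filterlim (\<lambda>n. real n - real j) at_infinity sequentially"
        by (intro filterlim_at_top_imp_at_infinity filterlim_tendsto_add_at_top[OF tendsto_const[of "- real j"], simplified]
            filterlim_real_sequentially)
    qed
    have "(\<lambda>n. (\<Sum>k\<le>n. w n k * g (real k / real n)) - L ([:0, 1:] ^ j)) \<longlonglongrightarrow> 0"
      by (rule Lim_null_comparison[OF _ z]) (use ev in simp)
    then have "(\<lambda>n. \<Sum>k\<le>n. w n k * g (real k / real n)) \<longlonglongrightarrow> L ([:0, 1:] ^ j)"
      by (rule LIM_zero_cancel)
    from LIMSEQ_subseq_LIMSEQ[OF this r]
    have "(\<lambda>i. \<Sum>k\<le>r i. w (r i) k * g (real k / real (r i))) \<longlonglongrightarrow> L ([:0, 1:] ^ j)"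
      by (simp add: o_def)
    then show ?thesis unfolding e by (rule LIMSEQ_unique[OF lim[OF gc gb]])
  qed
  have int: "integrable M (\<lambda>t. t ^ j)" for j
  proof (rule M.integrable_const_bound[of _ 1])
    show "AE t in M. norm (t ^ j) \<le> 1" using ae by eventually_elim (auto simp: power_le_one)
  qed simp
  have "(\<integral>t. poly p t \<partial>M) = L p" for p
  proof -
    have "p = (\<Sum>i\<le>degree p. smult (coeff p i) ([:0, 1:] ^ i))"
      by (simp only: monom_altdef[symmetric] poly_as_sum_of_monoms)
    from arg_cong[OF this, of L] have "L p = (\<Sum>i\<le>degree p. coeff p i * L ([:0, 1:] ^ i))"
      by (simp only: L)
    also have "\<dots> = (\<integral>t. poly p t \<partial>M)"
      using int by (simp add: poly_altdef mom)
    finally show ?thesis by simp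
  qed
  then show ?thesis using that M ae by (auto simp: L_def)
qed

text \<open>The form at \<open>x\<close> is the squared norm of \<open>x\<close> times the form at
  the unit vector, hence the constant density; the null measure covers \<open>x = 0\<close>.\<close>

lemma moment_measure:
  fixes x :: "'a::complex_hilbert_space"
  assumes R: "positive_contraction R"
  shows "\<exists>M. finite_measure M \<and> sets M = sets borel \<and> (AE t in M. 0 \<le> t \<and> t \<le> (1::real)) \<and>
    (\<forall>p. (\<integral>t. poly p t \<partial>M) = Re \<langle>x, op_poly R p x\<rangle>)"
proof (cases "x = 0")
  case True
  have ae: "AE t in null_measure borel. P t" for P :: "real \<Rightarrow> bool"
    by (rule AE_I[of _ _ UNIV]) auto
  then have "(\<integral>t. poly p t \<partial>(null_measure borel)) = 0" for p :: "real poly"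
    by (rule integral_eq_zero_AE)
  then show ?thesis
    using True by (intro exI[of _ "null_measure borel"]) (auto intro!: finite_measureI ae)
next
  case False
  define u where "u = (1 / norm x) *\<^sub>R x"
  have u: "norm u = 1" "x = norm x *\<^sub>R u" using False by (auto simp: u_def)
  obtain M where M: "real_distribution M" "AE t in M. 0 \<le> t \<and> t \<le> 1"
    "\<And>p. (\<integral>t. poly p t \<partial>M) = Re \<langle>u, op_poly R p u\<rangle>"
    using moment_measure_unit[OF R u(1)] by blast
  interpret M: real_distribution M by (rule M)
  have lR: "clinear_map R" using R by (auto simp: positive_contraction_def symmetric_map_def)
  let ?D = "density M (\<lambda>_. ennreal ((norm x)\<^sup>2))"
  show ?thesis
  proof (intro exI[of _ ?D] conjI allI)
    show "finite_measure ?D"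
      by (rule finite_measureI) (simp add: emeasure_density M.emeasure_space_1[simplified])
    show "AE t in ?D. 0 \<le> t \<and> t \<le> 1"
      using M(2) by (simp add: AE_density)
    show "(\<integral>t. poly p t \<partial>?D) = Re \<langle>x, op_poly R p x\<rangle>" for p
    proof -
      have "poly p \<in> borel_measurable borel"
        by (intro borel_measurable_continuous_onI continuous_on_poly continuous_on_id)
      then have pm: "poly p \<in> borel_measurable M" by simp
      have "\<langle>x, op_poly R p x\<rangle> = (norm x)\<^sup>2 * \<langle>u, op_poly R p u\<rangle>"
        by (subst (1 2) u(2))
           (simp add: clinear_mapD[OF clinear_map_op_poly[OF lR]] cinner_scaleR_left cinner_scaleR_right power2_eq_square del: norm_scaleR)
      then show ?thesis
        using pm by (simp add: integral_density M(3))
    qed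
  qed simp
qed

section \<open>Extension of a functional calculus by square-integrable approximation\<close>

text \<open>The index type \<open>'i\<close> consists of formal expressions (polynomials, lists of coefficients and sets);
  the isometry \<open>rep_inner\<close> makes \<open>rep\<close> depend only on the function an expression represents.\<close>

locale sq_calculus =
  fixes W :: "'i set" and ev :: "'i \<Rightarrow> real \<Rightarrow> real" and rep :: "'i \<Rightarrow> 'a::complex_hilbert_space \<Rightarrow> 'a"
    and \<mu> :: "'a \<Rightarrow> real measure"
  assumes sq_int_ev: "i \<in> W \<Longrightarrow> sq_int (\<mu> x) (ev i)"
    and rep_inner: "i \<in> W \<Longrightarrow> j \<in> W \<Longrightarrow> \<langle>rep i x, rep j x\<rangle> = complex_of_real (\<integral>t. ev i t * ev j t \<partial>\<mu> x)"
begin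

definition approximates :: "(nat \<Rightarrow> 'i) \<Rightarrow> (real \<Rightarrow> real) \<Rightarrow> 'a \<Rightarrow> bool" where
  "approximates s f x \<longleftrightarrow> (\<forall>n. s n \<in> W) \<and> sq_conv (\<mu> x) (\<lambda>n. ev (s n)) f"

text \<open>Quantifying over all approximating sequences avoids choosing one. Where no such sequence
  exists the condition is vacuous, so \<open>ext\<close> is meaningful only at approximable
  functions.\<close>

definition ext :: "(real \<Rightarrow> real) \<Rightarrow> 'a \<Rightarrow> 'a" where
  "ext f x = (THE z. \<forall>s. approximates s f x \<longrightarrow> (\<lambda>n. rep (s n) x) \<longlonglongrightarrow> z)"

lemma norm_rep_diff:
  assumes "i \<in> W" "j \<in> W"
  shows "(norm (rep i x - rep j x))\<^sup>2 = (\<integral>t. (ev i t - ev j t)\<^sup>2 \<partial>\<mu> x)"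
proof -
  have c: "(\<integral>t. ev j t * ev i t \<partial>\<mu> x) = (\<integral>t. ev i t * ev j t \<partial>\<mu> x)"
    by (intro Bochner_Integration.integral_cong refl mult.commute)
  have "complex_of_real ((norm (rep i x - rep j x))\<^sup>2) = complex_of_real
      ((\<integral>t. ev i t * ev i t \<partial>\<mu> x) - (\<integral>t. ev i t * ev j t \<partial>\<mu> x)
        - ((\<integral>t. ev i t * ev j t \<partial>\<mu> x) - (\<integral>t. ev j t * ev j t \<partial>\<mu> x)))"
    unfolding cinner_self[symmetric] by (simp add: cinner_diff_left cinner_diff_right rep_inner c assms)
  also have "\<dots> = complex_of_real (\<integral>t. ev i t * ev i t - ev i t * ev j t - (ev i t * ev j t - ev j t * ev j t) \<partial>\<mu> x)"
    by (simp add: sq_int_mult sq_int_ev assms)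
  also have "(\<lambda>t. ev i t * ev i t - ev i t * ev j t - (ev i t * ev j t - ev j t * ev j t)) = (\<lambda>t. (ev i t - ev j t)\<^sup>2)"
    by (simp add: fun_eq_iff power2_eq_square algebra_simps)
  finally show ?thesis by (simp only: of_real_eq_iff)
qed

text \<open>By the isometry, an approximating sequence is Cauchy and any two of them have vanishing
  distance; completeness supplies the common limit.\<close>

lemma ext_tendsto:
  assumes s: "approximates s f x"
  shows "(\<lambda>n. rep (s n) x) \<longlonglongrightarrow> ext f x"
proof -
  have W: "s n \<in> W" for n using s by (simp add: approximates_def)
  note sf = s[unfolded approximates_def sq_conv_def, THEN conjunct2]
  have "Cauchy (\<lambda>n. rep (s n) x)"
  proof (rule CauchyI)
    fix e :: real assume "0 < e"
    \<comment> \<open>The bound (a-b)^2 <= 2(a-f)^2 + 2(b-f)^2 adds two such errors with factor 2,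
      giving e^2 in total.\<close>
    then have "0 < e\<^sup>2 / 4" by simp
    from order_tendstoD(2)[OF sf[THEN conjunct2, THEN conjunct2] this] obtain N where N: "\<And>n. N \<le> n \<Longrightarrow> (\<integral>t. (ev (s n) t - f t)\<^sup>2 \<partial>\<mu> x) < e\<^sup>2 / 4"
      by (auto simp: eventually_sequentially)
    have "norm (rep (s m) x - rep (s n) x) < e" if "N \<le> m" "N \<le> n" for m n
    proof -
      have i: "sq_int (\<mu> x) (\<lambda>t. ev (s m) t - f t)" "sq_int (\<mu> x) (\<lambda>t. ev (s n) t - f t)"
        "sq_int (\<mu> x) (\<lambda>t. ev (s m) t - ev (s n) t)"
        using sf by (auto intro: sq_int_diff)
      have "(norm (rep (s m) x - rep (s n) x))\<^sup>2
          \<le> (\<integral>t. 2 * (ev (s m) t - f t)\<^sup>2 + 2 * (ev (s n) t - f t)\<^sup>2 \<partial>\<mu> x)"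
        unfolding norm_rep_diff[OF W W]
      proof (rule integral_mono)
        fix t
        show "(ev (s m) t - ev (s n) t)\<^sup>2 \<le> 2 * (ev (s m) t - f t)\<^sup>2 + 2 * (ev (s n) t - f t)\<^sup>2"
          using zero_le_power2[of "(ev (s m) t - f t) + (ev (s n) t - f t)"]
          by (simp add: power2_eq_square algebra_simps)
      qed (use i in \<open>auto simp: sq_int_def\<close>)
      also have "\<dots> = 2 * (\<integral>t. (ev (s m) t - f t)\<^sup>2 \<partial>\<mu> x) + 2 * (\<integral>t. (ev (s n) t - f t)\<^sup>2 \<partial>\<mu> x)"
        using i by (simp add: sq_int_def)
      also have "\<dots> < e\<^sup>2" using N[OF that(1)] N[OF that(2)] by simp
      finally show ?thesis using \<open>0 < e\<close> by (simp add: power2_less_imp_less)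
    qed
    then show "\<exists>M. \<forall>m\<ge>M. \<forall>n\<ge>M. norm (rep (s m) x - rep (s n) x) < e" by blast
  qed
  then obtain z where z: "(\<lambda>n. rep (s n) x) \<longlonglongrightarrow> z"
    using Cauchy_convergent convergent_def by blast
  have all: "(\<lambda>n. rep (r n) x) \<longlonglongrightarrow> z" if r: "approximates r f x" for r
  proof -
    have "(\<lambda>n. \<integral>t. (ev (r n) t - ev (s n) t)\<^sup>2 \<partial>\<mu> x) \<longlonglongrightarrow> 0"
      using sq_conv_diff[OF r[unfolded approximates_def, THEN conjunct2] s[unfolded approximates_def, THEN conjunct2]]
      by (simp add: sq_conv_def)
    then have "(\<lambda>n. sqrt ((norm (rep (r n) x - rep (s n) x))\<^sup>2)) \<longlonglongrightarrow> sqrt 0"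
      using r W by (simp only: norm_rep_diff approximates_def) (rule tendsto_real_sqrt)
    then have "(\<lambda>n. rep (r n) x - rep (s n) x) \<longlonglongrightarrow> 0"
      by (simp add: tendsto_norm_zero_iff)
    from tendsto_add[OF this z] show ?thesis by simp
  qed
  have "ext f x = z"
    unfolding ext_def
  proof (rule the_equality)
    fix z' assume "\<forall>s. approximates s f x \<longrightarrow> (\<lambda>n. rep (s n) x) \<longlonglongrightarrow> z'"
    then show "z' = z" using s z LIMSEQ_unique by blast
  qed (use all in blast)
  then show ?thesis using z by simp
qed

lemma ext_inner:
  assumes "approximates s f x" "approximates r g x"
  shows "\<langle>ext f x, ext g x\<rangle> = complex_of_real (\<integral>t. f t * g t \<partial>\<mu> x)"
proof (rule LIMSEQ_unique)
  show "(\<lambda>n. \<langle>rep (s n) x, rep (r n) x\<rangle>) \<longlonglongrightarrow> \<langle>ext f x, ext g x\<rangle>"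
    by (intro tendsto_cinner ext_tendsto assms)
  show "(\<lambda>n. \<langle>rep (s n) x, rep (r n) x\<rangle>) \<longlonglongrightarrow> complex_of_real (\<integral>t. f t * g t \<partial>\<mu> x)"
    using tendsto_of_real[OF sq_conv_integral_mult] assms by (fastforce simp: approximates_def rep_inner)
qed

end

section \<open>Polynomial approximation of indicator functions\<close>

text \<open>One polynomial must serve every measure in \<open>I\<close>: linearity of the limit is
  later read off from a single sequence evaluated at several vectors.\<close>

definition poly_approximable :: "real measure set \<Rightarrow> (real \<Rightarrow> real) \<Rightarrow> bool" where
  "poly_approximable I f \<longleftrightarrow> (\<forall>e>0. \<exists>p. \<forall>M\<in>I. (\<integral>t. (poly p t - f t)\<^sup>2 \<partial>M) < e)"

definition unit_measure :: "real measure \<Rightarrow> bool" where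
  "unit_measure M \<longleftrightarrow> finite_measure M \<and> sets M = sets borel \<and> (AE t in M. 0 \<le> t \<and> t \<le> 1)"

lemma borel_measurable_poly: "poly (p :: real poly) \<in> borel_measurable borel"
  by (intro borel_measurable_continuous_onI continuous_on_poly continuous_on_id)

lemma unit_measure_sq_int:
  assumes M: "unit_measure M" and f: "f \<in> borel_measurable borel" and b: "\<And>t. 0 \<le> t \<Longrightarrow> t \<le> 1 \<Longrightarrow> \<bar>f t\<bar> \<le> c"
  shows "sq_int M f"
proof (rule sq_int_bounded)
  show "finite_measure M" using M by (simp add: unit_measure_def)
  show "f \<in> borel_measurable M" using f M by (simp add: unit_measure_def cong: measurable_cong_sets)
  have "AE t in M. 0 \<le> t \<and> t \<le> 1" using M by (simp add: unit_measure_def)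
  then show "AE t in M. \<bar>f t\<bar> \<le> c" by eventually_elim (use b in auto)
qed

lemma sq_int_poly:
  assumes "unit_measure M"
  shows "sq_int M (poly p)"
proof -
  have "compact (poly p ` {0..1})"
    by (intro compact_continuous_image continuous_on_poly continuous_on_id) auto
  then obtain c where "\<And>t. t \<in> {0..1} \<Longrightarrow> \<bar>poly p t\<bar> \<le> c"
    using compact_imp_bounded bounded_real by (metis (no_types, lifting) imageI)
  then show ?thesis
    by (intro unit_measure_sq_int[OF assms borel_measurable_poly, of _ c]) auto
qed

lemma sq_integral_triangle:
  assumes "sq_int M (\<lambda>t. f t - g t)" "sq_int M (\<lambda>t. g t - h t)" 
  shows "(\<integral>t. (f t - h t)\<^sup>2 \<partial>M) \<le> 2 * (\<integral>t. (f t - g t)\<^sup>2 \<partial>M) + 2 * (\<integral>t. (g t - h t)\<^sup>2 \<partial>M)"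
proof -
  have i: "sq_int M (\<lambda>t. f t - h t)"
    using sq_int_add[OF assms] by simp
  have "(\<integral>t. (f t - h t)\<^sup>2 \<partial>M) \<le> (\<integral>t. 2 * (f t - g t)\<^sup>2 + 2 * (g t - h t)\<^sup>2 \<partial>M)"
  proof (rule integral_mono)
    fix t
    show "(f t - h t)\<^sup>2 \<le> 2 * (f t - g t)\<^sup>2 + 2 * (g t - h t)\<^sup>2"
      using zero_le_power2[of "(f t - g t) - (g t - h t)"]
      by (simp add: power2_eq_square algebra_simps)
  qed (use i assms in \<open>auto simp: sq_int_def\<close>)
  then show ?thesis using assms by (simp add: sq_int_def)
qed

text \<open>Dominated convergence applies to each measure, and finiteness of \<open>I\<close> gives
  one index \<open>n\<close> good for all of them. The constant 4 dominates the square of a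
  difference of two functions bounded by 1.\<close>

lemma poly_approximable_limit:
  assumes I: "finite I" "\<And>M. M \<in> I \<Longrightarrow> unit_measure M"
    and g: "\<And>n::nat. poly_approximable I (g n)" "\<And>n. g n \<in> borel_measurable borel" "\<And>n t. \<bar>g n t\<bar> \<le> 1"
    and lim: "\<And>t. (\<lambda>n. g n t) \<longlonglongrightarrow> f t"
  shows "poly_approximable I f"
  unfolding poly_approximable_def
proof (intro allI impI)
  fix e :: real assume e: "0 < e"
  have fm: "f \<in> borel_measurable borel" using g(2) lim by (rule borel_measurable_LIMSEQ_real[rotated])
  have fb: "\<bar>f t\<bar> \<le> 1" for t
    using tendsto_rabs[OF lim[of t]] g(3) by (intro LIMSEQ_le_const2) auto
  have ev: "\<forall>\<^sub>F n in sequentially. (\<integral>t. (g n t - f t)\<^sup>2 \<partial>M) < e / 4" if M: "M \<in> I" for M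
  proof -
    interpret finite_measure M using I(2)[OF M] by (simp add: unit_measure_def)
    have [measurable]: "f \<in> borel_measurable M" "g n \<in> borel_measurable M" for n
      using fm g(2) I(2)[OF M] by (simp_all add: unit_measure_def cong: measurable_cong_sets)
    have "(\<lambda>n. \<integral>t. (g n t - f t)\<^sup>2 \<partial>M) \<longlonglongrightarrow> (\<integral>t. 0 \<partial>M)"
    proof (rule integral_dominated_convergence[where w = "\<lambda>_. 4"])
      show "AE t in M. (\<lambda>n. (g n t - f t)\<^sup>2) \<longlonglongrightarrow> 0"
        using lim by (auto intro!: AE_I2 tendsto_eq_intros)
      show "AE t in M. norm ((g n t - f t)\<^sup>2) \<le> 4" for n
      proof (rule AE_I2)
        fix t
        have "\<bar>g n t - f t\<bar> \<le> 2" using fb[of t] g(3)[of n t] by linarith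
        then have "\<bar>g n t - f t\<bar>\<^sup>2 \<le> 2\<^sup>2" by (intro power_mono) auto
        then show "norm ((g n t - f t)\<^sup>2) \<le> 4" by simp
      qed
    qed auto
    then show ?thesis using e by (intro order_tendstoD) auto
  qed
  then have "\<forall>\<^sub>F n in sequentially. \<forall>M\<in>I. (\<integral>t. (g n t - f t)\<^sup>2 \<partial>M) < e / 4"
    using I(1) by (simp add: eventually_ball_finite_distrib)
  then obtain n where n: "\<And>M. M \<in> I \<Longrightarrow> (\<integral>t. (g n t - f t)\<^sup>2 \<partial>M) < e / 4"
    using eventually_happens'[OF sequentially_bot] by blast
  obtain p where p: "\<And>M. M \<in> I \<Longrightarrow> (\<integral>t. (poly p t - g n t)\<^sup>2 \<partial>M) < e / 4"
    using g(1)[of n] e unfolding poly_approximable_def by (metis divide_pos_pos zero_less_numeral)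
  have "(\<integral>t. (poly p t - f t)\<^sup>2 \<partial>M) < e" if M: "M \<in> I" for M
  proof -
    have "sq_int M (\<lambda>t. poly p t - g n t)" "sq_int M (\<lambda>t. g n t - f t)"
      using g(3) fb
      by (intro sq_int_diff sq_int_poly unit_measure_sq_int[where c = 1] I(2)[OF M] fm g(2); simp)+
    from sq_integral_triangle[OF this] show ?thesis using n[OF M] p[OF M] by linarith
  qed
  then show "\<exists>p. \<forall>M\<in>I. (\<integral>t. (poly p t - f t)\<^sup>2 \<partial>M) < e" by blast
qed

lemma poly_approximable_continuous:
  assumes I: "finite I" "\<And>M. M \<in> I \<Longrightarrow> unit_measure M" and g: "continuous_on UNIV g"
  shows "poly_approximable I g"
  unfolding poly_approximable_def
proof (intro allI impI)
  fix e :: real assume e: "0 < e"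
  \<comment> \<open>\<open>C\<close> strictly exceeds every total mass and is positive even for
    empty \<open>I\<close>; \<open>d\<close> is then chosen such that d^2 * C = e.\<close>
  define C where "C = (\<Sum>M\<in>I. measure M UNIV) + 1"
  have C: "0 < C" "\<And>M. M \<in> I \<Longrightarrow> measure M UNIV < C"
  proof -
    have "0 \<le> (\<Sum>M\<in>I. measure M UNIV)" by (simp add: sum_nonneg)
    then show "0 < C" by (simp add: C_def)
    show "measure M UNIV < C" if "M \<in> I" for M
      using member_le_sum[OF that, of "\<lambda>M. measure M UNIV"] I(1) by (simp add: C_def)
  qed
  define d where "d = sqrt (e / C)"
  have d: "0 < d" "d\<^sup>2 * C = e" using e C by (auto simp: d_def)
  obtain h where h: "real_polynomial_function h" "\<And>t. t \<in> {0..1} \<Longrightarrow> \<bar>g t - h t\<bar> < d"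
    using Stone_Weierstrass_real_polynomial_function[of "{0..1::real}" g d] g d
    by (auto intro: continuous_on_subset)
  then obtain a n where a: "h = (\<lambda>t. \<Sum>i\<le>n. a i * t ^ i)"
    by (auto simp: real_polynomial_function_iff_sum)
  define p where "p = (\<Sum>i\<le>n. monom (a i) i)"
  have p: "poly p t = h t" for t by (simp add: p_def a poly_sum poly_monom)
  have "(\<integral>t. (poly p t - g t)\<^sup>2 \<partial>M) < e" if M: "M \<in> I" for M
  proof -
    note u = I(2)[OF M, unfolded unit_measure_def]
    interpret finite_measure M using u by simp
    have ae: "AE t in M. \<bar>poly p t - g t\<bar> \<le> d"
      using u[THEN conjunct2, THEN conjunct2]
      by eventually_elim (use h(2) in \<open>force simp: p abs_minus_commute\<close>)
    have "(\<lambda>t. poly p t - g t) \<in> borel_measurable M"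
      using borel_measurable_poly borel_measurable_continuous_onI[OF g] u
      by (intro borel_measurable_diff) (simp_all cong: measurable_cong_sets)
    then have "sq_int M (\<lambda>t. poly p t - g t)"
      using ae by (intro sq_int_bounded) unfold_locales
    then have "(\<integral>t. (poly p t - g t)\<^sup>2 \<partial>M) \<le> (\<integral>t. d\<^sup>2 \<partial>M)"
    proof (intro integral_mono_AE)
      show "AE t in M. (poly p t - g t)\<^sup>2 \<le> d\<^sup>2"
        using ae by eventually_elim (metis abs_ge_zero power2_abs power_mono)
    qed (auto simp: sq_int_def)
    also have "\<dots> = d\<^sup>2 * measure M UNIV"
      using u sets_eq_imp_space_eq[of M borel] by simp
    also have "\<dots> < d\<^sup>2 * C" using mult_strict_left_mono[OF C(2)[OF M], of "d\<^sup>2"] d(1) by simp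
    finally show ?thesis by (simp add: d)
  qed
  then show "\<exists>p. \<forall>M\<in>I. (\<integral>t. (poly p t - g t)\<^sup>2 \<partial>M) < e" by blast
qed

lemma poly_approximable_add:
  assumes I: "\<And>M. M \<in> I \<Longrightarrow> unit_measure M"
    and f: "poly_approximable I f" "f \<in> borel_measurable borel" "\<And>t. \<bar>f t\<bar> \<le> 1"
    and g: "poly_approximable I g" "g \<in> borel_measurable borel" "\<And>t. \<bar>g t\<bar> \<le> 1"
  shows "poly_approximable I (\<lambda>t. f t + g t)"
  unfolding poly_approximable_def
proof (intro allI impI)
  fix e :: real assume e: "0 < e"
  then have e4: "0 < e / 4" by simp
  obtain p where p: "\<And>M. M \<in> I \<Longrightarrow> (\<integral>t. (poly p t - f t)\<^sup>2 \<partial>M) < e / 4"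
    using f(1) e4 unfolding poly_approximable_def by blast
  obtain q where q: "\<And>M. M \<in> I \<Longrightarrow> (\<integral>t. (poly q t - g t)\<^sup>2 \<partial>M) < e / 4"
    using g(1) e4 unfolding poly_approximable_def by blast
  have "(\<integral>t. (poly (p + q) t - (f t + g t))\<^sup>2 \<partial>M) < e" if M: "M \<in> I" for M
  proof -
    have "sq_int M (\<lambda>t. poly p t - f t)" "sq_int M (\<lambda>t. poly q t - g t)"
      using f(3) g(3)
      by (intro sq_int_diff sq_int_poly unit_measure_sq_int[where c = 1] I[OF M] f(2) g(2); simp)+
    moreover have "(\<lambda>t. (poly p t + g t) - (f t + g t)) = (\<lambda>t. poly p t - f t)"
      "(\<lambda>t. poly (p + q) t - (poly p t + g t)) = (\<lambda>t. poly q t - g t)"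
      by auto
    ultimately show ?thesis
      using sq_integral_triangle[of M "poly (p + q)" "\<lambda>t. poly p t + g t" "\<lambda>t. f t + g t"]
        p[OF M] q[OF M] by simp
  qed
  then show "\<exists>p. \<forall>M\<in>I. (\<integral>t. (poly p t - (f t + g t))\<^sup>2 \<partial>M) < e" by blast
qed

text \<open>Induction over the Borel sets from the intersection-stable generator of half-lines,
  where the disjoint form of the union step lets indicators be added.\<close>

lemma poly_approximable_indicator:
  assumes I: "finite I" "\<And>M. M \<in> I \<Longrightarrow> unit_measure M" and S: "S \<in> sets borel"
  shows "poly_approximable I (indicator S)"
proof -
  have b: "borel = sigma UNIV (range (\<lambda>a::real. {..a}))" by (rule borel_eq_atMost)
  have "Int_stable (range (\<lambda>a::real. {..a}))"
    by (auto simp: Int_stable_def)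
  moreover have "range (\<lambda>a::real. {..a}) \<subseteq> Pow UNIV" by simp
  moreover have "S \<in> sigma_sets UNIV (range (\<lambda>a::real. {..a}))" using S by (subst (asm) b) simp
  ultimately show ?thesis
  proof (induction S rule: sigma_sets_induct_disjoint)
    case (basic S)
    then obtain a where a: "S = {..a}" by auto
    \<comment> \<open>Continuous ramps that are 1 up to \<open>a\<close> and, for positive
      \<open>n\<close>, descend linearly to 0 at a + 1/n.\<close>
    define g where "g n t = max 0 (min 1 (1 - real n * (t - a)))" for n t
    show ?case
    proof (rule poly_approximable_limit[OF I, where g = g])
      show c: "poly_approximable I (g n)" "g n \<in> borel_measurable borel" for n
      proof -
        have "continuous_on UNIV (g n)" unfolding g_def by (intro continuous_intros)
        then show "poly_approximable I (g n)" "g n \<in> borel_measurable borel"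
          using poly_approximable_continuous[OF I] borel_measurable_continuous_onI by auto
      qed
      show "\<bar>g n t\<bar> \<le> 1" for n t by (auto simp: g_def)
      show "(\<lambda>n. g n t) \<longlonglongrightarrow> indicator S t" for t
      proof (cases "t \<le> a")
        case True
        have "real n * (t - a) \<le> 0" for n using True by (simp add: mult_nonneg_nonpos)
        then have "g n t = 1" for n by (simp add: g_def)
        then show ?thesis using True a by simp
      next
        case False
        obtain N where N: "1 < real N * (t - a)"
          using False reals_Archimedean3[of "t - a"] by auto
        have "g n t = 0" if "N \<le> n" for n
        proof -
          have "real N * (t - a) \<le> real n * (t - a)" using that False by (intro mult_right_mono) auto
          then show ?thesis using N by (simp add: g_def)
        qed
        then show ?thesis
          using False a by (intro tendsto_eventually) (auto simp: eventually_sequentially)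
      qed
    qed
  next
    case empty
    show ?case by (auto simp: poly_approximable_def intro!: exI[of _ 0])
  next
    case (compl A)
    show ?case
      unfolding poly_approximable_def
    proof (intro allI impI)
      fix e :: real assume "0 < e"
      then obtain p where p: "\<forall>M\<in>I. (\<integral>t. (poly p t - indicator A t)\<^sup>2 \<partial>M) < e"
        using compl by (auto simp: poly_approximable_def)
      have "(\<lambda>t. (poly (1 - p) t - indicator (UNIV - A) t)\<^sup>2) = (\<lambda>t. (poly p t - indicator A t)\<^sup>2)"
        by (auto simp: fun_eq_iff indicator_def power2_eq_square algebra_simps)
      then show "\<exists>p. \<forall>M\<in>I. (\<integral>t. (poly p t - indicator (UNIV - A) t)\<^sup>2 \<partial>M) < e"
        using p by metis
    qed
  next
    case (union A)
    then have A: "A i \<in> sets borel" for i by (subst b) auto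
    show ?case
    proof (rule poly_approximable_limit[OF I, where g = "\<lambda>n. indicator (\<Union>i<n. A i)"])
      show "poly_approximable I (indicator (\<Union>i<n. A i))" for n
      proof (induction n)
        case 0
        show ?case by (auto simp: poly_approximable_def intro!: exI[of _ 0])
      next
        case (Suc n)
        have "indicator (\<Union>i<Suc n. A i) = (\<lambda>t. indicator (\<Union>i<n. A i) t + indicator (A n) t :: real)"
        proof
          fix t
          have "A i \<inter> A n = {}" if "i < n" for i
            using disjoint_family_onD[OF union(1), of i n] that by simp
          then have "(\<Union>i<n. A i) \<inter> A n = {}" by blast
          then show "indicator (\<Union>i<Suc n. A i) t = (indicator (\<Union>i<n. A i) t + indicator (A n) t :: real)"
            by (auto simp: indicator_def less_Suc_eq)
        qed
        moreover have "poly_approximable I (\<lambda>t. indicator (\<Union>i<n. A i) t + indicator (A n) t)"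
          using A by (intro poly_approximable_add[OF I(2)] Suc.IH union.IH borel_measurable_indicator sets.finite_UN)
            (auto simp: indicator_def)
        ultimately show ?case by simp
      qed
      show "(\<lambda>n. indicator (\<Union>i<n. A i) t) \<longlonglongrightarrow> indicator (\<Union>i. A i) t" for t
        by (rule LIMSEQ_indicator_UN)
    qed (use A in \<open>auto simp: indicator_def intro!: borel_measurable_indicator\<close>)
  qed
qed

lemma poly_sq_conv_indicator:
  assumes I: "finite I" "\<And>M. M \<in> I \<Longrightarrow> unit_measure M" and S: "S \<in> sets borel"
  obtains p where "\<And>M. M \<in> I \<Longrightarrow> sq_conv M (\<lambda>n. poly (p n)) (indicator S)"
proof -
  have "\<exists>p. \<forall>M\<in>I. (\<integral>t. (poly p t - indicator S t)\<^sup>2 \<partial>M) < 1 / real (Suc n)" for n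
    using poly_approximable_indicator[OF I S] unfolding poly_approximable_def by simp
  then obtain p where p: "\<And>n M. M \<in> I \<Longrightarrow> (\<integral>t. (poly (p n) t - indicator S t)\<^sup>2 \<partial>M) < 1 / real (Suc n)"
    by metis
  show ?thesis
  proof (rule that)
    fix M assume M: "M \<in> I"
    have "sq_int M (indicator S)"
      using S by (intro unit_measure_sq_int[where c = 1] I(2)[OF M]) (auto simp: indicator_def)
    moreover have "(\<lambda>n. \<integral>t. (poly (p n) t - indicator S t)\<^sup>2 \<partial>M) \<longlonglongrightarrow> 0"
    proof (rule Lim_null_comparison[OF always_eventually])
      show "(\<lambda>n. 1 / real (Suc n)) \<longlonglongrightarrow> 0" by (rule LIMSEQ_Suc[OF lim_1_over_n])
      show "\<forall>n. norm (\<integral>t. (poly (p n) t - indicator S t)\<^sup>2 \<partial>M) \<le> 1 / real (Suc n)"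
        using p[OF M] by (auto intro: less_imp_le)
    qed
    ultimately show "sq_conv M (\<lambda>n. poly (p n)) (indicator S)"
      by (simp add: sq_conv_def sq_int_poly[OF I(2)[OF M]])
  qed
qed

section \<open>The spectral measure of a positive contraction\<close>

lemma orthogonal_projection_iff: "orthogonal_projection P \<longleftrightarrow> symmetric_map P \<and> P \<circ> P = P"
  by (auto simp: orthogonal_projection_def symmetric_map_def clinear_map_def)

locale contraction_calculus =
  fixes R :: "'a::complex_hilbert_space \<Rightarrow> 'a" and \<mu> :: "'a \<Rightarrow> real measure"
  assumes contraction: "positive_contraction R"
    and unit: "unit_measure (\<mu> x)"
    and moments: "(\<integral>t. poly p t \<partial>\<mu> x) = Re \<langle>x, op_poly R p x\<rangle>"
begin

lemma symmetric_R: "symmetric_map R"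
  using contraction by (simp add: positive_contraction_def)

text \<open>Symmetry of p(R) turns <p(R) x, q(R) x> into the moment of \<open>p * q\<close>, which
  is the required isometry.\<close>

sublocale sq_calculus UNIV poly "op_poly R" \<mu>
proof
  show "sq_int (\<mu> x) (poly p)" for x p by (rule sq_int_poly[OF unit])
  show "\<langle>op_poly R p x, op_poly R q x\<rangle> = complex_of_real (\<integral>t. poly p t * poly q t \<partial>\<mu> x)" for p q x
  proof -
    have "\<langle>op_poly R p x, op_poly R q x\<rangle> = \<langle>x, op_poly R (p * q) x\<rangle>"
      by (simp add: symmetric_mapD(2)[OF symmetric_op_poly[OF symmetric_R]]
          op_poly_mult[OF symmetric_mapD(1)[OF symmetric_R]])
    also have "\<dots> = complex_of_real (\<integral>t. poly (p * q) t \<partial>\<mu> x)"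
      unfolding moments by (rule symmetric_mapD(3)[OF symmetric_op_poly[OF symmetric_R]])
    finally show ?thesis by simp
  qed
qed

definition proj :: "real set \<Rightarrow> 'a \<Rightarrow> 'a" where
  "proj S = ext (indicator S)"

lemma approximates_indicator:
  assumes "S \<in> sets borel" "finite X"
  obtains p where "\<And>x. x \<in> X \<Longrightarrow> approximates p (indicator S) x"
proof -
  obtain p where "\<And>M. M \<in> \<mu> ` X \<Longrightarrow> sq_conv M (\<lambda>n. poly (p n)) (indicator S)"
    using poly_sq_conv_indicator[of "\<mu> ` X" S] assms unit by (metis finite_imageI imageE)
  then show ?thesis using that[of p] by (simp add: approximates_def)
qed

lemma proj_inner:
  assumes "S \<in> sets borel" "S' \<in> sets borel"
  shows "\<langle>proj S x, proj S' x\<rangle> = complex_of_real (measure (\<mu> x) (S \<inter> S'))"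
proof -
  obtain p q where "approximates p (indicator S) x" "approximates q (indicator S') x"
    using approximates_indicator[of S "{x}"] approximates_indicator[of S' "{x}"] assms by (metis finite.emptyI finite_insert singletonI)
  from ext_inner[OF this]
  have "\<langle>proj S x, proj S' x\<rangle> = complex_of_real (\<integral>t. indicator (S \<inter> S') t \<partial>\<mu> x)"
    by (simp add: proj_def indicator_inter_arith)
  then show ?thesis
    using unit[of x] assms by (simp add: unit_measure_def sets_eq_imp_space_eq[of "\<mu> x" borel])
qed

lemma proj_UNIV: "proj UNIV x = x"
proof -
  have "sq_int (\<mu> x) (\<lambda>t. 1)" using sq_int_ev[of 1 x] by (simp add: poly_1[abs_def])
  then have "approximates (\<lambda>n. 1) (indicator UNIV) x"
    using sq_conv_const[of "\<mu> x" "\<lambda>t. 1"] by (simp add: approximates_def indicator_def poly_1[abs_def])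
  from ext_tendsto[OF this] show ?thesis
    by (simp add: proj_def LIMSEQ_const_iff)
qed

lemma symmetric_proj:
  assumes S: "S \<in> sets borel"
  shows "symmetric_map (proj S)"
  unfolding symmetric_map_def clinear_map_def
proof (intro conjI allI)
  fix x y :: 'a and c
  \<comment> \<open>A single sequence for all four vectors, so that the linear and symmetric
    behaviour of its members passes to the limit.\<close>
  obtain p where p: "\<And>z. z \<in> {x, y, x + y, c *\<^sub>C x} \<Longrightarrow> approximates p (indicator S) z"
    using approximates_indicator[OF S, of "{x, y, x + y, c *\<^sub>C x}"] by auto
  then have lim: "(\<lambda>n. op_poly R (p n) z) \<longlonglongrightarrow> proj S z" if "z \<in> {x, y, x + y, c *\<^sub>C x}" for z
    using ext_tendsto that by (simp add: proj_def)
  note sym = symmetric_op_poly[OF symmetric_R]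
  note lin = clinear_mapD[OF symmetric_mapD(1)[OF sym]]
  have "(\<lambda>n. op_poly R (p n) (x + y)) \<longlonglongrightarrow> proj S x + proj S y"
    unfolding lin by (intro tendsto_add lim) auto
  then show "proj S (x + y) = proj S x + proj S y" using lim[of "x + y"] LIMSEQ_unique by blast
  have "(\<lambda>n. op_poly R (p n) (c *\<^sub>C x)) \<longlonglongrightarrow> c *\<^sub>C proj S x"
    unfolding lin by (intro tendsto_scaleC lim) auto
  then show "proj S (c *\<^sub>C x) = c *\<^sub>C proj S x" using lim[of "c *\<^sub>C x"] LIMSEQ_unique by blast
  have "(\<lambda>n. \<langle>op_poly R (p n) x, y\<rangle>) \<longlonglongrightarrow> \<langle>x, proj S y\<rangle>"
    unfolding symmetric_mapD(2)[OF sym] by (intro tendsto_cinner tendsto_const lim) auto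
  moreover have "(\<lambda>n. \<langle>op_poly R (p n) x, y\<rangle>) \<longlonglongrightarrow> \<langle>proj S x, y\<rangle>"
    by (intro tendsto_cinner tendsto_const lim) auto
  ultimately show "\<langle>proj S x, y\<rangle> = \<langle>x, proj S y\<rangle>" using LIMSEQ_unique by blast
qed

lemma cinner_proj:
  assumes "S \<in> sets borel"
  shows "\<langle>x, proj S x\<rangle> = complex_of_real (measure (\<mu> x) S)"
  using proj_inner[of UNIV S x] assms by (simp add: proj_UNIV)

text \<open>By \<open>proj_inner\<close> and symmetry, both sides have the measure of the
  intersection as quadratic form.\<close>

lemma proj_comp:
  assumes S: "S \<in> sets borel" and S': "S' \<in> sets borel"
  shows "proj (S \<inter> S') = proj S \<circ> proj S'"
proof (rule clinear_map_eqI)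
  show "clinear_map (proj S \<circ> proj S')"
    using symmetric_mapD(1)[OF symmetric_proj[OF S]] symmetric_mapD(1)[OF symmetric_proj[OF S']]
    by (auto simp: clinear_map_def)
  show "clinear_map (proj (S \<inter> S'))"
    using assms by (intro symmetric_mapD(1) symmetric_proj) auto
  show "\<langle>x, proj (S \<inter> S') x\<rangle> = \<langle>x, (proj S \<circ> proj S') x\<rangle>" for x
    using assms proj_inner[OF assms, of x]
    by (simp add: cinner_proj symmetric_mapD(2)[OF symmetric_proj[OF S]])
qed

lemma proj_Un:
  assumes "S \<in> sets borel" "S' \<in> sets borel" "S \<inter> S' = {}"
  shows "proj (S \<union> S') x = proj S x + proj S' x"
proof -
  have "proj (S \<union> S') = (\<lambda>x. proj S x + proj S' x)"
  proof (rule clinear_map_eqI)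
    show "clinear_map (proj (S \<union> S'))"
      using assms by (intro symmetric_mapD(1) symmetric_proj) auto
    show "clinear_map (\<lambda>x. proj S x + proj S' x)"
      using symmetric_mapD(1)[OF symmetric_proj[OF assms(1)]] symmetric_mapD(1)[OF symmetric_proj[OF assms(2)]]
      by (auto simp: clinear_map_def scaleC_add_right)
    show "\<langle>x, proj (S \<union> S') x\<rangle> = \<langle>x, proj S x + proj S' x\<rangle>" for x
    proof -
      interpret finite_measure "\<mu> x" using unit by (simp add: unit_measure_def)
      have "sets (\<mu> x) = sets borel" using unit by (simp add: unit_measure_def)
      then show ?thesis
        using assms by (simp add: cinner_add_right cinner_proj finite_measure_Union)
    qed
  qed
  then show ?thesis by simp
qed

text \<open>The squared norm of the remainder is the measure of the part of the union not yet
  exhausted, so continuity from below gives strong convergence.\<close>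

lemma proj_sums:
  assumes F: "range F \<subseteq> sets borel" and disj: "disjoint_family F"
  shows "(\<lambda>n::nat. proj (F n) x) sums proj (\<Union>n. F n) x"
proof -
  interpret finite_measure "\<mu> x" using unit by (simp add: unit_measure_def)
  have sets: "sets (\<mu> x) = sets borel" using unit by (simp add: unit_measure_def)
  define G where "G n = (\<Union>i<n. F i)" for n :: nat
  define U where "U = (\<Union>n. F n)"
  have G: "G n \<in> sets borel" for n using F by (auto simp: G_def)
  have U: "U \<in> sets borel" using F by (auto simp: U_def)
  have psum: "(\<Sum>i<n. proj (F i) x) = proj (G n) x" for n
  proof (induction n)
    case 0
    have "\<langle>proj {} x, proj {} x\<rangle> = 0" by (subst proj_inner) auto
    then show ?case by (simp add: G_def cinner_self)
  next
    case (Suc n)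
    have "F i \<inter> F n = {}" if "i < n" for i
      using disjoint_family_onD[OF disj, of i n] that by simp
    then have "G n \<inter> F n = {}" by (auto simp: G_def)
    moreover have "G (Suc n) = G n \<union> F n" by (auto simp: G_def less_Suc_eq)
    ultimately show ?case using Suc proj_Un[OF G] F by auto
  qed
  have diff: "(norm (proj (G n) x - proj U x))\<^sup>2 = measure (\<mu> x) U - measure (\<mu> x) (G n)" for n
  proof -
    have "G n \<union> (U - G n) = U" by (auto simp: G_def U_def)
    then have "proj U x = proj (G n) x + proj (U - G n) x"
      using proj_Un[of "G n" "U - G n" x] G U by (metis Diff_disjoint sets.Diff)
    then have "complex_of_real ((norm (proj (G n) x - proj U x))\<^sup>2) = \<langle>proj (U - G n) x, proj (U - G n) x\<rangle>"
      by (simp add: cinner_self)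
    also have "\<dots> = complex_of_real (measure (\<mu> x) (U - G n))"
      using G U by (subst proj_inner) auto
    also have "measure (\<mu> x) (U - G n) = measure (\<mu> x) U - measure (\<mu> x) (G n)"
      using G U by (intro finite_measure_Diff) (auto simp: sets, auto simp: G_def U_def)
    finally show ?thesis by (simp only: of_real_eq_iff)
  qed
  have "incseq G" unfolding G_def by (intro monoI UN_mono) auto
  have "(\<lambda>n. measure (\<mu> x) (G n)) \<longlonglongrightarrow> measure (\<mu> x) (\<Union>n. G n)"
    using G \<open>incseq G\<close> by (intro finite_Lim_measure_incseq) (auto simp: sets)
  moreover have "(\<Union>n. G n) = U" by (auto simp: G_def U_def)
  ultimately have "(\<lambda>n. (norm (proj (G n) x - proj U x))\<^sup>2) \<longlonglongrightarrow> measure (\<mu> x) U - measure (\<mu> x) U"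
    unfolding diff by (intro tendsto_diff tendsto_const) simp
  from tendsto_real_sqrt[OF this] have "(\<lambda>n. proj (G n) x - proj U x) \<longlonglongrightarrow> 0"
    by (simp add: tendsto_norm_zero_iff)
  then have "(\<lambda>n. proj (G n) x) \<longlonglongrightarrow> proj U x" by (rule LIM_zero_cancel)
  then show ?thesis by (simp add: sums_def psum U_def)
qed

lemma projection_valued_measure_proj: "projection_valued_measure proj"
  unfolding projection_valued_measure_def
proof (intro conjI ballI allI impI)
  show "orthogonal_projection (proj S)" if "S \<in> sets borel" for S
    using symmetric_proj[OF that] proj_comp[OF that that] by (simp add: orthogonal_projection_iff)
qed (auto simp: proj_UNIV proj_comp proj_sums fun_eq_iff)

text \<open>The moment measures from which \<open>proj\<close> was built come back as its scalar
  measures, by \<open>proj_inner\<close> with equal sets.\<close>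

lemma scalar_measure_proj: "scalar_measure proj x = \<mu> x"
proof -
  interpret finite_measure "\<mu> x" using unit by (simp add: unit_measure_def)
  have sets: "sets (\<mu> x) = sets borel" using unit by (simp add: unit_measure_def)
  have "ennreal ((norm (proj S x))\<^sup>2) = emeasure (\<mu> x) S" if "S \<in> sets borel" for S
  proof -
    have "complex_of_real ((norm (proj S x))\<^sup>2) = complex_of_real (measure (\<mu> x) S)"
      using that by (simp only: cinner_self[symmetric]) (simp add: proj_inner)
    then show ?thesis by (simp only: of_real_eq_iff emeasure_eq_measure)
  qed
  then have "scalar_measure proj x = measure_of (space (\<mu> x)) (sets (\<mu> x)) (emeasure (\<mu> x))"
    unfolding scalar_measure_def sets sets_eq_imp_space_eq[OF sets]
    by (simp, intro measure_of_eq) (auto simp: sets.sigma_sets_eq[of borel, simplified])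
  then show ?thesis by (simp add: measure_of_of_measure)
qed

end

text \<open>Only the support in [0,1] and the first moment are passed on: the first moment is the
  quadratic form of \<open>R\<close> and so ties \<open>E\<close> to \<open>R\<close>.\<close>

lemma contraction_spectral_measure:
  assumes R: "positive_contraction R"
  obtains E where "projection_valued_measure E"
    "\<And>x. unit_measure (scalar_measure E x)"
    "\<And>x. (\<integral>t. t \<partial>scalar_measure E x) = Re \<langle>x, R x\<rangle>"
proof -
  obtain \<mu> where \<mu>: "\<And>x. finite_measure (\<mu> x) \<and> sets (\<mu> x) = sets borel \<and> (AE t in \<mu> x. 0 \<le> t \<and> t \<le> (1::real)) \<and>
      (\<forall>p. (\<integral>t. poly p t \<partial>\<mu> x) = Re \<langle>x, op_poly R p x\<rangle>)"
    using moment_measure[OF R] by metis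
  interpret contraction_calculus R \<mu>
    by unfold_locales (use R \<mu> in \<open>auto simp: unit_measure_def\<close>)
  note lin = symmetric_mapD(1)[OF symmetric_R]
  have "(\<integral>t. t \<partial>\<mu> x) = Re \<langle>x, R x\<rangle>" for x
    using moments[where p = "[:0, 1:]" and x = x] by (simp add: op_poly_pCons[OF lin] clinear_mapD[OF lin])
  then show ?thesis
    using that projection_valued_measure_proj unit by (simp add: scalar_measure_proj)
qed

section \<open>Functional calculus of a projection-valued measure\<close>

text \<open>The sets in a list may overlap. Sums are then concatenations and products are lists of
  pairwise intersections, without passing to a normal form.\<close>

fun simple_val :: "(real \<times> real set) list \<Rightarrow> real \<Rightarrow> real" where
  "simple_val [] t = 0"
| "simple_val ((c, S) # l) t = c * indicator S t + simple_val l t"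

fun simple_mult :: "(real \<times> real set) list \<Rightarrow> (real \<times> real set) list \<Rightarrow> (real \<times> real set) list" where
  "simple_mult [] m = []"
| "simple_mult ((c, S) # l) m = map (\<lambda>(d, T). (c * d, S \<inter> T)) m @ simple_mult l m"

definition borel_simple :: "(real \<times> real set) list set" where
  "borel_simple = {l. \<forall>(c, S) \<in> set l. S \<in> sets borel}"

lemma borel_simple_Nil [simp]: "[] \<in> borel_simple"
  by (simp add: borel_simple_def)

lemma borel_simple_Cons [simp]: "(c, S) # l \<in> borel_simple \<longleftrightarrow> S \<in> sets borel \<and> l \<in> borel_simple"
  by (auto simp: borel_simple_def)

lemma borel_simple_append [simp]: "l @ m \<in> borel_simple \<longleftrightarrow> l \<in> borel_simple \<and> m \<in> borel_simple"
  by (auto simp: borel_simple_def)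

lemma borel_simple_Int: "S \<in> sets borel \<Longrightarrow> m \<in> borel_simple \<Longrightarrow> map (\<lambda>(d, T). (c * d, S \<inter> T)) m \<in> borel_simple"
  by (induction m) auto

lemma borel_simple_mult: "l \<in> borel_simple \<Longrightarrow> m \<in> borel_simple \<Longrightarrow> simple_mult l m \<in> borel_simple"
  by (induction l m rule: simple_mult.induct) (auto intro: borel_simple_Int)

lemma simple_val_append: "simple_val (l @ m) t = simple_val l t + simple_val m t"
  by (induction l t rule: simple_val.induct) auto

lemma simple_val_mult: "simple_val (simple_mult l m) t = simple_val l t * simple_val m t"
proof (induction l m rule: simple_mult.induct)
  case (2 c S l m)
  have "simple_val (map (\<lambda>(d, T). (c * d, S \<inter> T)) m) t = c * indicator S t * simple_val m t"
    by (induction m) (auto simp: indicator_inter_arith algebra_simps)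
  then show ?case using 2 by (simp add: simple_val_append algebra_simps)
qed simp

lemma simple_val_measurable: "l \<in> borel_simple \<Longrightarrow> simple_val l \<in> borel_measurable borel"
proof (induction l)
  case (Cons a l)
  obtain c S where [simp]: "a = (c, S)" by (cases a)
  have "simple_val (a # l) = (\<lambda>t. c * indicator S t + simple_val l t)" by auto
  then show ?case using Cons
    by (auto intro!: borel_measurable_add borel_measurable_times borel_measurable_indicator)
qed (simp add: simple_val.simps(1)[abs_def])

lemma simple_val_bounded: "\<exists>C. \<forall>t. \<bar>simple_val l t\<bar> \<le> C"
proof (induction l)
  case (Cons a l)
  then obtain C where C: "\<And>t. \<bar>simple_val l t\<bar> \<le> C" by blast
  obtain c S where a: "a = (c, S)" by (cases a)
  have "\<bar>simple_val (a # l) t\<bar> \<le> \<bar>c\<bar> + C" for t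
    using C[of t] by (auto simp: a indicator_def)
  then show ?case by blast
qed auto

lemma simple_function_simple_val:
  assumes F: "simple_function borel (F :: real \<Rightarrow> real)"
  obtains l where "l \<in> borel_simple" "simple_val l = F"
proof -
  have fin: "finite (range F)" using F by (simp add: simple_function_def)
  have m: "F -` {c} \<in> sets borel" for c
    using simple_functionD(2)[OF F, of "{c}"] by simp
  obtain xs where xs: "set xs = range F" "distinct xs" using finite_distinct_list[OF fin] by blast
  define l where "l = map (\<lambda>c. (c, F -` {c})) xs"
  have "simple_val (map (\<lambda>c. (c, F -` {c})) ys) t = (if F t \<in> set ys then F t else 0)" if "distinct ys" for ys t
    using that by (induction ys) (auto simp: indicator_def)
  then have "simple_val l = F" using xs by (auto simp: l_def)
  moreover have "l \<in> borel_simple" using m by (auto simp: l_def borel_simple_def)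
  ultimately show ?thesis using that by blast
qed

text \<open>The factor 2 is inherited from \<open>borel_measurable_implies_sequence_metric\<close>;
  its purpose is domination by a multiple of \<open>f\<close>.\<close>

lemma simple_val_approximation:
  assumes f: "f \<in> borel_measurable borel"
  obtains s where "\<And>n::nat. s n \<in> borel_simple" "\<And>t. (\<lambda>n. simple_val (s n) t) \<longlonglongrightarrow> f t"
    "\<And>n t. \<bar>simple_val (s n) t\<bar> \<le> 2 * \<bar>f t\<bar>"
proof -
  obtain F where F: "\<And>i. simple_function borel (F i)" "\<And>t. (\<lambda>i. F i t) \<longlonglongrightarrow> f t"
    "\<And>i t. dist (F i t) 0 \<le> 2 * dist (f t) 0"
    using borel_measurable_implies_sequence_metric[OF f, of 0] by auto
  have "\<forall>i. \<exists>l. l \<in> borel_simple \<and> simple_val l = F i"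
    using simple_function_simple_val[OF F(1)] by metis
  then obtain s where "\<And>i. s i \<in> borel_simple" "\<And>i. simple_val (s i) = F i" by metis
  then show ?thesis using that[of s] F by (simp add: dist_norm)
qed

lemma sq_conv_dominated:
  assumes f: "sq_int M f" and s: "\<And>n::nat. s n \<in> borel_measurable M"
    and lim: "\<And>t. (\<lambda>n. s n t) \<longlonglongrightarrow> f t" and bound: "\<And>n t. \<bar>s n t\<bar> \<le> c * \<bar>f t\<bar>"
  shows "sq_conv M s f"
proof -
  have fm [measurable]: "f \<in> borel_measurable M" using f by (simp add: sq_int_def)
  note [measurable] = s
  have "(\<lambda>n. \<integral>t. (s n t - f t)\<^sup>2 \<partial>M) \<longlonglongrightarrow> (\<integral>t. 0 \<partial>M)"
  proof (rule integral_dominated_convergence[where w = "\<lambda>t. (c + 1)\<^sup>2 * (f t)\<^sup>2"])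
    show "AE t in M. (\<lambda>n. (s n t - f t)\<^sup>2) \<longlonglongrightarrow> 0"
      using lim by (auto intro!: AE_I2 tendsto_eq_intros)
    show "AE t in M. norm ((s n t - f t)\<^sup>2) \<le> (c + 1)\<^sup>2 * (f t)\<^sup>2" for n
    proof (rule AE_I2)
      fix t
      have "\<bar>s n t - f t\<bar> \<le> (c + 1) * \<bar>f t\<bar>" using bound[of n t] by (simp add: distrib_right)
      then have "\<bar>s n t - f t\<bar>\<^sup>2 \<le> ((c + 1) * \<bar>f t\<bar>)\<^sup>2" by (intro power_mono) auto
      then show "norm ((s n t - f t)\<^sup>2) \<le> (c + 1)\<^sup>2 * (f t)\<^sup>2" by (simp add: power_mult_distrib)
    qed
    show "integrable M (\<lambda>t. (c + 1)\<^sup>2 * (f t)\<^sup>2)" using sq_int_integrable[OF f] by simp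
  qed auto
  then show ?thesis
    using f sq_int_bound[OF f s, where c = c] bound by (simp add: sq_conv_def)
qed

text \<open>Fatou's lemma turns a uniform bound along simple approximations into membership in the
  domain of an unbounded integral.\<close>

lemma sq_int_Fatou:
  assumes s: "\<And>n::nat. sq_int M (s n)" and f: "f \<in> borel_measurable M"
    and lim: "\<And>t. (\<lambda>n. s n t) \<longlonglongrightarrow> f t" and bound: "\<And>n. (\<integral>t. (s n t)\<^sup>2 \<partial>M) \<le> C"
  shows "sq_int M f"
  unfolding sq_int_def
proof (intro conjI f integrableI_bounded)
  have [measurable]: "f \<in> borel_measurable M" "s n \<in> borel_measurable M" for n
    using s f by (auto simp: sq_int_def)
  have l: "liminf (\<lambda>n. ennreal ((s n t)\<^sup>2)) = ennreal ((f t)\<^sup>2)" for t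
    by (intro lim_imp_Liminf tendsto_ennrealI tendsto_power lim) simp
  have "(\<integral>\<^sup>+t. ennreal (norm ((f t)\<^sup>2)) \<partial>M) = (\<integral>\<^sup>+t. liminf (\<lambda>n. ennreal ((s n t)\<^sup>2)) \<partial>M)"
    by (simp add: l)
  also have "\<dots> \<le> liminf (\<lambda>n. \<integral>\<^sup>+t. ennreal ((s n t)\<^sup>2) \<partial>M)"
    by (rule nn_integral_liminf) simp
  also have "\<dots> \<le> ennreal C"
  proof (rule Liminf_le)
    show "\<forall>\<^sub>F n in sequentially. (\<integral>\<^sup>+t. ennreal ((s n t)\<^sup>2) \<partial>M) \<le> ennreal C"
    proof (intro always_eventually allI)
      fix n
      have "(\<integral>\<^sup>+t. ennreal ((s n t)\<^sup>2) \<partial>M) = ennreal (\<integral>t. (s n t)\<^sup>2 \<partial>M)"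
        using sq_int_integrable[OF s] by (intro nn_integral_eq_integral) auto
      then show "(\<integral>\<^sup>+t. ennreal ((s n t)\<^sup>2) \<partial>M) \<le> ennreal C"
        using bound by (simp add: ennreal_leI)
    qed
  qed simp
  finally show "(\<integral>\<^sup>+t. ennreal (norm ((f t)\<^sup>2)) \<partial>M) < \<infinity>"
    by (simp add: le_less_trans)
qed (use f in simp)

locale pvm =
  fixes E :: "real set \<Rightarrow> 'a::complex_hilbert_space \<Rightarrow> 'a"
  assumes pvm: "projection_valued_measure E"
begin

abbreviation \<mu> :: "'a \<Rightarrow> real measure" where "\<mu> \<equiv> scalar_measure E"

lemma symmetric_E: "S \<in> sets borel \<Longrightarrow> symmetric_map (E S)"
  using pvm by (auto simp: projection_valued_measure_def orthogonal_projection_iff)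

lemma E_linear: "S \<in> sets borel \<Longrightarrow> clinear_map (E S)"
  using symmetric_E symmetric_mapD(1) by blast

lemma E_UNIV [simp]: "E UNIV x = x"
  using pvm by (simp add: projection_valued_measure_def)

lemma E_Int: "S \<in> sets borel \<Longrightarrow> S' \<in> sets borel \<Longrightarrow> E (S \<inter> S') x = E S (E S' x)"
  using pvm by (simp add: projection_valued_measure_def)

lemma E_inner: "S \<in> sets borel \<Longrightarrow> S' \<in> sets borel \<Longrightarrow> \<langle>E S x, E S' x\<rangle> = \<langle>x, E (S \<inter> S') x\<rangle>"
  by (simp add: symmetric_mapD(2)[OF symmetric_E] E_Int)

lemma E_norm: "S \<in> sets borel \<Longrightarrow> \<langle>x, E S x\<rangle> = complex_of_real ((norm (E S x))\<^sup>2)"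
  using E_inner[of S S x] by (simp add: cinner_self)

lemma sets_\<mu> [simp, measurable_cong]: "sets (\<mu> x) = sets borel"
  unfolding scalar_measure_def by (simp add: sets.sigma_sets_eq[of borel, simplified])

lemma space_\<mu> [simp]: "space (\<mu> x) = UNIV"
  using sets_eq_imp_space_eq[OF sets_\<mu>] by simp

lemma borel_measurable_\<mu>: "f \<in> borel_measurable borel \<Longrightarrow> f \<in> borel_measurable (\<mu> x)"
  by (simp cong: measurable_cong_sets)

text \<open>\<open>measure_of\<close> falls back to the zero measure when its set function is not a
  measure, so positivity and countable additivity come before any evaluation.\<close>

lemma emeasure_\<mu>:
  assumes "S \<in> sets borel"
  shows "emeasure (\<mu> x) S = ennreal ((norm (E S x))\<^sup>2)"
proof (rule emeasure_measure_of[OF scalar_measure_def])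
  show "positive (sets (\<mu> x)) (\<lambda>S. ennreal ((norm (E S x))\<^sup>2))"
  proof -
    \<comment> \<open>Apply countable additivity to a sequence of empty sets: a convergent series
      with constant terms has terms 0.\<close>
    have "(\<lambda>n::nat. E {} x) sums E (\<Union>n::nat. {}) x"
      using pvm unfolding projection_valued_measure_def
      by (elim conjE allE[of _ "\<lambda>n. {}"] allE[of _ x]) (auto simp: disjoint_family_on_def)
    then have "(\<lambda>n::nat. E {} x) \<longlonglongrightarrow> 0" by (intro summable_LIMSEQ_zero) (rule sums_summable)
    then have "E {} x = 0" by (simp add: LIMSEQ_const_iff)
    then show ?thesis by (simp add: positive_def)
  qed
  show "countably_additive (sets (\<mu> x)) (\<lambda>S. ennreal ((norm (E S x))\<^sup>2))"
  proof (rule countably_additiveI)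
    fix F :: "nat \<Rightarrow> real set" assume F: "range F \<subseteq> sets (\<mu> x)" "disjoint_family F"
    then have FE: "(\<lambda>n. E (F n) x) sums E (\<Union>n. F n) x"
      using pvm by (simp add: projection_valued_measure_def)
    have n: "(norm (E S x))\<^sup>2 = Re \<langle>x, E S x\<rangle>" if "S \<in> sets borel" for S
      using E_norm[OF that] by simp
    have Fb: "F n \<in> sets borel" "(\<Union>n. F n) \<in> sets borel" for n using F by auto
    have "(\<lambda>n. (norm (E (F n) x))\<^sup>2) sums (norm (E (\<Union>n. F n) x))\<^sup>2"
      unfolding sums_def n[OF Fb(1)] n[OF Fb(2)]
      using tendsto_Re[OF tendsto_cinner[OF tendsto_const FE[unfolded sums_def], of x]]
      by (simp add: cinner_sum_right)
    then show "(\<Sum>n. ennreal ((norm (E (F n) x))\<^sup>2)) = ennreal ((norm (E (\<Union>n. F n) x))\<^sup>2)"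
      by (intro suminf_ennreal_eq) auto
  qed
qed (use assms in auto)

lemma finite_\<mu>: "finite_measure (\<mu> x)"
  by (rule finite_measureI) (simp add: emeasure_\<mu>)

lemma measure_\<mu>: "S \<in> sets borel \<Longrightarrow> measure (\<mu> x) S = (norm (E S x))\<^sup>2"
  by (simp add: measure_def emeasure_\<mu>)

fun simple_op :: "(real \<times> real set) list \<Rightarrow> 'a \<Rightarrow> 'a" where
  "simple_op [] x = 0"
| "simple_op ((c, S) # l) x = c *\<^sub>R E S x + simple_op l x"

lemma simple_op_append: "simple_op (l @ m) x = simple_op l x + simple_op m x"
  by (induction l x rule: simple_op.induct) auto

lemma symmetric_simple_op: "l \<in> borel_simple \<Longrightarrow> symmetric_map (simple_op l)"
proof (induction l)
  case (Cons a l)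
  obtain c S where a: "a = (c, S)" by (cases a)
  have S: "symmetric_map (E S)" and l: "symmetric_map (simple_op l)"
    using Cons by (auto simp: a symmetric_E)
  note linS = clinear_mapD[OF symmetric_mapD(1)[OF S]] and linl = clinear_mapD[OF symmetric_mapD(1)[OF l]]
  show ?case
    unfolding symmetric_map_def clinear_map_def
    by (auto simp: a linS linl scaleR_right_distrib scaleC_add_right scaleC_scaleR_commute cinner_add_left
        cinner_add_right cinner_scaleR_left cinner_scaleR_right symmetric_mapD(2)[OF S] symmetric_mapD(2)[OF l])
qed (auto simp: symmetric_map_def clinear_map_def)

lemma simple_op_mult:
  "l \<in> borel_simple \<Longrightarrow> m \<in> borel_simple \<Longrightarrow> simple_op (simple_mult l m) x = simple_op l (simple_op m x)"
proof (induction l m rule: simple_mult.induct)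
  case (2 c S l m)
  then have S: "S \<in> sets borel" by simp
  have "simple_op (map (\<lambda>(d, T). (c * d, S \<inter> T)) m) x = c *\<^sub>R E S (simple_op m x)"
    using 2(3)
  proof (induction m)
    case Nil
    show ?case by (simp add: clinear_mapD[OF E_linear[OF S]])
  next
    case (Cons a m)
    then show ?case using S
      by (cases a) (simp add: clinear_mapD[OF E_linear[OF S]] scaleR_right_distrib E_Int)
  qed
  then show ?case using 2 by (simp add: simple_op_append)
qed simp

lemma sq_int_simple: "l \<in> borel_simple \<Longrightarrow> sq_int (\<mu> x) (simple_val l)"
  using simple_val_bounded[of l] simple_val_measurable[of l]
  by (auto intro!: sq_int_bounded[OF finite_\<mu>])

lemma integrable_simple:
  assumes "l \<in> borel_simple"
  shows "integrable (\<mu> x) (simple_val l)"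
proof -
  obtain C where "\<And>t. \<bar>simple_val l t\<bar> \<le> C" using simple_val_bounded by blast
  then show ?thesis
    using borel_measurable_\<mu>[OF simple_val_measurable[OF assms]]
    by (intro finite_measure.integrable_const_bound[OF finite_\<mu>, where B = C]) auto
qed

lemma simple_op_inner_self:
  "l \<in> borel_simple \<Longrightarrow> \<langle>x, simple_op l x\<rangle> = complex_of_real (\<integral>t. simple_val l t \<partial>\<mu> x)"
proof (induction l)
  case (Cons a l)
  obtain c S where a: "a = (c, S)" by (cases a)
  have "integrable (\<mu> x) (\<lambda>t. c * indicator S t)" "integrable (\<mu> x) (simple_val l)"
    using Cons integrable_simple[of "[(1, S)]" x] by (auto simp: a integrable_simple simple_val.simps[abs_def])
  then show ?case
    using Cons by (simp add: a cinner_add_right cinner_scaleR_right E_norm measure_\<mu>)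
qed (simp add: simple_val.simps(1)[abs_def])

text \<open>The second use of the completion scheme: for \<open>f\<close> square integrable with
  respect to the scalar measure of \<open>x\<close>, \<open>ext f x\<close> is the integral of
  \<open>f\<close> against \<open>E\<close>, applied to \<open>x\<close>.\<close>

sublocale sq_calculus borel_simple simple_val simple_op \<mu>
proof
  show "\<langle>simple_op l x, simple_op m x\<rangle> = complex_of_real (\<integral>t. simple_val l t * simple_val m t \<partial>\<mu> x)"
    if "l \<in> borel_simple" "m \<in> borel_simple" for l m x
    using that simple_op_inner_self[OF borel_simple_mult, of l m x]
    by (simp add: simple_val_mult simple_op_mult symmetric_mapD(2)[OF symmetric_simple_op])
qed (rule sq_int_simple)

lemma approximation:
  assumes f: "f \<in> borel_measurable borel"
  obtains s where "\<And>n::nat. s n \<in> borel_simple" "\<And>t. (\<lambda>n. simple_val (s n) t) \<longlonglongrightarrow> f t"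
    "\<And>n t. \<bar>simple_val (s n) t\<bar> \<le> 2 * \<bar>f t\<bar>" "\<And>x. sq_int (\<mu> x) f \<Longrightarrow> approximates s f x"
proof -
  obtain s where s: "\<And>n::nat. s n \<in> borel_simple" "\<And>t. (\<lambda>n. simple_val (s n) t) \<longlonglongrightarrow> f t"
    "\<And>n t. \<bar>simple_val (s n) t\<bar> \<le> 2 * \<bar>f t\<bar>"
    using simple_val_approximation[OF f] by metis
  have "approximates s f x" if "sq_int (\<mu> x) f" for x
    unfolding approximates_def
    using s by (auto intro!: sq_conv_dominated[OF that, of _ 2] borel_measurable_\<mu> simple_val_measurable)
  then show ?thesis using that s by blast
qed

lemma ext_inner_sq_int:
  assumes f: "sq_int (\<mu> x) f" and g: "sq_int (\<mu> x) g"
  shows "\<langle>ext f x, ext g x\<rangle> = complex_of_real (\<integral>t. f t * g t \<partial>\<mu> x)"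
proof -
  have "f \<in> borel_measurable borel" "g \<in> borel_measurable borel"
    using f g by (simp_all add: sq_int_def cong: measurable_cong_sets)
  then obtain s r where "approximates s f x" "approximates r g x"
    using approximation f g by metis
  then show ?thesis by (rule ext_inner)
qed

lemma norm_ext:
  assumes f: "sq_int (\<mu> x) f"
  shows "(norm (ext f x))\<^sup>2 = (\<integral>t. (f t)\<^sup>2 \<partial>\<mu> x)"
  using ext_inner_sq_int[OF f f] by (simp add: cinner_self power2_eq_square flip: of_real_mult)

lemma norm_ext_diff:
  assumes f: "sq_int (\<mu> x) f" and g: "sq_int (\<mu> x) g"
  shows "(norm (ext f x - ext g x))\<^sup>2 = (\<integral>t. (f t - g t)\<^sup>2 \<partial>\<mu> x)"
proof -
  have c: "(\<integral>t. g t * f t \<partial>\<mu> x) = (\<integral>t. f t * g t \<partial>\<mu> x)"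
    by (intro Bochner_Integration.integral_cong refl mult.commute)
  have "complex_of_real ((norm (ext f x - ext g x))\<^sup>2) = complex_of_real
      ((\<integral>t. f t * f t \<partial>\<mu> x) - (\<integral>t. f t * g t \<partial>\<mu> x)
        - ((\<integral>t. f t * g t \<partial>\<mu> x) - (\<integral>t. g t * g t \<partial>\<mu> x)))"
    unfolding cinner_self[symmetric] by (simp add: cinner_diff_left cinner_diff_right ext_inner_sq_int f g c)
  also have "\<dots> = complex_of_real (\<integral>t. f t * f t - f t * g t - (f t * g t - g t * g t) \<partial>\<mu> x)"
    by (simp add: sq_int_mult f g)
  also have "(\<lambda>t. f t * f t - f t * g t - (f t * g t - g t * g t)) = (\<lambda>t. (f t - g t)\<^sup>2)"
    by (simp add: fun_eq_iff power2_eq_square algebra_simps)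
  finally show ?thesis by (simp only: of_real_eq_iff)
qed

lemma ext_sq_conv:
  assumes "sq_conv (\<mu> x) s f"
  shows "(\<lambda>n. ext (s n) x) \<longlonglongrightarrow> ext f x"
proof -
  have "(\<lambda>n. (norm (ext (s n) x - ext f x))\<^sup>2) \<longlonglongrightarrow> 0"
    using assms by (simp add: sq_conv_def norm_ext_diff)
  from tendsto_real_sqrt[OF this] show ?thesis
    by (simp add: tendsto_norm_zero_iff LIM_zero_iff)
qed

lemma ext_simple:
  assumes "l \<in> borel_simple"
  shows "ext (simple_val l) x = simple_op l x"
proof -
  have "approximates (\<lambda>n. l) (simple_val l) x"
    using assms by (simp add: approximates_def sq_conv_const sq_int_simple)
  from ext_tendsto[OF this] show ?thesis by (simp add: LIMSEQ_const_iff)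
qed

lemma ext_indicator:
  assumes "S \<in> sets borel"
  shows "ext (indicator S) x = E S x"
  using ext_simple[of "[(1, S)]" x] assms by (simp add: simple_val.simps[abs_def])

lemma sq_int_indicator: "S \<in> sets borel \<Longrightarrow> sq_int (\<mu> x) (indicator S)"
  using sq_int_simple[of "[(1, S)]" x] by (simp add: simple_val.simps[abs_def])

lemma ext_cong_AE:
  assumes "sq_int (\<mu> x) f" "sq_int (\<mu> x) g" "AE t in \<mu> x. f t = g t"
  shows "ext f x = ext g x"
proof -
  have "(\<integral>t. (f t - g t)\<^sup>2 \<partial>\<mu> x) = 0"
    by (rule integral_eq_zero_AE) (use assms(3) in eventually_elim, simp)
  then show ?thesis using norm_ext_diff[OF assms(1,2)] by simp
qed

text \<open>The scalar measures are quadratic in the vector, not additive. The bound is therefore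
  taken on the vectors \<open>simple_op (s n) z\<close>, which depend linearly on \<open>z\<close>,
  and Fatou returns it to the integrals.\<close>

lemma sq_int_subspace:
  assumes f: "sq_int (\<mu> x) f"
  shows "sq_int (\<mu> y) f \<Longrightarrow> sq_int (\<mu> (x + y)) f" "sq_int (\<mu> (c *\<^sub>C x)) f"
proof -
  have fb: "f \<in> borel_measurable borel" using f by (simp add: sq_int_def cong: measurable_cong_sets)
  obtain s where s: "\<And>n::nat. s n \<in> borel_simple" "\<And>t. (\<lambda>n. simple_val (s n) t) \<longlonglongrightarrow> f t"
    "\<And>n t. \<bar>simple_val (s n) t\<bar> \<le> 2 * \<bar>f t\<bar>"
    using approximation[OF fb] by metis
  note lin = clinear_mapD[OF symmetric_mapD(1)[OF symmetric_simple_op[OF s(1)]]]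
  have nrm: "(\<integral>t. (simple_val (s n) t)\<^sup>2 \<partial>\<mu> z) = (norm (simple_op (s n) z))\<^sup>2" for n z
    using norm_ext[OF sq_int_simple[OF s(1)]] by (simp add: ext_simple[OF s(1)])
  have b: "norm (simple_op (s n) z) \<le> 2 * norm (ext f z)" if z: "sq_int (\<mu> z) f" for n z
  proof -
    have "(norm (simple_op (s n) z))\<^sup>2 \<le> (\<integral>t. 2\<^sup>2 * (f t)\<^sup>2 \<partial>\<mu> z)"
      unfolding nrm[symmetric]
    proof (rule integral_mono)
      show "(simple_val (s n) t)\<^sup>2 \<le> 2\<^sup>2 * (f t)\<^sup>2" for t
        using power_mono[OF s(3)[of n t], of 2] by (simp add: power_mult_distrib)
    qed (use z sq_int_simple[OF s(1)] in \<open>auto simp: sq_int_def\<close>)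
    also have "\<dots> = (2 * norm (ext f z))\<^sup>2" by (simp add: norm_ext[OF z] power_mult_distrib)
    finally show ?thesis by (rule power2_le_imp_le) simp
  qed
  show "sq_int (\<mu> (c *\<^sub>C x)) f"
  proof (rule sq_int_Fatou[OF sq_int_simple[OF s(1)] borel_measurable_\<mu>[OF fb] s(2)])
    show "(\<integral>t. (simple_val (s n) t)\<^sup>2 \<partial>\<mu> (c *\<^sub>C x)) \<le> (cmod c * (2 * norm (ext f x)))\<^sup>2" for n
      unfolding nrm lin norm_scaleC by (intro power_mono mult_left_mono b[OF f]) auto
  qed
  show "sq_int (\<mu> (x + y)) f" if y: "sq_int (\<mu> y) f"
  proof (rule sq_int_Fatou[OF sq_int_simple[OF s(1)] borel_measurable_\<mu>[OF fb] s(2)])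
    show "(\<integral>t. (simple_val (s n) t)\<^sup>2 \<partial>\<mu> (x + y)) \<le> (2 * norm (ext f x) + 2 * norm (ext f y))\<^sup>2" for n
      unfolding nrm lin by (intro power_mono norm_triangle_mono b[OF f] b[OF y]) auto
  qed
qed

lemma ext_linear:
  assumes f: "sq_int (\<mu> x) f"
  shows "sq_int (\<mu> y) f \<Longrightarrow> ext f (x + y) = ext f x + ext f y" "ext f (c *\<^sub>C x) = c *\<^sub>C ext f x"
    "sq_int (\<mu> y) f \<Longrightarrow> \<langle>ext f x, y\<rangle> = \<langle>x, ext f y\<rangle>"
proof -
  have fb: "f \<in> borel_measurable borel" using f by (simp add: sq_int_def cong: measurable_cong_sets)
  obtain s where s: "\<And>n::nat. s n \<in> borel_simple" "\<And>x. sq_int (\<mu> x) f \<Longrightarrow> approximates s f x"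
    using approximation[OF fb] by metis
  have lim: "(\<lambda>n. simple_op (s n) z) \<longlonglongrightarrow> ext f z" if "sq_int (\<mu> z) f" for z
    using ext_tendsto[OF s(2)[OF that]] .
  note sym = symmetric_simple_op[OF s(1)]
  note lin = clinear_mapD[OF symmetric_mapD(1)[OF sym]]
  show "ext f (x + y) = ext f x + ext f y" if y: "sq_int (\<mu> y) f"
    using lim[OF sq_int_subspace(1)[OF f y], unfolded lin] tendsto_add[OF lim[OF f] lim[OF y]]
    by (rule LIMSEQ_unique)
  show "ext f (c *\<^sub>C x) = c *\<^sub>C ext f x"
    using lim[OF sq_int_subspace(2)[OF f], unfolded lin] tendsto_scaleC[OF lim[OF f]]
    by (rule LIMSEQ_unique)
  show "\<langle>ext f x, y\<rangle> = \<langle>x, ext f y\<rangle>" if y: "sq_int (\<mu> y) f"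
    using tendsto_cinner[OF lim[OF f] tendsto_const, unfolded symmetric_mapD(2)[OF sym]]
      tendsto_cinner[OF tendsto_const lim[OF y]]
    by (rule LIMSEQ_unique)
qed

lemma ext_inner_self:
  assumes f: "sq_int (\<mu> x) f"
  shows "\<langle>x, ext f x\<rangle> = complex_of_real (\<integral>t. f t \<partial>\<mu> x)"
proof -
  have "ext (indicator UNIV) x = x" by (subst ext_indicator) auto
  moreover have "\<langle>ext (indicator UNIV) x, ext f x\<rangle> = complex_of_real (\<integral>t. indicator UNIV t * f t \<partial>\<mu> x)"
    by (rule ext_inner_sq_int[OF sq_int_indicator f]) simp
  ultimately show ?thesis by (simp only: indicator_UNIV mult_1_left)
qed

lemma simple_op_ext:
  assumes l: "l \<in> borel_simple" and g: "sq_int (\<mu> x) g"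
  shows "sq_int (\<mu> x) (\<lambda>t. simple_val l t * g t)"
    "simple_op l (ext g x) = ext (\<lambda>t. simple_val l t * g t) x"
proof -
  obtain C where C: "\<And>t. \<bar>simple_val l t\<bar> \<le> C" using simple_val_bounded by blast
  have gb: "g \<in> borel_measurable borel" using g by (simp add: sq_int_def cong: measurable_cong_sets)
  show 1: "sq_int (\<mu> x) (\<lambda>t. simple_val l t * g t)"
  proof (rule sq_int_bound[OF g, of _ C])
    show "(\<lambda>t. simple_val l t * g t) \<in> borel_measurable (\<mu> x)"
      by (intro borel_measurable_\<mu> borel_measurable_times simple_val_measurable l gb)
    show "AE t in \<mu> x. \<bar>simple_val l t * g t\<bar> \<le> C * \<bar>g t\<bar>"
      using mult_right_mono[OF C abs_ge_zero] by (simp add: abs_mult)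
  qed
  obtain r where r: "\<And>n::nat. r n \<in> borel_simple" "approximates r g x" 
    "\<And>t. (\<lambda>n. simple_val (r n) t) \<longlonglongrightarrow> g t" "\<And>n t. \<bar>simple_val (r n) t\<bar> \<le> 2 * \<bar>g t\<bar>"
    using approximation[OF gb] g by metis
  have "sq_conv (\<mu> x) (\<lambda>n t. simple_val l t * simple_val (r n) t) (\<lambda>t. simple_val l t * g t)"
  proof (rule sq_conv_dominated[OF 1, of _ 2])
    show "(\<lambda>t. simple_val l t * simple_val (r n) t) \<in> borel_measurable (\<mu> x)" for n
      by (intro borel_measurable_\<mu> borel_measurable_times simple_val_measurable l r)
    show "(\<lambda>n. simple_val l t * simple_val (r n) t) \<longlonglongrightarrow> simple_val l t * g t" for t
      by (intro tendsto_mult tendsto_const r)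
    show "\<bar>simple_val l t * simple_val (r n) t\<bar> \<le> 2 * \<bar>simple_val l t * g t\<bar>" for n t
      using mult_left_mono[OF r(4)[of n t] abs_ge_zero[of "simple_val l t"]] by (simp add: abs_mult)
  qed
  then have "approximates (\<lambda>n. simple_mult l (r n)) (\<lambda>t. simple_val l t * g t) x"
    using l r(1) by (simp add: approximates_def borel_simple_mult simple_val_mult[abs_def])
  from ext_tendsto[OF this]
  have a: "(\<lambda>n. simple_op l (simple_op (r n) x)) \<longlonglongrightarrow> ext (\<lambda>t. simple_val l t * g t) x"
    using l r(1) by (simp add: simple_op_mult)
  note sym = symmetric_simple_op[OF l]
  show "simple_op l (ext g x) = ext (\<lambda>t. simple_val l t * g t) x"
  \<comment> \<open>The limits are identified through inner products, where symmetry moves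
    \<open>simple_op l\<close> onto the test vector \<open>y\<close>.\<close>
  proof (rule cinner_eqI)
    fix y
    have "(\<lambda>n. \<langle>y, simple_op l (simple_op (r n) x)\<rangle>) \<longlonglongrightarrow> \<langle>simple_op l y, ext g x\<rangle>"
      unfolding symmetric_mapD(2)[OF sym, symmetric] by (intro tendsto_cinner tendsto_const ext_tendsto r)
    moreover have "(\<lambda>n. \<langle>y, simple_op l (simple_op (r n) x)\<rangle>) \<longlonglongrightarrow> \<langle>y, ext (\<lambda>t. simple_val l t * g t) x\<rangle>"
      by (intro tendsto_cinner tendsto_const a)
    ultimately show "\<langle>y, simple_op l (ext g x)\<rangle> = \<langle>y, ext (\<lambda>t. simple_val l t * g t) x\<rangle>"
      using LIMSEQ_unique symmetric_mapD(2)[OF sym] by metis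
  qed
qed

text \<open>The norms of \<open>simple_op (s n) (ext g x)\<close> are integrals of (s_n g)^2 and
  hence bounded by 4 times that of (f g)^2. Fatou puts \<open>ext g x\<close> into the domain of
  \<open>f\<close>, and dominated convergence identifies the value.\<close>

lemma ext_compose:
  assumes f: "f \<in> borel_measurable borel" and g: "sq_int (\<mu> x) g" and fg: "sq_int (\<mu> x) (\<lambda>t. f t * g t)"
  shows "sq_int (\<mu> (ext g x)) f" "ext f (ext g x) = ext (\<lambda>t. f t * g t) x"
proof -
  obtain s where s: "\<And>n::nat. s n \<in> borel_simple" "\<And>t. (\<lambda>n. simple_val (s n) t) \<longlonglongrightarrow> f t"
    "\<And>n t. \<bar>simple_val (s n) t\<bar> \<le> 2 * \<bar>f t\<bar>" "\<And>x. sq_int (\<mu> x) f \<Longrightarrow> approximates s f x"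
    using approximation[OF f] by metis
  have gb: "g \<in> borel_measurable borel" using g by (simp add: sq_int_def cong: measurable_cong_sets)
  have conv: "sq_conv (\<mu> x) (\<lambda>n t. simple_val (s n) t * g t) (\<lambda>t. f t * g t)"
  proof (rule sq_conv_dominated[OF fg, of _ 2])
    show "(\<lambda>t. simple_val (s n) t * g t) \<in> borel_measurable (\<mu> x)" for n
      by (intro borel_measurable_\<mu> borel_measurable_times simple_val_measurable gb s)
    show "(\<lambda>n. simple_val (s n) t * g t) \<longlonglongrightarrow> f t * g t" for t
      by (intro tendsto_mult tendsto_const s)
    show "\<bar>simple_val (s n) t * g t\<bar> \<le> 2 * \<bar>f t * g t\<bar>" for n t
      using mult_right_mono[OF s(3)[of n t] abs_ge_zero[of "g t"]] by (simp add: abs_mult)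
  qed
  show 1: "sq_int (\<mu> (ext g x)) f"
  proof (rule sq_int_Fatou[OF sq_int_simple[OF s(1)] borel_measurable_\<mu>[OF f] s(2)])
    fix n
    have "(\<integral>t. (simple_val (s n) t)\<^sup>2 \<partial>\<mu> (ext g x)) = (norm (simple_op (s n) (ext g x)))\<^sup>2"
      using norm_ext[OF sq_int_simple[OF s(1)]] by (simp add: ext_simple[OF s(1)])
    also have "\<dots> = (\<integral>t. (simple_val (s n) t * g t)\<^sup>2 \<partial>\<mu> x)"
      by (simp only: simple_op_ext[OF s(1) g] norm_ext)
    also have "\<dots> \<le> (\<integral>t. 4 * (f t * g t)\<^sup>2 \<partial>\<mu> x)"
    proof (rule integral_mono)
      show "(simple_val (s n) t * g t)\<^sup>2 \<le> 4 * (f t * g t)\<^sup>2" for t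
        using mult_right_mono[OF power_mono[OF s(3)[of n t], of 2], of "(g t)\<^sup>2"] by (simp add: power_mult_distrib)
    qed (use simple_op_ext(1)[OF s(1) g] fg in \<open>auto simp: sq_int_def\<close>)
    finally show "(\<integral>t. (simple_val (s n) t)\<^sup>2 \<partial>\<mu> (ext g x)) \<le> (\<integral>t. 4 * (f t * g t)\<^sup>2 \<partial>\<mu> x)" .
  qed
  have "(\<lambda>n. simple_op (s n) (ext g x)) \<longlonglongrightarrow> ext f (ext g x)"
    by (rule ext_tendsto[OF s(4)[OF 1]])
  moreover have "(\<lambda>n. simple_op (s n) (ext g x)) \<longlonglongrightarrow> ext (\<lambda>t. f t * g t) x"
    unfolding simple_op_ext(2)[OF s(1) g] by (rule ext_sq_conv[OF conv])
  ultimately show "ext f (ext g x) = ext (\<lambda>t. f t * g t) x" by (rule LIMSEQ_unique)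
qed

text \<open>On \<open>S n\<close> the function is bounded by \<open>n\<close>, so cut-off vectors
  lie in the domain. Dominated convergence yields approximation in the graph norm, not merely in the
  norm.\<close>

lemma cutoff:
  assumes f: "f \<in> borel_measurable borel"
  defines "S \<equiv> \<lambda>n::nat. {t. \<bar>f t\<bar> \<le> real n}"
  shows "S n \<in> sets borel" "sq_int (\<mu> (E (S n) x)) f" "(\<lambda>n. E (S n) x) \<longlonglongrightarrow> x"
    "sq_int (\<mu> x) f \<Longrightarrow> (\<lambda>n. ext f (E (S n) x)) \<longlonglongrightarrow> ext f x"
proof -
  note [measurable] = f
  show S: "S n \<in> sets borel" for n unfolding S_def by measurable
  have i: "sq_int (\<mu> x) (\<lambda>t. f t * indicator (S n) t)" for n x
    using f S by (intro sq_int_bounded[OF finite_\<mu>, of _ _ "real n"]) (auto simp: S_def indicator_def intro!: borel_measurable_\<mu>)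
  have c: "sq_int (\<mu> (E (S n) x)) f" "ext f (E (S n) x) = ext (\<lambda>t. f t * indicator (S n) t) x" for n x
    using ext_compose[OF f sq_int_indicator[OF S] i] by (simp_all add: ext_indicator[OF S])
  show "sq_int (\<mu> (E (S n) x)) f" by (rule c)
  have lim: "(\<lambda>n. indicator (S n) t) \<longlonglongrightarrow> (1::real)" for t
  proof (rule tendsto_eventually)
    have "\<forall>\<^sub>F n in sequentially. nat \<lceil>\<bar>f t\<bar>\<rceil> \<le> n" by (rule eventually_ge_at_top)
    then show "\<forall>\<^sub>F n in sequentially. indicator (S n) t = (1::real)"
      by eventually_elim (simp add: S_def nat_ceiling_le_eq)
  qed
  have "sq_conv (\<mu> x) (\<lambda>n. indicator (S n)) (indicator UNIV)"
    using lim S by (intro sq_conv_dominated[OF sq_int_indicator, where c = 1] borel_measurable_\<mu>) (auto simp: indicator_def)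
  moreover have "ext (indicator UNIV) x = x" by (subst ext_indicator) auto
  ultimately show "(\<lambda>n. E (S n) x) \<longlonglongrightarrow> x"
    using ext_sq_conv[of x "\<lambda>n. indicator (S n)" "indicator UNIV"] by (simp only: ext_indicator[OF S])
  show "(\<lambda>n. ext f (E (S n) x)) \<longlonglongrightarrow> ext f x" if fx: "sq_int (\<mu> x) f"
  proof -
    have "sq_conv (\<mu> x) (\<lambda>n t. f t * indicator (S n) t) (\<lambda>t. f t)"
    proof (rule sq_conv_dominated[OF fx, of _ 1])
      show "(\<lambda>n. f t * indicator (S n) t) \<longlonglongrightarrow> f t" for t
        using tendsto_mult_left[OF lim[of t], of "f t"] by simp
    qed (use f S in \<open>auto intro!: borel_measurable_\<mu> simp: indicator_def\<close>)
    from ext_sq_conv[OF this] show ?thesis by (simp add: c)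
  qed
qed

lemma dense_domain:
  assumes f: "f \<in> borel_measurable borel"
  shows "closure {x. sq_int (\<mu> x) f} = UNIV"
proof -
  have "x \<in> closure {x. sq_int (\<mu> x) f}" for x
    unfolding closure_sequential using cutoff(2,3)[OF f]
    by (intro exI[of _ "\<lambda>n. E {t. \<bar>f t\<bar> \<le> real n} x"]) auto
  then show ?thesis by auto
qed

text \<open>The bridge to the given definition: polarization collapses its four scalar integrals to
  <x, ext f y>, and density of the domain leaves only one possible value.\<close>

lemma spectral_integral_ext:
  assumes f: "f \<in> borel_measurable borel"
  shows "spectral_integral E (\<lambda>t. complex_of_real (f t)) = {(y, ext f y) | y. sq_int (\<mu> y) f}"
proof -
  have dom: "spectral_integral_domain E (\<lambda>t. complex_of_real (f t)) = {x. sq_int (\<mu> x) f}"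
    using borel_measurable_\<mu>[OF f] by (auto simp: spectral_integral_domain_def sq_int_def)
  have ses: "sesquilinear_integral E (\<lambda>t. complex_of_real (f t)) x y = \<langle>x, ext f y\<rangle>"
    if "sq_int (\<mu> x) f" "sq_int (\<mu> y) f" for x y
  proof -
    have "sq_int (\<mu> (y + (\<i> ^ k) *\<^sub>C x)) f" for k
      using that sq_int_subspace by blast
    then have "sesquilinear_integral E (\<lambda>t. complex_of_real (f t)) x y =
        (\<Sum>k<4::nat. \<i> ^ k * \<langle>y + (\<i> ^ k) *\<^sub>C x, ext f (y + (\<i> ^ k) *\<^sub>C x)\<rangle>) / 4"
      unfolding sesquilinear_integral_def by (simp add: ext_inner_self)
    also have "\<dots> = \<langle>x, ext f y\<rangle>"
      by (rule polarization) (simp add: that ext_linear sq_int_subspace)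
    finally show ?thesis .
  qed
  show ?thesis
    unfolding spectral_integral_def dom
    using ses cinner_eqI_dense[OF dense_domain[OF f]] by fastforce
qed

end

section \<open>Bounded maps\<close>

definition bounded_map :: "('a::real_normed_vector \<Rightarrow> 'a) \<Rightarrow> bool" where
  "bounded_map K \<longleftrightarrow> (\<exists>C. \<forall>x. norm (K x) \<le> C * norm x)"

lemma bounded_map_obtain:
  assumes "bounded_map K"
  obtains C where "0 < C" "\<And>x. norm (K x) \<le> C * norm x"
proof -
  obtain c where c: "\<And>x. norm (K x) \<le> c * norm x" using assms by (auto simp: bounded_map_def)
  have "norm (K x) \<le> max c 1 * norm x" for x
    by (rule order_trans[OF c]) (intro mult_right_mono, auto)
  then show ?thesis using that[of "max c 1"] by simp
qed

lemma bounded_map_tendsto: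
  assumes "clinear_map K" "bounded_map K" "(f \<longlongrightarrow> x) F"
  shows "((\<lambda>n. K (f n)) \<longlongrightarrow> K x) F"
proof -
  obtain C where C: "\<And>x. norm (K x) \<le> C * norm x" using bounded_map_obtain[OF assms(2)] by metis
  have "((\<lambda>n. C * norm (f n - x)) \<longlongrightarrow> 0) F"
    by (intro tendsto_mult_right_zero tendsto_norm_zero LIM_zero assms)
  then have "((\<lambda>n. K (f n) - K x) \<longlongrightarrow> 0) F"
    by (rule Lim_null_comparison[rotated]) (simp add: C flip: clinear_mapD(6)[OF assms(1)])
  then show ?thesis by (rule LIM_zero_cancel)
qed

lemma bounded_map_comp:
  assumes "bounded_map K" "bounded_map L"
  shows "bounded_map (\<lambda>x. K (L x))"
proof -
  obtain C where C: "0 < C" "\<And>x. norm (K x) \<le> C * norm x" using bounded_map_obtain[OF assms(1)] by metis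
  obtain D where D: "0 < D" "\<And>x. norm (L x) \<le> D * norm x" using bounded_map_obtain[OF assms(2)] by metis
  have "norm (K (L x)) \<le> (C * D) * norm x" for x
    using order_trans[OF C(2) mult_left_mono[OF D(2)]] C(1) by (simp add: mult.assoc)
  then show ?thesis by (auto simp: bounded_map_def)
qed

text \<open>The sets where \<open>\<parallel>K x\<parallel> \<le> n\<close> are closed because \<open>K\<close> has a formal adjoint on a dense set, so by
  Baire's theorem one of them contains a ball.\<close>

lemma bounded_map_formal_adjoint:
  fixes K :: "'a::complex_hilbert_space \<Rightarrow> 'a"
  assumes lin: "clinear_map K" and D: "closure D = UNIV"
    and adj: "\<And>u v. v \<in> D \<Longrightarrow> \<langle>K u, v\<rangle> = \<langle>u, K' v\<rangle>"
  shows "bounded_map K"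
proof -
  define C where "C n = {u. norm (K u) \<le> real n}" for n
  have closed: "closed (C n)" for n
    unfolding closed_sequential_limits
  proof (intro allI impI, elim conjE)
    fix u l assume u: "\<forall>j. u j \<in> C n" and l: "u \<longlonglongrightarrow> l"
    have le: "cmod \<langle>K l, v\<rangle> \<le> real n * norm v" if v: "v \<in> D" for v
    proof (rule LIMSEQ_le_const2)
      show "(\<lambda>j. cmod \<langle>K (u j), v\<rangle>) \<longlonglongrightarrow> cmod \<langle>K l, v\<rangle>"
        unfolding adj[OF v] by (intro tendsto_norm tendsto_cinner l tendsto_const)
      have "cmod \<langle>K (u j), v\<rangle> \<le> real n * norm v" for j
        using u by (intro order_trans[OF norm_cinner_le] mult_right_mono) (auto simp: C_def)
      then show "\<exists>N. \<forall>j\<ge>N. cmod \<langle>K (u j), v\<rangle> \<le> real n * norm v" by blast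
    qed
    \<comment> \<open>Test vectors tending to \<open>K l\<close> convert the bound on inner products
      into a bound on the norm of \<open>K l\<close>.\<close>
    obtain v where v: "\<And>j. v j \<in> D" "v \<longlonglongrightarrow> K l"
      using D closure_sequential[of "K l" D] by auto
    have "cmod \<langle>K l, K l\<rangle> \<le> real n * norm (K l)"
      by (rule LIMSEQ_le[OF tendsto_norm[OF tendsto_cinner[OF tendsto_const v(2)]]
            tendsto_mult_left[OF tendsto_norm[OF v(2)]]]) (use le v(1) in blast)
    then have "norm (K l) * norm (K l) \<le> real n * norm (K l)"
      by (simp add: cinner_self norm_power power2_eq_square norm_mult)
    then show "l \<in> C n"
      by (cases "K l = 0") (auto simp: C_def)
  qed
  have "\<exists>n. interior (C n) \<noteq> {}"
  proof (rule ccontr)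
    assume "\<not> ?thesis"
    then have "euclidean interior_of \<Union>(range C) = {}"
      using closed by (intro Baire_category_alt disjI1 completely_metrizable_space_euclidean)
        (auto simp: interior_of_def interior_def)
    moreover have "\<Union>(range C) = UNIV"
      using real_arch_simple by (auto simp: C_def)
    ultimately show False by simp
  qed
  then obtain n u0 r where r: "0 < r" "ball u0 r \<subseteq> C n"
    by (auto simp: mem_interior)
  \<comment> \<open>A small vector is the difference of two points of the ball, so its image has
    norm at most n + n.\<close>
  have small: "norm (K w) \<le> 2 * real n" if "norm w < r" for w
  proof -
    have "u0 \<in> C n" "u0 + w \<in> C n" using r that by (auto simp: dist_norm subset_eq)
    then have "norm (K (u0 + w)) \<le> real n" "norm (K u0) \<le> real n" by (auto simp: C_def)
    then show ?thesis
      using norm_triangle_ineq4[of "K (u0 + w)" "K u0"] by (simp add: clinear_mapD[OF lin])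
  qed
  have "norm (K w) \<le> (4 * real n / r) * norm w" for w
  proof (cases "w = 0")
    case False
    \<comment> \<open>This scaling gives the vector norm r/2, inside the ball; dividing 2n by
      \<open>c\<close> produces the constant 4n/r.\<close>
    define c where "c = r / (2 * norm w)"
    have c: "0 < c" using False r by (simp add: c_def)
    have "norm (c *\<^sub>R w) < r" using False r by (simp add: c_def)
    from small[OF this] have "c * norm (K w) \<le> 2 * real n"
      using c by (simp add: clinear_mapD[OF lin])
    then show ?thesis using False r by (simp add: c_def field_simps)
  qed (simp add: clinear_mapD[OF lin])
  then show ?thesis unfolding bounded_map_def by blast
qed

section \<open>The spectral theorem for operators with bounded inverse\<close>

text \<open>R = (T + M)/(2M) lies between 0 and 1, so T = 2MR - M, and the inverse of
  \<open>T\<close> is a function of \<open>R\<close>. Its spectral measure is the image of that of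
  \<open>R\<close>.\<close>

lemma spectral_theorem_inverse:
  fixes T :: "'a::complex_hilbert_space \<Rightarrow> 'a"
  assumes T: "symmetric_map T" "bounded_map T" and inj: "\<And>x. T x = 0 \<Longrightarrow> x = 0"
  shows "\<exists>E. projection_valued_measure E \<and> spectral_integral E complex_of_real = {(T u, u) | u. True}"
proof -
  note linT = clinear_mapD[OF symmetric_mapD(1)[OF T(1)]]
  obtain M where M: "0 < M" "\<And>x. norm (T x) \<le> M * norm x" using bounded_map_obtain[OF T(2)] by metis
  define R where "R x = (1 / (2 * M)) *\<^sub>R (T x + M *\<^sub>R x)" for x
  have Rx: "Re \<langle>x, R x\<rangle> = (Re \<langle>x, T x\<rangle> + M * (norm x)\<^sup>2) / (2 * M)" for x
    by (simp add: R_def cinner_scaleR_right cinner_add_right cinner_self)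
  have bT: "\<bar>Re \<langle>x, T x\<rangle>\<bar> \<le> M * (norm x)\<^sup>2" for x
  proof -
    have "\<bar>Re \<langle>x, T x\<rangle>\<bar> \<le> norm x * norm (T x)"
      using abs_Re_le_cmod norm_cinner_le order_trans by blast
    also have "\<dots> \<le> norm x * (M * norm x)" by (intro mult_left_mono M) simp
    finally show ?thesis by (simp add: power2_eq_square mult_ac)
  qed
  have "positive_contraction R"
    unfolding positive_contraction_def symmetric_map_def clinear_map_def
  proof (intro conjI allI)
    fix x y c
    show "R (x + y) = R x + R y" "R (c *\<^sub>C x) = c *\<^sub>C R x"
      by (simp_all add: R_def linT scaleR_right_distrib scaleC_add_right scaleC_scaleR_commute algebra_simps)
    show "\<langle>R x, y\<rangle> = \<langle>x, R y\<rangle>"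
      by (simp add: R_def cinner_scaleR_right cinner_scaleR_left cinner_add_right cinner_add_left symmetric_mapD(2)[OF T(1)])
    show "0 \<le> Re \<langle>x, R x\<rangle>" "Re \<langle>x, R x\<rangle> \<le> (norm x)\<^sup>2"
      using bT[of x] M(1) by (simp_all add: Rx field_simps abs_le_iff)
  qed
  then obtain F where F: "projection_valued_measure F" "\<And>x. unit_measure (scalar_measure F x)"
    "\<And>x. (\<integral>t. t \<partial>scalar_measure F x) = Re \<langle>x, R x\<rangle>"
    using contraction_spectral_measure by metis
  interpret F: pvm F by unfold_locales (rule F)
  \<comment> \<open>The point t = 1/2 corresponds to the value 0 of \<open>T\<close>; the convention
    \<open>inverse 0 = 0\<close> sends it to 0, a point that \<open>E0\<close> below shows to carry
    no mass.\<close>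
  define \<phi> where "\<phi> t = inverse (2 * M * t - M)" for t :: real
  have \<phi> [measurable]: "\<phi> \<in> borel_measurable borel" unfolding \<phi>_def by measurable
  have vim: "\<phi> -` S \<in> sets borel" if "S \<in> sets borel" for S
    using measurable_sets_borel[OF \<phi> that] .
  define E where "E S = F (\<phi> -` S)" for S
  have E: "projection_valued_measure E"
    unfolding projection_valued_measure_def
  proof (intro conjI ballI allI impI)
    fix G :: "nat \<Rightarrow> real set" and x assume G: "range G \<subseteq> sets borel" "disjoint_family G"
    have "(\<lambda>n. F (\<phi> -` G n) x) sums F (\<Union>n. \<phi> -` G n) x"
      using F(1) G vim unfolding projection_valued_measure_def disjoint_family_on_def
      by (elim conjE allE[of _ "\<lambda>n. \<phi> -` G n"] allE[of _ x]) blast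
    then show "(\<lambda>n. E (G n) x) sums E (\<Union>n. G n) x" by (simp add: E_def vimage_UN)
  qed (use F(1) vim in \<open>auto simp: E_def projection_valued_measure_def\<close>)
  interpret E: pvm E by unfold_locales (rule E)
  have distr: "E.\<mu> x = distr (F.\<mu> x) borel \<phi>" for x
  proof (rule measure_eqI)
    fix S assume "S \<in> sets (E.\<mu> x)"
    then show "emeasure (E.\<mu> x) S = emeasure (distr (F.\<mu> x) borel \<phi>) S"
      using vim by (simp add: E.emeasure_\<mu> emeasure_distr F.emeasure_\<mu> E_def cong: measurable_cong_sets)
  qed simp
  have \<phi>F: "\<phi> \<in> measurable (F.\<mu> x) borel" for x by (rule F.borel_measurable_\<mu>[OF \<phi>])
  have unit: "AE t in F.\<mu> x. 0 \<le> t \<and> t \<le> 1" for x using F(2) by (simp add: unit_measure_def)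
  have inv_sq: "sq_int (E.\<mu> x) inverse" for x
  proof (rule sq_int_bounded[OF E.finite_\<mu>, of _ _ M])
    show "inverse \<in> borel_measurable (E.\<mu> x)" by (rule E.borel_measurable_\<mu>) measurable
    show "AE t in E.\<mu> x. \<bar>inverse t\<bar> \<le> M"
      unfolding distr
    proof (subst AE_distr_iff[OF \<phi>F])
      show "AE t in F.\<mu> x. \<bar>inverse (\<phi> t)\<bar> \<le> M"
        using unit[of x]
      proof eventually_elim
        case (elim t)
        then have "0 \<le> M * t" "M * t \<le> M" using M(1) by (auto simp: mult_le_cancel_left1)
        then show ?case by (simp add: \<phi>_def)
      qed
    qed simp
  qed
  \<comment> \<open>Both sides have the same quadratic form: after the change of variable the
    integrand is 2Mt - M, whose integral is given by the first moment.\<close>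
  have ext_inv: "E.ext inverse = T"
  proof (rule clinear_map_eqI[OF _ symmetric_mapD(1)[OF T(1)]])
    show "clinear_map (E.ext inverse)"
      unfolding clinear_map_def using E.ext_linear[OF inv_sq] inv_sq by blast
    fix x
    have int: "integrable (F.\<mu> x) (\<lambda>t. t)"
      using unit[of x]
      by (intro finite_measure.integrable_const_bound[OF F.finite_\<mu>, where B = 1] F.borel_measurable_\<mu>) auto
    have "(\<integral>t. inverse t \<partial>E.\<mu> x) = (\<integral>t. inverse (\<phi> t) \<partial>F.\<mu> x)"
      unfolding distr by (rule integral_distr[OF \<phi>F]) measurable
    also have "\<dots> = (\<integral>t. 2 * M * t - M \<partial>F.\<mu> x)" by (simp add: \<phi>_def)
    also have "\<dots> = 2 * M * Re \<langle>x, R x\<rangle> - M * (norm x)\<^sup>2"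
      using int finite_measure.integrable_const[OF F.finite_\<mu>, of x M] by (simp add: F(3) F.measure_\<mu>)
    also have "\<dots> = Re \<langle>x, T x\<rangle>" using M(1) by (simp add: Rx field_simps)
    finally show "\<langle>x, E.ext inverse x\<rangle> = \<langle>x, T x\<rangle>"
      using E.ext_inner_self[OF inv_sq] symmetric_mapD(3)[OF T(1)] by metis
  qed
  \<comment> \<open>Since \<open>inverse 0 = 0\<close>, integrating the inverse over {0} gives 0, so
    \<open>T\<close> annihilates the range of \<open>E {0}\<close> and injectivity applies.\<close>
  have E0: "E {0} x = 0" for x
  proof (rule inj)
    have "sq_int (E.\<mu> x) (\<lambda>t. inverse t * indicator {0} t)"
      by (rule sq_int_bounded[OF E.finite_\<mu>, of _ _ 0]) (auto intro!: E.borel_measurable_\<mu> simp: indicator_def)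
    from E.ext_compose(2)[OF _ E.sq_int_indicator this]
    have "T (E {0} x) = E.ext (\<lambda>t. inverse t * indicator {0} t) x"
      by (simp add: E.ext_indicator ext_inv)
    also have "(\<lambda>t. inverse t * indicator {0} t) = (\<lambda>t::real. 0)" by (auto simp: indicator_def)
    also have "E.ext (\<lambda>t. 0) x = 0" using E.ext_simple[of "[]"] by (simp add: simple_val.simps(1)[abs_def])
    finally show "T (E {0} x) = 0" .
  qed
  have ae: "AE t in E.\<mu> x. t \<noteq> 0" for x
    by (rule AE_I[of _ _ "{0}"]) (auto simp: E.emeasure_\<mu> E0)
  have one: "sq_int (E.\<mu> x) (\<lambda>t. t * inverse t)" "E.ext (\<lambda>t. t * inverse t) x = x"
    "sq_int (E.\<mu> x) (\<lambda>t. inverse t * t)" "E.ext (\<lambda>t. inverse t * t) x = x" for x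
  proof -
    show 1: "sq_int (E.\<mu> x) (\<lambda>t. t * inverse t)"
      by (rule sq_int_bounded[OF E.finite_\<mu>, of _ _ 1])
         (auto intro!: E.borel_measurable_\<mu>, auto simp: field_simps)
    have "E.ext (\<lambda>t. t * inverse t) x = E.ext (indicator UNIV) x"
      by (rule E.ext_cong_AE[OF 1 E.sq_int_indicator]) (use ae[of x] in \<open>auto elim!: eventually_mono\<close>)
    then show 2: "E.ext (\<lambda>t. t * inverse t) x = x" by (subst (asm) E.ext_indicator) auto
    show "sq_int (E.\<mu> x) (\<lambda>t. inverse t * t)" "E.ext (\<lambda>t. inverse t * t) x = x"
      using 1 2 by (simp_all add: mult.commute)
  qed
  have id: "(\<lambda>t. t) \<in> borel_measurable (borel :: real measure)" by simp
  have "{(y, E.ext (\<lambda>t. t) y) | y. sq_int (E.\<mu> y) (\<lambda>t. t)} = {(T u, u) | u. True}"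
  proof (intro equalityI subsetI)
    fix p assume "p \<in> {(y, E.ext (\<lambda>t. t) y) | y. sq_int (E.\<mu> y) (\<lambda>t. t)}"
    then obtain y where p: "p = (y, E.ext (\<lambda>t. t) y)" and y: "sq_int (E.\<mu> y) (\<lambda>t. t)" by auto
    have "T (E.ext (\<lambda>t. t) y) = y"
      using E.ext_compose(2)[OF _ y one(3)] by (simp add: ext_inv one)
    then show "p \<in> {(T u, u) | u. True}" using p by force
  next
    fix p assume "p \<in> {(T u, u) | u. True}"
    then obtain u where p: "p = (T u, u)" by auto
    from E.ext_compose[OF id inv_sq one(1), of u]
    have "sq_int (E.\<mu> (T u)) (\<lambda>t. t)" "E.ext (\<lambda>t. t) (T u) = u" by (simp_all add: ext_inv one)
    then show "p \<in> {(y, E.ext (\<lambda>t. t) y) | y. sq_int (E.\<mu> y) (\<lambda>t. t)}" using p by force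
  qed
  then show ?thesis
    using E E.spectral_integral_ext[OF id] by (intro exI[of _ E]) simp
qed

lemma op_app_eq: "single_valued T \<Longrightarrow> (x, y) \<in> T \<Longrightarrow> T \<cdot> x = y"
  unfolding op_app_def by (blast dest: single_valuedD)

lemma op_app_graph: "P x \<Longrightarrow> {(y, f y) | y. P y} \<cdot> x = f x"
  by (rule op_app_eq) (auto simp: single_valued_def)

text \<open>\<open>V\<close> is the integral of 1/f, which is bounded by 1/d almost everywhere. The
  composition rule, used in both orders, makes it a two-sided inverse.\<close>

lemma (in pvm) ext_bounded_inverse:
  assumes f: "f \<in> borel_measurable borel" and d: "0 < d" and away: "\<And>x. AE t in \<mu> x. d \<le> \<bar>f t\<bar>"
  obtains V where "symmetric_map V" "bounded_map V"
    "\<And>u. sq_int (\<mu> (V u)) f" "\<And>u. ext f (V u) = u" "\<And>x. sq_int (\<mu> x) f \<Longrightarrow> V (ext f x) = x"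
proof -
  note [measurable] = f
  have g: "(\<lambda>t. inverse (f t)) \<in> borel_measurable borel" by measurable
  have bd: "AE t in \<mu> x. \<bar>inverse (f t)\<bar> \<le> 1 / d" for x
    using away[of x] by eventually_elim (use d in \<open>auto simp: field_simps\<close>)
  have gi: "sq_int (\<mu> x) (\<lambda>t. inverse (f t))" for x
    by (rule sq_int_bounded[OF finite_\<mu> borel_measurable_\<mu>[OF g] bd])
  have one: "sq_int (\<mu> x) (\<lambda>t. f t * inverse (f t))" "ext (\<lambda>t. f t * inverse (f t)) x = x"
    "sq_int (\<mu> x) (\<lambda>t. inverse (f t) * f t)" "ext (\<lambda>t. inverse (f t) * f t) x = x" for x
  proof -
    show 1: "sq_int (\<mu> x) (\<lambda>t. f t * inverse (f t))"
      by (rule sq_int_bounded[OF finite_\<mu>, of _ _ 1])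
         (auto intro!: borel_measurable_\<mu>, auto simp: field_simps)
    have "ext (\<lambda>t. f t * inverse (f t)) x = ext (indicator UNIV) x"
      by (rule ext_cong_AE[OF 1 sq_int_indicator]) (use away[of x] d in \<open>auto elim!: eventually_mono\<close>)
    then show 2: "ext (\<lambda>t. f t * inverse (f t)) x = x" by (subst (asm) ext_indicator) auto
    show "sq_int (\<mu> x) (\<lambda>t. inverse (f t) * f t)" "ext (\<lambda>t. inverse (f t) * f t) x = x"
      using 1 2 by (simp_all add: mult.commute)
  qed
  let ?V = "ext (\<lambda>t. inverse (f t))"
  show ?thesis
  proof (rule that)
    show "symmetric_map ?V"
      unfolding symmetric_map_def clinear_map_def using ext_linear[OF gi] gi by blast
    have "norm (?V x) \<le> (1 / d) * norm x" for x
    proof -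
      have "(norm (?V x))\<^sup>2 \<le> (\<integral>t. (1 / d)\<^sup>2 \<partial>\<mu> x)"
        unfolding norm_ext[OF gi]
      proof (rule integral_mono_AE)
        show "AE t in \<mu> x. (inverse (f t))\<^sup>2 \<le> (1 / d)\<^sup>2"
          using bd[of x] by eventually_elim (metis abs_ge_zero power2_abs power_mono)
      qed (use gi finite_measure.integrable_const[OF finite_\<mu>] in \<open>auto simp: sq_int_def\<close>)
      also have "\<dots> = ((1 / d) * norm x)\<^sup>2"
        by (simp add: measure_\<mu> power_mult_distrib power_divide)
      finally show ?thesis by (rule power2_le_imp_le) (use d in simp)
    qed
    then show "bounded_map ?V" unfolding bounded_map_def by blast
    show "sq_int (\<mu> (?V u)) f" "ext f (?V u) = u" for u
      using ext_compose[OF f gi one(1)] by (simp_all add: one)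
    show "?V (ext f x) = x" if "sq_int (\<mu> x) f" for x
      using ext_compose(2)[OF g that one(3)] by (simp add: one)
  qed
qed

text \<open>The partial operator \<open>X\<close> is represented by its everywhere defined inverse
  \<open>T\<close>, so its domain is simply the range of \<open>T\<close>.\<close>

locale bounded_inverse_operator =
  fixes T :: "'a::complex_hilbert_space \<Rightarrow> 'a" and X :: "'a operator"
  assumes symmetric_T: "symmetric_map T" and bounded_T: "bounded_map T"
    and inj_T: "T x = 0 \<Longrightarrow> x = 0" and X_eq: "X = {(T u, u) | u. True}"
begin

lemma spectral_measure_spec:
  "projection_valued_measure (spectral_measure X)" "spectral_integral (spectral_measure X) complex_of_real = X"
  using someI_ex[OF spectral_theorem_inverse[OF symmetric_T bounded_T inj_T]]
  unfolding spectral_measure_def X_eq by auto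

sublocale pvm "spectral_measure X"
  by unfold_locales (rule spectral_measure_spec)

lemma ext_id:
  "sq_int (\<mu> (T u)) (\<lambda>t. t)" "ext (\<lambda>t. t) (T u) = u" "sq_int (\<mu> y) (\<lambda>t. t) \<Longrightarrow> T (ext (\<lambda>t. t) y) = y"
proof -
  have eq: "{(y, ext (\<lambda>t. t) y) | y. sq_int (\<mu> y) (\<lambda>t. t)} = {(T u, u) | u. True}"
    using spectral_integral_ext[of "\<lambda>t. t"] spectral_measure_spec(2) X_eq by simp
  from eq have "(T u, u) \<in> {(y, ext (\<lambda>t. t) y) | y. sq_int (\<mu> y) (\<lambda>t. t)}" by blast
  then show "sq_int (\<mu> (T u)) (\<lambda>t. t)" "ext (\<lambda>t. t) (T u) = u" by auto
  show "T (ext (\<lambda>t. t) y) = y" if "sq_int (\<mu> y) (\<lambda>t. t)"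
  proof -
    have "(y, ext (\<lambda>t. t) y) \<in> {(T u, u) | u. True}" unfolding eq[symmetric] using that by blast
    then show ?thesis by auto
  qed
qed

text \<open>For \<open>y\<close> in the spectral subspace of |t| < c, applying \<open>X\<close>
  gives norm at most c times that of \<open>y\<close>, while \<open>T\<close> recovers
  \<open>y\<close> with factor \<open>M\<close>. With c = 1/(2M) the norm of \<open>y\<close> is at
  most half of itself.\<close>

lemma spectral_gap: "\<exists>c>0. \<forall>x. AE t in \<mu> x. c \<le> \<bar>t\<bar>"
proof -
  obtain M where M: "0 < M" "\<And>x. norm (T x) \<le> M * norm x" using bounded_map_obtain[OF bounded_T] by metis
  define c where "c = 1 / (2 * M)"
  define S where "S = {t::real. \<bar>t\<bar> < c}"
  have S: "S \<in> sets borel" unfolding S_def by measurable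
  have "spectral_measure X S x = 0" for x
  proof -
    let ?y = "spectral_measure X S x"
    have i: "sq_int (\<mu> x) (\<lambda>t. t * indicator S t)"
      using S by (intro sq_int_bounded[OF finite_\<mu>, of _ _ c] borel_measurable_\<mu>)
        (auto simp: S_def indicator_def c_def M(1) less_imp_le)
    have y: "sq_int (\<mu> ?y) (\<lambda>t. t)" "ext (\<lambda>t. t) ?y = ext (\<lambda>t. t * indicator S t) x"
      using ext_compose[OF _ sq_int_indicator[OF S] i] by (simp_all add: ext_indicator S)
    have "(norm (ext (\<lambda>t. t) ?y))\<^sup>2 \<le> (\<integral>t. c\<^sup>2 * indicator S t \<partial>\<mu> x)"
      unfolding y(2) norm_ext[OF i]
    proof (rule integral_mono)
      show "(t * indicator S t)\<^sup>2 \<le> c\<^sup>2 * indicator S t" for t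
        using power_mono[of "\<bar>t\<bar>" c 2] by (auto simp: S_def indicator_def)
      show "integrable (\<mu> x) (\<lambda>t. c\<^sup>2 * indicator S t)"
        using S by (intro integrable_mult_right finite_measure.integrable_const_bound[OF finite_\<mu>, where B = 1] borel_measurable_\<mu>) auto
    qed (use i in \<open>auto simp: sq_int_def\<close>)
    also have "\<dots> = (c * norm ?y)\<^sup>2" using S by (simp add: measure_\<mu> power_mult_distrib)
    finally have *: "norm (ext (\<lambda>t. t) ?y) \<le> c * norm ?y"
      by (rule power2_le_imp_le) (use M in \<open>simp add: c_def\<close>)
    have "norm ?y \<le> M * norm (ext (\<lambda>t. t) ?y)" using M(2)[of "ext (\<lambda>t. t) ?y"] ext_id(3)[OF y(1)] by simp
    also have "\<dots> \<le> M * (c * norm ?y)" using * M(1) by (intro mult_left_mono) auto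
    also have "\<dots> = norm ?y / 2" using M(1) by (simp add: c_def)
    finally show ?thesis by simp
  qed
  then have "AE t in \<mu> x. c \<le> \<bar>t\<bar>" for x
    by (intro AE_I[of _ _ S]) (auto simp: S emeasure_\<mu>, auto simp: S_def)
  moreover have "0 < c" using M by (simp add: c_def)
  ultimately show ?thesis by blast
qed

text \<open>Phrased through the modulus of \<open>f\<close> so as to cover both \<open>sqrt\<close>,
  used for \<open>A\<close>, and t -> sqrt |t|, used for \<open>B\<close>.\<close>

lemma sqrt_bounded_inverse:
  assumes f: "f \<in> borel_measurable borel" and abs: "\<And>t. \<bar>f t\<bar> = sqrt \<bar>t\<bar>"
  obtains V where "symmetric_map V" "bounded_map V"
    "\<And>u. sq_int (\<mu> (V u)) f" "\<And>u. ext f (V u) = u" "\<And>x. sq_int (\<mu> x) f \<Longrightarrow> V (ext f x) = x"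
proof -
  obtain c where c: "0 < c" "\<And>x. AE t in \<mu> x. c \<le> \<bar>t\<bar>" using spectral_gap by blast
  have "AE t in \<mu> x. sqrt c \<le> \<bar>f t\<bar>" for x
    using c(2)[of x] by eventually_elim (simp add: abs)
  then show ?thesis using ext_bounded_inverse[OF f, of "sqrt c"] c(1) that by auto
qed

end

lemma self_adjoint_bounded_inverse:
  assumes X: "self_adjoint X" and inv: "has_bounded_inverse X"
  obtains T where "bounded_inverse_operator T X"
proof -
  have sv: "single_valued X" "single_valued (X\<inverse>)" and rng: "Domain (X\<inverse>) = UNIV"
    and lin: "linear_operator X" and adj: "adjoint_operator X = X"
    using assms by (auto simp: self_adjoint_def has_bounded_inverse_def linear_operator_def)
  have "\<forall>y. \<exists>x. (x, y) \<in> X" using rng by (auto simp: set_eq_iff Domain_iff)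
  then obtain T where T: "\<And>y. (T y, y) \<in> X" by metis
  have uniq: "x = T y" if "(x, y) \<in> X" for x y
    using sv(2) that T[of y] by (auto simp: single_valued_def)
  have X_eq: "X = {(T u, u) | u. True}" using T uniq by auto
  have "bounded_inverse_operator T X"
  proof
    show "symmetric_map T"
      unfolding symmetric_map_def clinear_map_def
    proof (intro conjI allI)
      fix x y c
      show "T (x + y) = T x + T y" "T (c *\<^sub>C x) = c *\<^sub>C T x"
        using lin T uniq by (metis linear_operator_def)+
      have "(T y, y) \<in> adjoint_operator X" using T adj by simp
      then show "\<langle>T x, y\<rangle> = \<langle>x, T y\<rangle>" using T[of x] by (force simp: adjoint_operator_def)
    qed
    show "bounded_map T"
      using inv T by (fastforce simp: has_bounded_inverse_def bounded_operator_def bounded_map_def)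
    show "x = 0" if "T x = 0" for x
      using T[of x] that lin sv(1) by (auto simp: linear_operator_def single_valued_def)
  qed (rule X_eq)
  then show ?thesis by (rule that)
qed

text \<open>\<open>bounded_operator\<close> constrains \<open>H\<close> only on its domain. Images
  of a sequence converging to \<open>y\<close> are Cauchy, and the limiting pair satisfies the
  adjoint relation, hence lies in \<open>H\<close> itself.\<close>

lemma self_adjoint_bounded_Domain:
  fixes H :: "'a::complex_hilbert_space operator"
  assumes H: "self_adjoint H" and b: "bounded_operator H"
  shows "Domain H = UNIV"
proof -
  have adj: "adjoint_operator H = H" and dense: "closure (Domain H) = UNIV" and lin: "linear_operator H"
    using H by (auto simp: self_adjoint_def)
  obtain c where c: "\<And>x y. (x, y) \<in> H \<Longrightarrow> norm y \<le> c * norm x"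
    using b by (auto simp: bounded_operator_def)
  have c': "norm y \<le> max c 1 * norm x" if "(x, y) \<in> H" for x y
    by (rule order_trans[OF c[OF that]]) (intro mult_right_mono, auto)
  have "y \<in> Domain H" for y
  proof -
    obtain d where d: "\<And>n. d n \<in> Domain H" "d \<longlonglongrightarrow> y"
      using dense closure_sequential[of y "Domain H"] by auto
    then have "\<forall>n. \<exists>w. (d n, w) \<in> H" by (auto simp: Domain_iff)
    then obtain e where e: "\<And>n. (d n, e n) \<in> H" by metis
    have diff: "norm (e m - e n) \<le> max c 1 * norm (d m - d n)" for m n
    proof -
      have "(d m + (-1) *\<^sub>C d n, e m + (-1) *\<^sub>C e n) \<in> H"
        using e lin unfolding linear_operator_def by blast
      moreover have "(-1) *\<^sub>C z = - z" for z :: 'a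
        using scaleR_eq_scaleC[of "-1" z] by simp
      ultimately show ?thesis using c'[of "d m - d n" "e m - e n"] by simp
    qed
    have "Cauchy e"
    proof (rule CauchyI)
      fix r :: real assume "0 < r"
      then have "0 < r / max c 1" by simp
      then obtain N where N: "\<And>m n. N \<le> m \<Longrightarrow> N \<le> n \<Longrightarrow> norm (d m - d n) < r / max c 1"
        using CauchyD[OF LIMSEQ_imp_Cauchy[OF d(2)]] by metis
      have "norm (e m - e n) < r" if "N \<le> m" "N \<le> n" for m n
      proof -
        have "max c 1 * norm (d m - d n) < r"
          using N[OF that] by (simp add: pos_less_divide_eq mult.commute)
        then show ?thesis using diff[of m n] by simp
      qed
      then show "\<exists>M. \<forall>m\<ge>M. \<forall>n\<ge>M. norm (e m - e n) < r" by blast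
    qed
    then obtain z where z: "e \<longlonglongrightarrow> z" using Cauchy_convergent convergent_def by blast
    have "\<langle>w, y\<rangle> = \<langle>x, z\<rangle>" if "(x, w) \<in> H" for x w
    proof -
      have "\<langle>w, d n\<rangle> = \<langle>x, e n\<rangle>" for n
        using e[of n] that adj by (force simp: adjoint_operator_def)
      then show ?thesis
        using tendsto_cinner[OF tendsto_const d(2), of w] tendsto_cinner[OF tendsto_const z, of x]
          LIMSEQ_unique by (simp, blast)
    qed
    then have "(y, z) \<in> adjoint_operator H" by (auto simp: adjoint_operator_def)
    then show ?thesis using adj by auto
  qed
  then show ?thesis by auto
qed

text \<open>Subtracting 0 leaves the graph of \<open>A\<close> unchanged; without a bounded inverse,
  0 would be a spectral point and force the infimum down to at most 0.\<close>

lemma zero_notin_spectrum: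
  assumes "(INF l \<in> spectrum A. ereal (Re l)) > 0"
  shows "has_bounded_inverse (A :: 'a::complex_hilbert_space operator)"
proof (rule ccontr)
  assume n: "\<not> has_bounded_inverse A"
  have "{(x, y - 0 *\<^sub>C x) | x y. (x, y) \<in> A} = A" by auto
  then have "0 \<in> spectrum A" using n by (simp add: spectrum_def)
  then have "(INF l \<in> spectrum A. ereal (Re l)) \<le> ereal (Re 0)" by (rule INF_lower)
  then show False using assms by (simp add: zero_ereal_def)
qed

theorem theorem2p10:
  fixes A H B :: "'a::complex_hilbert_space operator"
    and b :: "'a \<Rightarrow> 'a \<Rightarrow> complex"
  assumes "self_adjoint A" and "self_adjoint H"
    and "(INF l \<in> spectrum A. ereal (Re l)) > 0"
    and "bounded_operator H" and "has_bounded_inverse H"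
    and b_eq: "\<And>x y. x \<in> Domain (op_sqrt A) \<Longrightarrow> y \<in> Domain (op_sqrt A) \<Longrightarrow>
           b x y = \<langle>op_sqrt A \<cdot> x, H \<cdot> op_sqrt A \<cdot> y\<rangle>"
    and B_eq: "B = {(x, op_sqrt A \<cdot> H \<cdot> op_sqrt A \<cdot> x) | x.
           x \<in> Domain (op_sqrt A) \<and> H \<cdot> op_sqrt A \<cdot> x \<in> Domain (op_sqrt A)}"
    and "Domain (op_sqrt A) = Domain (op_sqrt_abs B)"
  shows "\<forall>x \<in> Domain (op_sqrt A). \<forall>y \<in> Domain (op_sqrt A).
           b x y = \<langle>op_sqrt_abs B \<cdot> x, op_sign B \<cdot> op_sqrt_abs B \<cdot> y\<rangle>"
proof -
  obtain TA where "bounded_inverse_operator TA A"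
    using self_adjoint_bounded_inverse[OF assms(1) zero_notin_spectrum[OF assms(3)]] .
  then interpret A: bounded_inverse_operator TA A .
  obtain K where "bounded_inverse_operator K H"
    using self_adjoint_bounded_inverse[OF assms(2,5)] .
  then interpret H: bounded_inverse_operator K H .

  \<comment> \<open>\<open>H\<close> as a bijection of the whole space with inverse
    \<open>K\<close>\<close>
  define h where "h x = H \<cdot> x" for x
  have svH: "single_valued H" and adjH: "adjoint_operator H = H"
    using assms(2) by (auto simp: self_adjoint_def linear_operator_def)
  have h: "(x, h x) \<in> H" for x
  proof -
    obtain y where "(x, y) \<in> H" using self_adjoint_bounded_Domain[OF assms(2,4)] by (metis DomainE UNIV_I)
    then show ?thesis using op_app_eq[OF svH] by (simp add: h_def)
  qed
  have Kh: "K (h x) = x" for x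
    using h[of x] by (auto simp: H.X_eq)
  have hK: "h (K u) = u" for u
    using op_app_eq[OF svH, of "K u" u] by (auto simp: h_def H.X_eq)
  have h_sym: "\<langle>h x, y\<rangle> = \<langle>x, h y\<rangle>" for x y
    using h[of x] h[of y] adjH by (force simp: adjoint_operator_def)

  \<comment> \<open>The square root \<open>s\<close> of \<open>A\<close>, its domain
    \<open>DS\<close>, and its bounded inverse \<open>V\<close>\<close>
  define s where "s = A.ext sqrt"
  define DS where "DS = {x. sq_int (A.\<mu> x) sqrt}"
  have sqrt_m: "sqrt \<in> borel_measurable borel" by measurable
  have S_eq: "op_sqrt A = {(y, s y) | y. y \<in> DS}"
    using A.spectral_integral_ext[OF sqrt_m]
    by (simp add: op_sqrt_def functional_calculus_def s_def DS_def)
  have domS: "Domain (op_sqrt A) = DS" by (auto simp: S_eq)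
  have S_app: "op_sqrt A \<cdot> x = s x" if "x \<in> DS" for x
    unfolding S_eq using that by (rule op_app_graph)
  have s_sym: "\<langle>s x, y\<rangle> = \<langle>x, s y\<rangle>" if "x \<in> DS" "y \<in> DS" for x y
    using that A.ext_linear(3) by (simp add: s_def DS_def)
  obtain V where V: "symmetric_map V" "bounded_map V" "\<And>u. V u \<in> DS" "\<And>u. s (V u) = u"
      "\<And>x. x \<in> DS \<Longrightarrow> V (s x) = x"
  proof -
    \<comment> \<open>The root function here is odd on the reals, with sqrt (-t) = - sqrt t.\<close>
    have "\<bar>sqrt t\<bar> = sqrt \<bar>t\<bar>" for t by (cases "0 \<le> t") (auto simp: abs_if real_sqrt_minus)
    then obtain V where V: "symmetric_map V" "bounded_map V" "\<And>u. sq_int (A.\<mu> (V u)) sqrt"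
        "\<And>u. A.ext sqrt (V u) = u" "\<And>x. sq_int (A.\<mu> x) sqrt \<Longrightarrow> V (A.ext sqrt x) = x"
      using A.sqrt_bounded_inverse[OF sqrt_m] by metis
    show ?thesis by (rule that[OF V(1,2)]) (simp_all add: s_def DS_def V)
  qed

  \<comment> \<open>The bounded inverse of \<open>B\<close>\<close>
  define G where "G u = V (K (V u))" for u
  \<comment> \<open>\<open>G\<close> is A^(-1/2) H^(-1) A^(-1/2). The two membership conditions in
    the domain of \<open>B\<close> are exactly what lets its three factors be inverted one after
    another.\<close>
  have Bg: "B = {(G u, u) | u. True}"
  proof (intro equalityI subsetI)
    fix p assume "p \<in> B"
    then obtain x where x: "x \<in> DS" "h (s x) \<in> DS" and p: "p = (x, s (h (s x)))"
      unfolding B_eq domS by (auto simp: S_app h_def)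
    then have "x = G (s (h (s x)))" by (simp add: G_def V Kh)
    then show "p \<in> {(G u, u) | u. True}" using p by blast
  next
    fix p assume "p \<in> {(G u, u) | u. True}"
    then obtain u where p: "p = (G u, u)" by auto
    have "s (G u) = K (V u)" by (simp add: G_def V)
    then have "h (s (G u)) = V u" by (simp add: hK)
    then have "G u \<in> DS" "op_sqrt A \<cdot> G u = s (G u)" "H \<cdot> s (G u) \<in> DS" "op_sqrt A \<cdot> H \<cdot> s (G u) = u"
      using V by (auto simp: G_def S_app h_def)
    then show "p \<in> B" unfolding B_eq domS p by force
  qed
  note lV = clinear_mapD[OF symmetric_mapD(1)[OF V(1)]]
  note lK = clinear_mapD[OF symmetric_mapD(1)[OF H.symmetric_T]]
  interpret B: bounded_inverse_operator G B
  proof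
    show "symmetric_map G"
      by (auto simp: symmetric_map_def clinear_map_def G_def lV lK symmetric_mapD(2)[OF V(1)] symmetric_mapD(2)[OF H.symmetric_T])
    show "bounded_map G"
      unfolding G_def by (intro bounded_map_comp[OF V(2)] bounded_map_comp[OF H.bounded_T] V(2))
    show "x = 0" if "G x = 0" for x
    proof -
      have Vinj: "u = 0" if "V u = 0" for u using V(4)[of u] V(4)[of 0] that by (simp add: lV)
      show ?thesis using that Vinj H.inj_T unfolding G_def by metis
    qed
  qed (rule Bg)

  \<comment> \<open>The square root \<open>q\<close> of |B|, the sign \<open>j\<close> of
    \<open>B\<close>, and the bounded inverse \<open>W\<close> of \<open>q\<close>\<close>
  define r :: "real \<Rightarrow> real" where "r t = sqrt \<bar>t\<bar>" for t
  have r_m: "r \<in> borel_measurable borel" unfolding r_def by measurable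
  have sgn_m: "(sgn :: real \<Rightarrow> real) \<in> borel_measurable borel" by measurable
  define q where "q = B.ext r"
  define j where "j = B.ext sgn"
  define DQ where "DQ = {x. sq_int (B.\<mu> x) r}"
  have Q_eq: "op_sqrt_abs B = {(y, q y) | y. y \<in> DQ}"
    using B.spectral_integral_ext[OF r_m]
    by (simp add: op_sqrt_abs_def functional_calculus_def q_def DQ_def r_def)
  have domQ: "DQ = DS" using assms(8) domS by (auto simp: Q_eq)
  have Q_app: "op_sqrt_abs B \<cdot> x = q x" if "x \<in> DS" for x
    unfolding Q_eq domQ using that by (rule op_app_graph)
  have sgn_i: "sq_int (B.\<mu> x) sgn" for x
    by (rule sq_int_bounded[OF B.finite_\<mu> B.borel_measurable_\<mu>[OF sgn_m], where c = 1]) (simp add: sgn_real_def)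
  have J_app: "op_sign B \<cdot> x = j x" for x
    unfolding op_sign_def functional_calculus_def B.spectral_integral_ext[OF sgn_m] j_def
    using sgn_i by (intro op_app_graph)
  have q_sym: "\<langle>q x, y\<rangle> = \<langle>x, q y\<rangle>" if "x \<in> DS" "y \<in> DS" for x y
    using that B.ext_linear(3) by (simp add: q_def DQ_def flip: domQ)
  have j_sym: "\<langle>j x, y\<rangle> = \<langle>x, j y\<rangle>" for x y
    using B.ext_linear(3)[OF sgn_i sgn_i] by (simp add: j_def)
  obtain W where W: "symmetric_map W" "bounded_map W" "\<And>u. W u \<in> DS" "\<And>u. q (W u) = u"
      "\<And>x. x \<in> DS \<Longrightarrow> W (q x) = x"
    using B.sqrt_bounded_inverse[OF r_m] unfolding q_def domQ[symmetric] DQ_def by (auto simp: r_def)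

  \<comment> \<open>Equality of the two forms when the second argument lies in Dom(B)\<close>
  have core: "\<langle>s x, h (s y)\<rangle> = \<langle>q x, j (q y)\<rangle>" if x: "x \<in> DS" and y: "sq_int (B.\<mu> y) (\<lambda>t. t)" and yD: "y \<in> DS" for x y
  proof -
    define u where "u = B.ext (\<lambda>t. t) y"
    have "y = G u" using B.ext_id(3)[OF y] by (simp add: u_def)
    then have "h (s y) = V u" by (simp add: G_def V hK)
    then have left: "\<langle>s x, h (s y)\<rangle> = \<langle>x, u\<rangle>"
      using s_sym[OF x V(3)[of u]] V(4)[of u] by simp
    have yr: "sq_int (B.\<mu> y) r" using yD by (simp add: DQ_def flip: domQ)
    have sr: "sq_int (B.\<mu> y) (\<lambda>t. sgn t * r t)"
      by (rule sq_int_bound[OF yr, where c = 1])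
         (auto intro!: B.borel_measurable_\<mu> borel_measurable_times sgn_m r_m simp: abs_mult sgn_real_def)
    have jq: "j (q y) = B.ext (\<lambda>t. sgn t * r t) y"
      using B.ext_compose(2)[OF sgn_m yr sr] by (simp add: j_def q_def)
    have id: "(\<lambda>t. r t * (sgn t * r t)) = (\<lambda>t. t)"
    proof
      fix t show "r t * (sgn t * r t) = t"
        by (cases t "0::real" rule: linorder_cases) (auto simp: r_def)
    qed
    \<comment> \<open>Square integrability of t = r (sgn r) at \<open>y\<close> puts
      \<open>j (q y)\<close> into the domain of \<open>q\<close>, so \<open>q\<close> can be moved
      across the inner product.\<close>
    have "j (q y) \<in> DS" "q (j (q y)) = u"
      using B.ext_compose[OF r_m sr, unfolded id, OF y] unfolding jq by (simp_all add: q_def u_def DQ_def flip: domQ)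
    then show ?thesis using left q_sym[OF x] by simp
  qed

  \<comment> \<open>Boundedness of A^(1/2) |B|^(-1/2)\<close>
  have linS: "s (x + y) = s x + s y" "s (c *\<^sub>C x) = c *\<^sub>C s x" if "x \<in> DS" "y \<in> DS" for x y c
    using that A.ext_linear(1,2) by (simp_all add: s_def DS_def)
  \<comment> \<open>\<open>W\<close> maps into Dom(|B|^(1/2)), which is Dom(A^(1/2)) by hypothesis,
    so the composition is defined everywhere.\<close>
  have "clinear_map (\<lambda>u. s (W u))"
    by (simp add: clinear_map_def clinear_mapD[OF symmetric_mapD(1)[OF W(1)]] linS[OF W(3) W(3)])
  moreover have "bounded_map (\<lambda>u. s (W u))"
  proof (rule bounded_map_formal_adjoint[OF calculation])
    show "closure DS = UNIV" unfolding DS_def by (rule A.dense_domain[OF sqrt_m])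
    show "\<langle>s (W u), v\<rangle> = \<langle>u, W (s v)\<rangle>" if "v \<in> DS" for u v
      using s_sym[OF W(3) that] by (simp add: symmetric_mapD(2)[OF W(1)])
  qed
  ultimately have sW: "(\<lambda>n. s (W (f n))) \<longlonglongrightarrow> s (W z)" if "f \<longlonglongrightarrow> z" for f z
    using that by (rule bounded_map_tendsto)

  \<comment> \<open>Passage to general second arguments by spectral cutoffs\<close>
  have main: "\<langle>s x, h (s y)\<rangle> = \<langle>q x, j (q y)\<rangle>" if x: "x \<in> DS" and y: "y \<in> DS" for x y
  proof -
    define S where "S n = {t. \<bar>r t\<bar> \<le> real n}" for n :: nat
    define yn where "yn n = spectral_measure B (S n) y" for n
    have yr: "sq_int (B.\<mu> y) r" using y by (simp add: DQ_def flip: domQ)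
    note cut = B.cutoff[OF r_m, folded S_def]
    have ynD: "yn n \<in> DS" for n using cut(2) by (simp add: yn_def DQ_def flip: domQ)
    \<comment> \<open>On \<open>S n\<close> the root of |t| is at most \<open>n\<close>, so |t| is
      at most n^2 and the cutoff lies in Dom(B).\<close>
    have ynB: "sq_int (B.\<mu> (yn n)) (\<lambda>t. t)" for n
    proof -
      have b: "\<bar>t * indicator (S n) t\<bar> \<le> (real n)\<^sup>2" for t
      proof (cases "t \<in> S n")
        case True
        then have "(sqrt \<bar>t\<bar>)\<^sup>2 \<le> (real n)\<^sup>2" by (intro power_mono) (auto simp: S_def r_def)
        then show ?thesis using True by simp
      qed simp
      have "sq_int (B.\<mu> y) (\<lambda>t. t * indicator (S n) t)"
        using b cut(1) by (intro sq_int_bounded[OF B.finite_\<mu>, where c = "(real n)\<^sup>2"] B.borel_measurable_\<mu>) auto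
      from B.ext_compose(1)[OF _ B.sq_int_indicator[OF cut(1)] this] show ?thesis
        by (simp add: yn_def B.ext_indicator cut(1))
    qed
    have q_lim: "(\<lambda>n. q (yn n)) \<longlonglongrightarrow> q y"
      using cut(4)[OF yr] by (simp add: q_def yn_def)
    \<comment> \<open>Writing \<open>s (yn n)\<close> as \<open>s (W (q (yn n)))\<close> reduces
      this to \<open>q_lim\<close> and the bounded map just found.\<close>
    have s_lim: "(\<lambda>n. s (yn n)) \<longlonglongrightarrow> s y"
      using sW[OF q_lim] by (simp add: W(5) ynD y)
    \<comment> \<open>\<open>h\<close> and \<open>j\<close> are moved to the fixed first argument,
      so the limit concerns only \<open>s (yn n)\<close> and \<open>q (yn n)\<close>.\<close>
    have "(\<lambda>n. \<langle>h (s x), s (yn n)\<rangle>) \<longlonglongrightarrow> \<langle>h (s x), s y\<rangle>"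
      by (intro tendsto_cinner tendsto_const s_lim)
    moreover have "\<langle>h (s x), s (yn n)\<rangle> = \<langle>j (q x), q (yn n)\<rangle>" for n
      using core[OF x ynB ynD] by (simp add: h_sym j_sym)
    moreover have "(\<lambda>n. \<langle>j (q x), q (yn n)\<rangle>) \<longlonglongrightarrow> \<langle>j (q x), q y\<rangle>"
      by (intro tendsto_cinner tendsto_const q_lim)
    ultimately have "\<langle>h (s x), s y\<rangle> = \<langle>j (q x), q y\<rangle>"
      using LIMSEQ_unique by (simp, blast)
    then show ?thesis by (simp add: h_sym j_sym)
  qed
  show ?thesis
    using b_eq main unfolding domS by (simp add: S_app Q_app J_app h_def)
qed

end
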